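(* Let $X$ be a Banach function space over $\mathbf{R}^d$ for which there exist $1<r^*<s^*<\infty$ such that $X$ is $r^*$-convex and $s^*$-concave. Then the following are equivalent: (i) $M:X\to X$ and $M:X'\to X'$ are bounded; (ii) there is an $r\in(1,r^*]$ so that $M:(X^r)'\to(X^r)'$ is bounded; (iii) there is an $s\in[s^*,\infty)$ so that $M:X_{1,s}\to X_{1,s}$ is bounded.
   Context: $L^0(\mathbf{R}^d)$ is the space of measurable functions on $\mathbf{R}^d$ (Lebesgue measure, modulo a.e. equality); $q'$ is the Hölder conjugate of $q\in[1,\infty]$. Banach function space over $\mathbf{R}^d$: a vector space $X\subseteq L^0(\mathbf{R}^d)$ with a norm $\|\cdot\|_X$ satisfying: (ideal property) if $f\in X$, $g\in L^0(\mathbf{R}^d)$ and $|g|\le|f|$, then $g\in X$ and $\|g\|_X\le\|f\|_X$; (Fatou property) if $0\le f_n\uparrow f$ with $f_n\in X$ and $\sup_n\|f_n\|_X<\infty$, then $f\in X$ and $\|f\|_X=\sup_n\|f_n\|_X$; (saturation property) every measurable $E\subseteq\mathbf{R}^d$ of positive measure has a measurable subset $F\subseteq E$ of positive measure with $\mathbf{1}_F\in X$. The associate space $X'$ is the space of $g\in L^0(\mathbf{R}^d)$ with $\|g\|_{X'}:=\sup_{\|f\|_X\le1}\int_{\mathbf{R}^d}|fg|<\infty$. $X$ is $p$-convex if $\big\|(|f|^p+|g|^p)^{1/p}\big\|_X\le(\|f\|_X^p+\|g\|_X^p)^{1/p}$ for all $f,g\in X$, and $q$-concave if $(\|f\|_X^q+\|g\|_X^q)^{1/q}\le\big\|(|f|^q+|g|^q)^{1/q}\big\|_X$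 for all $f,g\in X$. For $p\in(0,\infty)$, $X^p:=\{f\in L^0(\mathbf{R}^d):|f|^{1/p}\in X\}$ with $\|f\|_{X^p}:=\big\||f|^{1/p}\big\|_X^p$. For $1\le r<s\le\infty$ and $X$ an $r$-convex and $s$-concave Banach function space, $X_{r,s}:=\big[\big[(X^r)'\big]^{(s/r)'}\big]'$, which is again a Banach function space; in particular $X_{1,s}=[(X')^{s'}]'$. $M$ is the Hardy--Littlewood maximal operator $Mf=\sup_Q\big(\frac1{|Q|}\int_Q|f|\big)\mathbf{1}_Q$, the supremum being over all cubes $Q\subseteq\mathbf{R}^d$. *)

theory Defs
  imports "HOL-Analysis.Analysis"
begin

text \<open>
  Elements of \<open>L\<^sup>0\<close> are represented by real-valued Lebesgue measurable functions.
  Instead of passing to the quotient by almost everywhere equality, every condition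
  below is imposed up to null sets; in particular the ideal property makes
  membership and norm invariant under almost everywhere equality.
  The value of \<open>fnorm X\<close> outside \<open>fcarrier X\<close> carries no meaning.
\<close>

record 'a fspace =
  fcarrier :: "('a \<Rightarrow> real) set"
  fnorm :: "('a \<Rightarrow> real) \<Rightarrow> real"

locale banach_function_space =
  fixes X :: "'a::euclidean_space fspace"
  assumes measurable: "f \<in> fcarrier X \<Longrightarrow> f \<in> borel_measurable lebesgue"
    and zero_mem: "(\<lambda>x. 0) \<in> fcarrier X"
    and add_mem: "f \<in> fcarrier X \<Longrightarrow> g \<in> fcarrier X \<Longrightarrow> (\<lambda>x. f x + g x) \<in> fcarrier X"
    and scale_mem: "f \<in> fcarrier X \<Longrightarrow> (\<lambda>x. c * f x) \<in> fcarrier X"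
    and norm_nonneg: "f \<in> fcarrier X \<Longrightarrow> 0 \<le> fnorm X f"
    and norm_eq_0_iff:
      "f \<in> fcarrier X \<Longrightarrow> fnorm X f = 0 \<longleftrightarrow> (AE x in lebesgue. f x = 0)"
    and norm_scale: "f \<in> fcarrier X \<Longrightarrow> fnorm X (\<lambda>x. c * f x) = \<bar>c\<bar> * fnorm X f"
    and norm_triangle: "f \<in> fcarrier X \<Longrightarrow> g \<in> fcarrier X \<Longrightarrow>
      fnorm X (\<lambda>x. f x + g x) \<le> fnorm X f + fnorm X g"
    and ideal: "f \<in> fcarrier X \<Longrightarrow> g \<in> borel_measurable lebesgue \<Longrightarrow>
      (AE x in lebesgue. \<bar>g x\<bar> \<le> \<bar>f x\<bar>) \<Longrightarrow> g \<in> fcarrier X \<and> fnorm X g \<le> fnorm X f"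
    and fatou: "(\<And>n. F n \<in> fcarrier X) \<Longrightarrow> f \<in> borel_measurable lebesgue \<Longrightarrow>
      (AE x in lebesgue. (\<forall>n. 0 \<le> F n x) \<and> incseq (\<lambda>n. F n x) \<and> (\<lambda>n. F n x) \<longlonglongrightarrow> f x) \<Longrightarrow>
      bdd_above (range (\<lambda>n::nat. fnorm X (F n))) \<Longrightarrow>
      f \<in> fcarrier X \<and> fnorm X f = (SUP n. fnorm X (F n))"
    and saturation: "E \<in> sets lebesgue \<Longrightarrow> emeasure lebesgue E > 0 \<Longrightarrow>
      \<exists>A. A \<in> sets lebesgue \<and> A \<subseteq> E \<and> emeasure lebesgue A > 0 \<and> indicat_real A \<in> fcarrier X"

definition associate_enorm ::
    "'a::euclidean_space fspace \<Rightarrow> ('a \<Rightarrow> real) \<Rightarrow> ennreal" where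
  "associate_enorm X g =
     (SUP f\<in>{f \<in> fcarrier X. fnorm X f \<le> 1}. \<integral>\<^sup>+x. ennreal \<bar>f x * g x\<bar> \<partial>lebesgue)"

definition associate :: "'a::euclidean_space fspace \<Rightarrow> 'a fspace" where
  "associate X =
     \<lparr>fcarrier = {g \<in> borel_measurable lebesgue. associate_enorm X g < \<infinity>},
      fnorm = (\<lambda>g. enn2real (associate_enorm X g))\<rparr>"

text \<open>
  In the next two definitions the function \<open>(|f|\<^sup>p + |g|\<^sup>p)\<^bsup>1/p\<^esup>\<close> lies in \<open>X\<close> by the
  ideal property, being dominated by a constant multiple of \<open>|f| + |g|\<close>.
\<close>

definition p_convex :: "real \<Rightarrow> 'a::euclidean_space fspace \<Rightarrow> bool" where
  "p_convex p X \<longleftrightarrow> (\<forall>f\<in>fcarrier X. \<forall>g\<in>fcarrier X.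
     fnorm X (\<lambda>x. (\<bar>f x\<bar> powr p + \<bar>g x\<bar> powr p) powr (1/p))
       \<le> (fnorm X f powr p + fnorm X g powr p) powr (1/p))"

definition q_concave :: "real \<Rightarrow> 'a::euclidean_space fspace \<Rightarrow> bool" where
  "q_concave q X \<longleftrightarrow> (\<forall>f\<in>fcarrier X. \<forall>g\<in>fcarrier X.
     (fnorm X f powr q + fnorm X g powr q) powr (1/q)
       \<le> fnorm X (\<lambda>x. (\<bar>f x\<bar> powr q + \<bar>g x\<bar> powr q) powr (1/q)))"

definition fpower :: "'a::euclidean_space fspace \<Rightarrow> real \<Rightarrow> 'a fspace" where
  "fpower X p =
     \<lparr>fcarrier = {f \<in> borel_measurable lebesgue. (\<lambda>x. \<bar>f x\<bar> powr (1/p)) \<in> fcarrier X},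
      fnorm = (\<lambda>f. fnorm X (\<lambda>x. \<bar>f x\<bar> powr (1/p)) powr p)\<rparr>"

text \<open>The Hoelder conjugate, for finite exponents \<open>q > 1\<close>.\<close>

definition conjugate_exponent :: "real \<Rightarrow> real" where
  "conjugate_exponent q = q / (q - 1)"

text \<open>The space \<open>X\<^bsub>r,s\<^esub>\<close>, for \<open>1 \<le> r < s < \<infinity>\<close>.\<close>

definition rescaled :: "'a::euclidean_space fspace \<Rightarrow> real \<Rightarrow> real \<Rightarrow> 'a fspace" where
  "rescaled X r s =
     associate (fpower (associate (fpower X r)) (conjugate_exponent (s / r)))"

definition cubes :: "'a::euclidean_space set set" where
  "cubes = {cbox a (a + l *\<^sub>R One) | a l. l > 0}"

text \<open>
  The supremum is the same for closed, open and half-open cubes, since a cube of one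
  kind is contained in cubes of the other kinds of arbitrarily close volume.
\<close>

definition maximal_fun :: "('a::euclidean_space \<Rightarrow> real) \<Rightarrow> 'a \<Rightarrow> ennreal" where
  "maximal_fun f x =
     (SUP Q\<in>cubes. (\<integral>\<^sup>+y\<in>Q. ennreal \<bar>f y\<bar> \<partial>lebesgue) / emeasure lebesgue Q * indicator Q x)"

text \<open>
  Since \<open>maximal_fun f\<close> may take the value \<open>\<infinity>\<close>, its membership in \<open>X\<close> includes
  finiteness almost everywhere.
\<close>

definition maximal_bounded :: "'a::euclidean_space fspace \<Rightarrow> bool" where
  "maximal_bounded X \<longleftrightarrow> (\<exists>C::real. \<forall>f\<in>fcarrier X.
     (AE x in lebesgue. maximal_fun f x < \<infinity>) \<and>
     (\<lambda>x. enn2real (maximal_fun f x)) \<in> fcarrier X \<and>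
     fnorm X (\<lambda>x. enn2real (maximal_fun f x)) \<le> C * fnorm X f)"

end

theory Submission
  imports Defs
begin

text \<open>
  All norms involved are determined by their unit balls, so the argument is carried out for
  sets \<open>B\<close> of functions with values in \<open>[0,\<infinity>]\<close> that are solid and closed under increasing
  limits. Associate spaces become polars, \<open>X\<^sup>r\<close> becomes \<open>ball_power B r\<close>, and boundedness of
  the maximal operator \<open>M\<close> becomes \<open>ball_maximal B\<close>. Infinite values are harmless, because a
  ball is saturated exactly if the elements of its polar are finite almost everywhere.

  Concavity of \<open>X\<close> is convexity of \<open>X'\<close>, \<open>X\<^bsub>1,s\<^esub>\<close> is the space \<open>((X')\<^sup>r)'\<close> with \<open>r = s'\<close>, and
  \<open>X'' = X\<close> by the bipolar theorem (\<open>bipolar_eq\<close>). Hence condition (iii) for \<open>X\<close> is condition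
  (ii) for \<open>X'\<close>, while condition (i) is symmetric in \<open>X\<close> and \<open>X'\<close>. So only the equivalence
  of (i) and (ii) has to be shown, for a space with a convex power
  (\<open>ball_maximal_iff_polar_power\<close>).

  Two tools from harmonic analysis carry this equivalence. First, if \<open>M\<close> is bounded on a
  space, the Rubio de Francia algorithm yields \<open>A\<^sub>1\<close> majorants, and these satisfy a
  reverse Hoelder inequality (\<open>ball_maximal_A1_majorant\<close>); so \<open>M\<close> remains bounded for a
  slightly larger power. Second, the form \<open>\<integral>M(h) u\<close> is dominated by \<open>\<integral>h A(u)\<close>, where
  \<open>A(u)\<close> is a sum of averages of \<open>u\<close> over a sparse family of cubes (\<open>sparse_domination\<close>); this
  replaces the sublinear operator by one that can be moved from one factor to the other.

  From (i) to (ii): for \<open>h\<close> in \<open>(X\<^sup>r)'\<close> and \<open>f\<close> in \<open>X\<^sup>r\<close>, sparse domination leads to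
  \<open>J = \<integral>h g\<^sup>r\<close> with \<open>g\<close> a sparse sum of the \<open>r\<close>-averages of \<open>f\<^bsup>1/r\<^esup>\<close>. The function \<open>h g\<^bsup>r-1\<^esup>\<close> lies in
  \<open>X'\<close> with norm at most \<open>J\<^bsup>1/r'\<^esup>\<close>, and sparseness, the bound for \<open>M\<close> on \<open>X'\<close> and the improved
  bound on \<open>X\<close> give \<open>J \<lesssim> J\<^bsup>1/r'\<^esup>\<close>.

  From (ii) to (i): the Fefferman--Stein inequality
  \<open>\<integral>M(f)\<^sup>r h \<lesssim> \<integral>f\<^sup>r M(h)\<close>, for \<open>h\<close> in \<open>(X\<^sup>r)'\<close>, and \<open>(X\<^sup>r)'' = X\<^sup>r\<close> bound \<open>M\<close> on \<open>X\<close>. For \<open>X'\<close> it suffices to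
  bound sparse operators on \<open>X\<close>, and for this on \<open>L\<^sup>r(w)\<close> with \<open>w\<close> an \<open>A\<^sub>1\<close> majorant of
  an element of \<open>(X\<^sup>r)'\<close>.
\<close>

section \<open>Powers of extended nonnegative reals and Hoelder's inequality\<close>

text \<open>
  Powers with positive exponents. On \<open>[0,\<infinity>]\<close> they are order isomorphisms, which is why they
  commute with suprema.
\<close>

definition epowr :: "ennreal \<Rightarrow> real \<Rightarrow> ennreal" (infixr "epowr" 80) where
  "x epowr a = (if x = top then top else ennreal (enn2real x powr a))"

lemma epowr_top [simp]: "top epowr a = top"
  by (simp add: epowr_def)

lemma epowr_ennreal: "0 \<le> t \<Longrightarrow> ennreal t epowr a = ennreal (t powr a)"
  by (simp add: epowr_def)

lemma epowr_0 [simp]: "0 epowr a = 0"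
  using epowr_ennreal[of 0] by simp

lemma epowr_1 [simp]: "1 epowr a = 1"
  using epowr_ennreal[of 1] by simp

lemma epowr_one [simp]: "x epowr 1 = x"
  by (cases x) (simp_all add: epowr_ennreal)

lemma epowr_epowr [simp]: "(x epowr a) epowr b = x epowr (a * b)"
  by (cases x) (simp_all add: epowr_ennreal powr_powr)

lemma epowr_mono: "x \<le> y \<Longrightarrow> 0 < a \<Longrightarrow> x epowr a \<le> y epowr a"
  by (cases x; cases y) (auto simp: epowr_ennreal top_unique intro!: ennreal_leI powr_mono2)

lemma epowr_le_iff:
  assumes "0 < a"
  shows "x epowr a \<le> y epowr a \<longleftrightarrow> x \<le> y"
proof
  assume "x epowr a \<le> y epowr a"
  then have "(x epowr a) epowr (1/a) \<le> (y epowr a) epowr (1/a)"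
    by (rule epowr_mono) (use assms in simp)
  then show "x \<le> y" using assms by simp
qed (use assms epowr_mono in auto)

lemma epowr_eq_0_iff [simp]: "x epowr a = 0 \<longleftrightarrow> x = 0"
  by (cases x) (auto simp: epowr_ennreal)

lemma epowr_eq_top_iff [simp]: "x epowr a = top \<longleftrightarrow> x = top"
  by (cases x) (auto simp: epowr_ennreal)

lemma epowr_less_top_iff [simp]: "x epowr a < top \<longleftrightarrow> x < top"
  by (metis epowr_eq_top_iff less_top)

lemma epowr_mult: "(x * y) epowr a = x epowr a * y epowr a"
proof (cases "x = 0 \<or> y = 0 \<or> x = top \<or> y = top")
  case True
  then show ?thesis
    by (auto simp: ennreal_mult_top ennreal_top_mult)
next
  case False
  then show ?thesis
    by (cases x; cases y) (auto simp: epowr_ennreal ennreal_mult[symmetric] powr_mult)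
qed

lemma epowr_add: "x epowr (a + b) = x epowr a * x epowr b"
  by (cases x) (auto simp: epowr_ennreal powr_add ennreal_mult[symmetric])

lemma epowr_divide:
  assumes "0 < c"
  shows "(x / ennreal c) epowr a = x epowr a / ennreal (c powr a)"
proof -
  have "(x / ennreal c) epowr a = (x * ennreal (1 / c)) epowr a"
    using assms by (simp add: divide_ennreal_def inverse_ennreal inverse_eq_divide)
  also have "\<dots> = x epowr a * ennreal ((1/c) powr a)"
    using assms by (simp add: epowr_mult epowr_ennreal)
  also have "\<dots> = x epowr a / ennreal (c powr a)"
    using assms by (simp add: divide_ennreal_def inverse_ennreal powr_divide inverse_eq_divide)
  finally show ?thesis .
qed

lemma epowr_add_ge:
  assumes "1 \<le> a"
  shows "x epowr a + y epowr a \<le> (x + y) epowr a"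
proof (cases x; cases y)
  fix r t :: real assume *: "0 \<le> r" "x = ennreal r" "0 \<le> t" "y = ennreal t"
  have "r powr a + t powr a \<le> (r + t) powr a"
  proof (cases "r + t = 0")
    case False
    define s where "s = r + t"
    have s: "s > 0" using False * by (simp add: s_def)
    have 1: "u powr a \<le> (u / s) * s powr a" if "0 \<le> u" "u \<le> s" for u
    proof -
      have "(u / s) powr a \<le> (u / s) powr 1"
        using that s assms by (intro powr_mono') auto
      then have "(u / s) powr a \<le> u / s" using that s by simp
      then have "(u / s) powr a * s powr a \<le> (u / s) * s powr a"
        by (intro mult_right_mono) auto
      then show ?thesis using that s by (simp add: powr_divide)
    qed
    have "r powr a + t powr a \<le> (r / s) * s powr a + (t / s) * s powr a"
      by (intro add_mono 1) (use * in \<open>auto simp: s_def\<close>)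
    also have "\<dots> = ((r + t) / s) * s powr a" by (simp add: add_divide_distrib distrib_right)
    finally show ?thesis using s by (simp add: s_def)
  qed (use * in \<open>auto simp: add_nonneg_eq_0_iff\<close>)
  then show ?thesis using * by (simp add: epowr_ennreal ennreal_plus[symmetric] del: ennreal_plus)
qed auto

lemma epowr_sum_ge:
  assumes "finite I" "1 \<le> a"
  shows "(\<Sum>i\<in>I. x i epowr a) \<le> (\<Sum>i\<in>I. x i) epowr a"
  using assms(1)
proof induction
  case (insert i I)
  then have "(\<Sum>i\<in>insert i I. x i epowr a) \<le> x i epowr a + (\<Sum>i\<in>I. x i) epowr a"
    by (simp add: add_left_mono)
  also have "\<dots> \<le> (x i + (\<Sum>i\<in>I. x i)) epowr a"
    by (rule epowr_add_ge[OF assms(2)])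
  finally show ?case using insert by simp
qed simp

lemma SUP_epowr:
  assumes "0 < a" "I \<noteq> {}"
  shows "(SUP i\<in>I. f i) epowr a = (SUP i\<in>I. f i epowr a)"
proof (rule antisym)
  have "(SUP i\<in>I. f i) \<le> (SUP i\<in>I. f i epowr a) epowr (1/a)"
  proof (rule SUP_least)
    fix i assume "i \<in> I"
    then have "(f i epowr a) epowr (1/a) \<le> (SUP i\<in>I. f i epowr a) epowr (1/a)"
      using assms by (intro epowr_mono SUP_upper) auto
    then show "f i \<le> (SUP i\<in>I. f i epowr a) epowr (1/a)" using assms by simp
  qed
  then have "(SUP i\<in>I. f i) epowr a \<le> ((SUP i\<in>I. f i epowr a) epowr (1/a)) epowr a"
    using assms by (intro epowr_mono) auto
  then show "(SUP i\<in>I. f i) epowr a \<le> (SUP i\<in>I. f i epowr a)" using assms by simp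
  show "(SUP i\<in>I. f i epowr a) \<le> (SUP i\<in>I. f i) epowr a"
    using assms by (intro SUP_least epowr_mono SUP_upper) auto
qed

lemma borel_measurable_epowr [measurable (raw)]:
  assumes [measurable]: "f \<in> borel_measurable M"
  shows "(\<lambda>x. f x epowr a) \<in> borel_measurable M"
  unfolding epowr_def by measurable

lemma indicator_epowr: "(indicator A x :: ennreal) epowr a = indicator A x"
  by (simp add: indicator_def)

lemma young_ennreal:
  assumes "1 < p" "1 < q" "1/p + 1/q = 1"
  shows "x * y \<le> x epowr p * ennreal (1/p) + y epowr q * ennreal (1/q)"
proof (cases x; cases y)
  fix r t :: real assume *: "0 \<le> r" "x = ennreal r" "0 \<le> t" "y = ennreal t"
  have "r * t \<le> r powr p / p + t powr q / q"
    using Youngs_inequality[of p q r t] assms * by simp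
  then show ?thesis using * assms
    by (simp add: epowr_ennreal ennreal_plus[symmetric] ennreal_mult[symmetric] del: ennreal_plus)
next
  fix r assume *: "0 \<le> r" "x = ennreal r" "y = top"
  then show ?thesis using assms by (auto simp: ennreal_top_mult ennreal_mult_top)
next
  assume *: "x = top"
  then show ?thesis using assms by (auto simp: ennreal_top_mult)
qed (use assms in \<open>auto simp: ennreal_top_mult\<close>)

text \<open>For the product of two functions of norm one this is Young's inequality, integrated.\<close>

lemma Hoelder_nn_integral:
  assumes [measurable]: "f \<in> borel_measurable M" "g \<in> borel_measurable M"
    and pq: "1 < p" "1 < q" "1/p + 1/q = 1"
  shows "(\<integral>\<^sup>+x. f x * g x \<partial>M) \<le>
    (\<integral>\<^sup>+x. f x epowr p \<partial>M) epowr (1/p) * (\<integral>\<^sup>+x. g x epowr q \<partial>M) epowr (1/q)"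
proof -
  define A where "A = (\<integral>\<^sup>+x. f x epowr p \<partial>M)"
  define B where "B = (\<integral>\<^sup>+x. g x epowr q \<partial>M)"
  consider "A = 0 \<or> B = 0" | "A \<noteq> 0" "B \<noteq> 0" "A = top \<or> B = top" | "A \<noteq> 0" "B \<noteq> 0" "A < top" "B < top"
    using less_top by blast
  then show ?thesis
  proof cases
    case 1
    then have "AE x in M. f x * g x = 0"
      using pq by (auto simp: A_def B_def nn_integral_0_iff_AE)
    then have "(\<integral>\<^sup>+x. f x * g x \<partial>M) = 0"
      by (subst nn_integral_0_iff_AE) auto
    then show ?thesis by simp
  next
    case 2
    then have "A epowr (1/p) * B epowr (1/q) = top"
      by (auto simp: ennreal_top_mult ennreal_mult_top)
    then show ?thesis by (simp add: A_def B_def)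
  next
    case 3
    define a where "a = enn2real A powr (1/p)"
    define b where "b = enn2real B powr (1/q)"
    have A: "0 < enn2real A" "A = ennreal (enn2real A)" "0 < enn2real B" "B = ennreal (enn2real B)"
      using 3 by (simp_all add: enn2real_positive_iff zero_less_iff_neq_zero)
    have ab: "0 < a" "0 < b" using A by (auto simp: a_def b_def)
    have ap: "a powr p = enn2real A" "b powr q = enn2real B"
      using A pq by (auto simp: a_def b_def powr_powr)
    have "(\<integral>\<^sup>+x. f x * g x \<partial>M) = (\<integral>\<^sup>+x. ennreal (a * b) * (f x / ennreal a * (g x / ennreal b)) \<partial>M)"
    proof (rule nn_integral_cong)
      fix x
      have e: "f x = ennreal a * (f x / ennreal a)" "g x = ennreal b * (g x / ennreal b)"
        using ab by (simp_all add: ennreal_times_divide mult_divide_eq_ennreal mult.commute[of "ennreal _"])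
      show "f x * g x = ennreal (a * b) * (f x / ennreal a * (g x / ennreal b))"
        apply (subst e(1), subst e(2)) using ab by (simp add: ennreal_mult mult_ac)
    qed
    also have "\<dots> = ennreal (a * b) * (\<integral>\<^sup>+x. f x / ennreal a * (g x / ennreal b) \<partial>M)"
      by (rule nn_integral_cmult) measurable
    also have "(\<integral>\<^sup>+x. f x / ennreal a * (g x / ennreal b) \<partial>M) \<le>
      (\<integral>\<^sup>+x. (f x / ennreal a) epowr p * ennreal (1/p) + (g x / ennreal b) epowr q * ennreal (1/q) \<partial>M)"
      by (intro nn_integral_mono young_ennreal pq)
    also have "\<dots> = (\<integral>\<^sup>+x. f x epowr p / A * ennreal (1/p) + g x epowr q / B * ennreal (1/q) \<partial>M)"
      using ab ap A by (simp add: epowr_divide)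
    also have "\<dots> = A / A * ennreal (1/p) + B / B * ennreal (1/q)"
      by (simp add: nn_integral_add nn_integral_multc nn_integral_divide A_def B_def)
    also have "\<dots> = 1" using 3 pq by (simp add: ennreal_divide_self ennreal_plus[symmetric] del: ennreal_plus)
    finally have "(\<integral>\<^sup>+x. f x * g x \<partial>M) \<le> ennreal a * ennreal b"
      using ab by (simp add: mult_left_mono ennreal_mult)
    also have "\<dots> = A epowr (1/p) * B epowr (1/q)"
      using A by (metis a_def b_def epowr_ennreal less_imp_le)
    finally show ?thesis by (simp add: A_def B_def)
  qed
qed

lemma Hoelder_weighted:
  assumes [measurable]: "f \<in> borel_measurable M" "g \<in> borel_measurable M" "h \<in> borel_measurable M"
    and pq: "1 < p" "1 < q" "1/p + 1/q = 1"
  shows "(\<integral>\<^sup>+x. h x * (f x * g x) \<partial>M) \<le>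
    (\<integral>\<^sup>+x. h x * f x epowr p \<partial>M) epowr (1/p) * (\<integral>\<^sup>+x. h x * g x epowr q \<partial>M) epowr (1/q)"
proof -
  have "h x * (f x * g x) = (h x epowr (1/p) * f x) * (h x epowr (1/q) * g x)" for x
    using epowr_add[of "h x" "1/p" "1/q"] pq by (simp add: mult_ac)
  then have "(\<integral>\<^sup>+x. h x * (f x * g x) \<partial>M) = (\<integral>\<^sup>+x. (h x epowr (1/p) * f x) * (h x epowr (1/q) * g x) \<partial>M)"
    by simp
  also have "\<dots> \<le> (\<integral>\<^sup>+x. (h x epowr (1/p) * f x) epowr p \<partial>M) epowr (1/p) *
     (\<integral>\<^sup>+x. (h x epowr (1/q) * g x) epowr q \<partial>M) epowr (1/q)"
    by (rule Hoelder_nn_integral) (use pq in measurable)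
  finally show ?thesis using pq by (simp add: epowr_mult)
qed

text \<open>
  The device that turns a self-referential estimate into a bound: a finite quantity that
  is dominated by a power of itself of order less than one is bounded.
\<close>

lemma absorb_epowr:
  assumes "I \<le> K * I epowr (1/q)" "I < top" "1 < p" "1/p + 1/q = 1"
  shows "I \<le> K epowr p"
proof (cases "I = 0")
  case False
  have "I epowr (1/p) * I epowr (1/q) = I"
    using epowr_add[of I "1/p" "1/q"] assms by simp
  then have "I epowr (1/q) * I epowr (1/p) \<le> I epowr (1/q) * K"
    using assms(1) by (simp add: mult.commute)
  then have "I epowr (1/p) \<le> K"
    using False assms(2) by (subst (asm) ennreal_mult_le_mult_iff) auto
  then have "(I epowr (1/p)) epowr p \<le> K epowr p" using assms by (intro epowr_mono) auto
  then show ?thesis using assms by simp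
qed simp

section \<open>Cubes, averages and the maximal function\<close>

declare emeasure_completion [simp del]

text \<open>
  A cube is encoded by its lower corner and its side length, so that families of cubes are
  sets of pairs and their sides can be compared.
\<close>

definition cube :: "'a::euclidean_space \<times> real \<Rightarrow> 'a set" where
  "cube q = cbox (fst q) (fst q + snd q *\<^sub>R One)"

definition tripled :: "'a::euclidean_space \<times> real \<Rightarrow> 'a \<times> real" where
  "tripled q = (fst q - snd q *\<^sub>R One, 3 * snd q)"

definition avg :: "('a::euclidean_space \<Rightarrow> ennreal) \<Rightarrow> 'a \<times> real \<Rightarrow> ennreal" where
  "avg F q = (\<integral>\<^sup>+x\<in>cube q. F x \<partial>lebesgue) / emeasure lebesgue (cube q)"

text \<open>
  The maximal operator on functions with values in \<open>[0,\<infinity>]\<close>: in this form it can be iterated and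
  commutes with increasing limits.
\<close>

definition hl_max :: "('a::euclidean_space \<Rightarrow> ennreal) \<Rightarrow> 'a \<Rightarrow> ennreal" where
  "hl_max F x = (SUP q\<in>{q. 0 < snd q}. avg F q * indicator (cube q) x)"

lemma maximal_fun_eq_hl_max:
  fixes f :: "'a::euclidean_space \<Rightarrow> real"
  shows "maximal_fun f = hl_max (\<lambda>y. ennreal \<bar>f y\<bar>)"
proof
  fix x :: 'a
  have eq: "cubes = cube ` {q::'a \<times> real. 0 < snd q}"
    unfolding cubes_def cube_def image_def by auto
  show "maximal_fun f x = hl_max (\<lambda>y. ennreal \<bar>f y\<bar>) x"
    unfolding maximal_fun_def hl_max_def avg_def eq image_image ..
qed

lemma mem_cube: "x \<in> cube q \<longleftrightarrow> (\<forall>i\<in>Basis. fst q \<bullet> i \<le> x \<bullet> i \<and> x \<bullet> i \<le> fst q \<bullet> i + snd q)"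
  by (auto simp: cube_def mem_box inner_add_left inner_sum_left_Basis)

lemma mem_interior_cube:
  "x \<in> interior (cube q) \<longleftrightarrow> (\<forall>i\<in>Basis. fst q \<bullet> i < x \<bullet> i \<and> x \<bullet> i < fst q \<bullet> i + snd q)"
  by (auto simp: cube_def interior_cbox mem_box inner_add_left inner_sum_left_Basis)

lemma cube_measurable [measurable, simp]: "cube q \<in> sets lebesgue"
  by (simp add: cube_def)

lemma emeasure_cube:
  fixes q :: "'a::euclidean_space \<times> real"
  assumes "0 \<le> snd q"
  shows "emeasure lebesgue (cube q) = ennreal (snd q ^ DIM('a))"
  using assms by (simp add: cube_def emeasure_completion emeasure_lborel_cbox_eq inner_add_left inner_sum_left_Basis algebra_simps)

lemma emeasure_cube_pos:
  assumes "0 < snd q"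
  shows "emeasure lebesgue (cube q) \<noteq> 0" "emeasure lebesgue (cube q) < top"
  using assms by (auto simp: emeasure_cube)

lemma snd_tripled [simp]: "snd (tripled q) = 3 * snd q"
  by (simp add: tripled_def)

lemma emeasure_tripled:
  fixes q :: "'a::euclidean_space \<times> real"
  assumes "0 \<le> snd q"
  shows "emeasure lebesgue (cube (tripled q)) = 3 ^ DIM('a) * emeasure lebesgue (cube q)"
  using assms by (simp add: emeasure_cube power_mult_distrib ennreal_mult ennreal_power[symmetric])

lemma cube_subset_tripled:
  assumes "cube q \<inter> cube p \<noteq> {}" "snd q \<le> snd p" "0 \<le> snd q"
  shows "cube q \<subseteq> cube (tripled p)"
proof
  fix x assume x: "x \<in> cube q"
  from assms obtain y where "y \<in> cube q" "y \<in> cube p" by auto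
  with x assms show "x \<in> cube (tripled p)"
    unfolding mem_cube tripled_def
    by (simp add: inner_diff_left inner_sum_left_Basis) (smt (verit, best))
qed

lemma interior_cube_subset_interior_tripled:
  assumes "0 \<le> snd q"
  shows "interior (cube q) \<subseteq> interior (cube (tripled q))"
  unfolding subset_iff mem_interior_cube tripled_def using assms
  by (simp add: inner_diff_left inner_sum_left_Basis) (smt (verit, best))

lemma set_nn_integral_cube:
  assumes "0 < snd q"
  shows "(\<integral>\<^sup>+x\<in>cube q. F x \<partial>lebesgue) = avg F q * emeasure lebesgue (cube q)"
  using emeasure_cube_pos[OF assms]
  by (simp add: avg_def ennreal_divide_times ennreal_divide_self[OF emeasure_cube_pos(1)[OF assms]])

lemma avg_le_hl_max: "0 < snd q \<Longrightarrow> x \<in> cube q \<Longrightarrow> avg F q \<le> hl_max F x"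
  unfolding hl_max_def by (rule SUP_upper2[of q]) auto

lemma hl_max_leI:
  assumes "\<And>q. 0 < snd q \<Longrightarrow> x \<in> cube q \<Longrightarrow> avg F q \<le> c"
  shows "hl_max F x \<le> c"
  unfolding hl_max_def using assms by (intro SUP_least) (auto simp: indicator_def)

lemma less_hl_maxE:
  assumes "t < hl_max F x"
  obtains q where "0 < snd q" "x \<in> cube q" "t < avg F q"
  using assms hl_max_leI[of x F t] by (meson not_less)

lemma avg_mono_AE: "AE x in lebesgue. F x \<le> G x \<Longrightarrow> avg F q \<le> avg G q"
  unfolding avg_def by (intro divide_right_mono_ennreal nn_integral_mono_AE) (auto elim!: eventually_mono intro: mult_right_mono)

lemma avg_mono: "(\<And>x. F x \<le> G x) \<Longrightarrow> avg F q \<le> avg G q"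
  by (rule avg_mono_AE) auto

lemma hl_max_mono_AE: "AE x in lebesgue. F x \<le> G x \<Longrightarrow> hl_max F x \<le> hl_max G x"
  unfolding hl_max_def by (intro SUP_mono') (auto intro: mult_right_mono avg_mono_AE)

lemma hl_max_mono: "(\<And>x. F x \<le> G x) \<Longrightarrow> hl_max F x \<le> hl_max G x"
  by (rule hl_max_mono_AE) auto

lemma hl_max_cong_AE: "AE x in lebesgue. F x = G x \<Longrightarrow> hl_max F = hl_max G"
  by (intro ext antisym hl_max_mono_AE) auto

lemma avg_cmult:
  assumes [measurable]: "F \<in> borel_measurable lebesgue"
  shows "avg (\<lambda>x. c * F x) q = c * avg F q"
  unfolding avg_def by (simp add: mult.assoc nn_integral_cmult ennreal_times_divide)

lemma hl_max_cmult:
  assumes [measurable]: "F \<in> borel_measurable lebesgue"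
  shows "hl_max (\<lambda>x. c * F x) x = c * hl_max F x"
  unfolding hl_max_def by (simp add: avg_cmult SUP_mult_left_ennreal mult.assoc)

lemma avg_const: "0 < snd q \<Longrightarrow> avg (\<lambda>x. c) q = c"
  using emeasure_cube_pos[of q]
  by (simp add: avg_def nn_integral_cmult ennreal_times_divide[symmetric] ennreal_divide_self)

lemma hl_max_const_le: "hl_max (\<lambda>x. c) x \<le> c"
  by (intro hl_max_leI) (simp add: avg_const)

lemma hl_max_bounded: "(\<And>x. F x \<le> c) \<Longrightarrow> hl_max F x \<le> c"
  using hl_max_mono[of F "\<lambda>_. c" x] hl_max_const_le[of c x] by (auto intro: order_trans)

lemma avg_suminf:
  assumes [measurable]: "\<And>n::nat. F n \<in> borel_measurable lebesgue"
  shows "avg (\<lambda>x. \<Sum>n. F n x) q = (\<Sum>n. avg (F n) q)"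
proof -
  have "(\<integral>\<^sup>+x\<in>cube q. (\<Sum>n. F n x) \<partial>lebesgue) = (\<Sum>n. \<integral>\<^sup>+x\<in>cube q. F n x \<partial>lebesgue)"
    by (simp add: ennreal_suminf_multc[symmetric] nn_integral_suminf del: ennreal_suminf_multc)
  then show ?thesis by (simp add: avg_def)
qed

lemma hl_max_suminf_le:
  assumes [measurable]: "\<And>n::nat. F n \<in> borel_measurable lebesgue"
  shows "hl_max (\<lambda>x. \<Sum>n. F n x) x \<le> (\<Sum>n. hl_max (F n) x)"
proof (rule hl_max_leI)
  fix q :: "'a \<times> real" assume "0 < snd q" "x \<in> cube q"
  then show "avg (\<lambda>x. \<Sum>n. F n x) q \<le> (\<Sum>n. hl_max (F n) x)"
    unfolding avg_suminf[OF assms] by (intro suminf_le avg_le_hl_max) auto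
qed

lemma avg_add:
  assumes [measurable]: "F \<in> borel_measurable lebesgue" "G \<in> borel_measurable lebesgue"
  shows "avg (\<lambda>x. F x + G x) q = avg F q + avg G q"
  unfolding avg_def by (simp add: distrib_right nn_integral_add add_divide_distrib_ennreal)

lemma hl_max_add_le:
  assumes [measurable]: "F \<in> borel_measurable lebesgue" "G \<in> borel_measurable lebesgue"
  shows "hl_max (\<lambda>x. F x + G x) x \<le> hl_max F x + hl_max G x"
  by (rule hl_max_leI) (auto simp: avg_add intro!: add_mono avg_le_hl_max)

lemma avg_SUP:
  assumes [measurable]: "\<And>n::nat. F n \<in> borel_measurable lebesgue" and "incseq F"
  shows "avg (\<lambda>x. SUP n. F n x) q = (SUP n. avg (F n) q)"
proof -
  have "incseq (\<lambda>n x. F n x * indicator (cube q) x)"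
    using assms(2) by (auto simp: incseq_def le_fun_def intro!: mult_right_mono)
  then have "(\<integral>\<^sup>+x\<in>cube q. (SUP n. F n x) \<partial>lebesgue) = (SUP n. \<integral>\<^sup>+x\<in>cube q. F n x \<partial>lebesgue)"
    by (subst nn_integral_monotone_convergence_SUP[symmetric]) (auto simp: SUP_mult_right_ennreal)
  then show ?thesis by (simp add: avg_def SUP_divide_ennreal)
qed

lemma hl_max_SUP:
  assumes "\<And>n::nat. F n \<in> borel_measurable lebesgue" and "incseq F"
  shows "hl_max (\<lambda>x. SUP n. F n x) x = (SUP n. hl_max (F n) x)"
  unfolding hl_max_def avg_SUP[OF assms] SUP_mult_right_ennreal
  by (rule SUP_commute)

lemma incseq_hl_max: "incseq F \<Longrightarrow> incseq (\<lambda>n. hl_max (F n))"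
  by (auto simp: incseq_def le_fun_def intro!: hl_max_mono)

text \<open>
  A slight enlargement of a closed cube changes its volume by a factor close to one, so
  the points where the maximal function exceeds a level may be taken interior to the
  cubes that witness this; hence the maximal function is lower semicontinuous.
\<close>

lemma avg_enlarge:
  fixes q :: "'a::euclidean_space \<times> real"
  assumes q: "0 < snd q" and t: "t < avg F q"
  obtains p where "0 < snd p" "cube q \<subseteq> interior (cube p)" "t < avg F p"
proof -
  define E where "E h = (fst q - h *\<^sub>R One, snd q + 2 * h)" for h
  have E: "0 < snd (E h)" "cube q \<subseteq> interior (cube (E h))" if "0 < h" for h
  proof -
    show "0 < snd (E h)" using that q by (simp add: E_def)
    show "cube q \<subseteq> interior (cube (E h))"
      using that unfolding subset_iff mem_interior_cube mem_cube E_def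
      by (simp add: inner_diff_left inner_sum_left_Basis) (smt (verit, best))
  qed
  define I where "I = (\<integral>\<^sup>+x\<in>cube q. F x \<partial>lebesgue)"
  have ge: "I / ennreal ((snd q + 2 * h) ^ DIM('a)) \<le> avg F (E h)" if "0 < h" for h
  proof -
    have "I \<le> (\<integral>\<^sup>+x\<in>cube (E h). F x \<partial>lebesgue)"
      unfolding I_def using E(2)[OF that] interior_subset[of "cube (E h)"]
      by (intro nn_integral_mono mult_left_mono) (auto simp: indicator_def)
    moreover have "emeasure lebesgue (cube (E h)) = ennreal ((snd q + 2 * h) ^ DIM('a))"
      using emeasure_cube[of "E h"] E(1)[OF that] by (simp add: E_def)
    ultimately show ?thesis by (simp add: avg_def divide_right_mono_ennreal)
  qed
  have "\<exists>h>0. t < I / ennreal ((snd q + 2 * h) ^ DIM('a))"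
  proof (cases I)
    case top
    then show ?thesis using t by (intro exI[of _ 1]) (auto simp: ennreal_top_divide less_top[symmetric])
  next
    case (real i)
    obtain s where s: "0 \<le> s" "t = ennreal s"
      using t less_top_ennreal[of t] less_le_trans[OF t top_greatest] by auto
    have "avg F q = ennreal (i / snd q ^ DIM('a))"
      using real q by (simp add: avg_def emeasure_cube I_def[symmetric] divide_ennreal)
    then have "s < i / snd q ^ DIM('a)" using t s by (simp add: ennreal_less_iff)
    moreover have "((\<lambda>h. i / (snd q + 2 * h) ^ DIM('a)) \<longlongrightarrow> i / (snd q + 2 * 0) ^ DIM('a)) (at_right 0)"
      using q by (intro tendsto_intros) auto
    ultimately have "eventually (\<lambda>h. s < i / (snd q + 2 * h) ^ DIM('a)) (at_right 0)"
      by (intro order_tendstoD(1)) auto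
    then have "eventually (\<lambda>h. s < i / (snd q + 2 * h) ^ DIM('a) \<and> 0 < h) (at_right 0)"
      by (intro eventually_conj) (auto simp: eventually_at_right_less)
    from eventually_happens'[OF trivial_limit_at_right_real this]
    obtain h where "s < i / (snd q + 2 * h) ^ DIM('a)" "0 < h"
      by blast
    then show ?thesis using real s q
      by (intro exI[of _ h]) (simp add: divide_ennreal ennreal_less_iff)
  qed
  then obtain h where h: "h > 0" "t < I / ennreal ((snd q + 2 * h) ^ DIM('a))" by auto
  show ?thesis
    by (rule that[OF E(1)[OF h(1)] E(2)[OF h(1)]]) (rule less_le_trans[OF h(2) ge[OF h(1)]])
qed

lemma less_hl_max_interiorE:
  assumes "t < hl_max F x"
  obtains q where "0 < snd q" "x \<in> interior (cube q)" "t < avg F q"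
proof -
  obtain q where q: "0 < snd q" "x \<in> cube q" "t < avg F q"
    using assms by (rule less_hl_maxE)
  obtain p where "0 < snd p" "cube q \<subseteq> interior (cube p)" "t < avg F p"
    using q(1,3) by (rule avg_enlarge)
  with q(2) show ?thesis by (intro that) auto
qed

lemma open_hl_max_greater: "open {x. t < hl_max F x}"
proof (subst open_subopen, rule ballI)
  fix x assume "x \<in> {x. t < hl_max F x}"
  then obtain q where q: "0 < snd q" "x \<in> interior (cube q)" "t < avg F q"
    using less_hl_max_interiorE by blast
  have "interior (cube q) \<subseteq> {x. t < hl_max F x}"
  proof
    fix y assume "y \<in> interior (cube q)"
    then have "y \<in> cube q" using interior_subset by blast
    then show "y \<in> {x. t < hl_max F x}"
      using less_le_trans[OF q(3) avg_le_hl_max[OF q(1)]] by simp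
  qed
  then show "\<exists>T. open T \<and> x \<in> T \<and> T \<subseteq> {x. t < hl_max F x}"
    using q(2) open_interior by blast
qed

lemma measurable_hl_max [measurable]: "hl_max F \<in> borel_measurable lebesgue"
proof (rule borel_measurableI_greater)
  fix t
  have "{x. t < hl_max F x} \<in> sets lborel"
    using open_hl_max_greater[of t F] by (simp add: borel_open)
  from sets_completionI_sets[OF this]
  show "{x \<in> space lebesgue. t < hl_max F x} \<in> sets lebesgue" by simp
qed

section \<open>Covering by disjoint cubes and the weak-type inequality\<close>

lemma sets_hl_max_greater [measurable, simp]: "{x. t < hl_max f x} \<in> sets lebesgue"
proof -
  have "{x \<in> space lebesgue. t < hl_max f x} \<in> sets lebesgue" by measurable
  then show ?thesis by simp
qed

lemma sum_nn_integral_overlap: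
  assumes "finite I" and [measurable]: "\<And>i. i \<in> I \<Longrightarrow> A i \<in> sets M" "G \<in> borel_measurable M"
    and N: "\<And>x. (\<Sum>i\<in>I. indicator (A i) x) \<le> (N :: ennreal)"
  shows "(\<Sum>i\<in>I. \<integral>\<^sup>+x\<in>A i. G x \<partial>M) \<le> N * (\<integral>\<^sup>+x. G x \<partial>M)"
proof -
  have "(\<Sum>i\<in>I. \<integral>\<^sup>+x\<in>A i. G x \<partial>M) = (\<integral>\<^sup>+x. (\<Sum>i\<in>I. G x * indicator (A i) x) \<partial>M)"
    by (rule nn_integral_sum[symmetric]) measurable
  also have "\<dots> \<le> (\<integral>\<^sup>+x. N * G x \<partial>M)"
    by (intro nn_integral_mono) (simp add: sum_distrib_left[symmetric] mult.commute[of N] mult_left_mono N)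
  also have "\<dots> = N * (\<integral>\<^sup>+x. G x \<partial>M)" by (rule nn_integral_cmult) measurable
  finally show ?thesis .
qed

lemma sum_indicator_disjoint_le:
  assumes "finite I" "disjoint_family_on A I"
  shows "(\<Sum>i\<in>I. indicator (A i) x) \<le> (1 :: ennreal)"
proof -
  have "(\<Sum>i\<in>I. indicator (A i) x) = (indicator (\<Union>i\<in>I. A i) x :: ennreal)"
    using assms by (simp add: indicator_UN_disjoint)
  then show ?thesis by (simp add: indicator_def)
qed

lemma nn_integral_incseq_sets:
  assumes [measurable]: "\<And>n::nat. C n \<in> sets M" "u \<in> borel_measurable M" and "incseq C"
  shows "(\<integral>\<^sup>+x\<in>(\<Union>n. C n). u x \<partial>M) = (SUP n. \<integral>\<^sup>+x\<in>C n. u x \<partial>M)"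
proof -
  have "(SUP n. u x * indicator (C n) x) = u x * indicator (\<Union>n. C n) x" for x
    unfolding SUP_mult_left_ennreal[symmetric]
  proof (rule arg_cong[where f = "\<lambda>y. u x * y"])
    show "(SUP n. indicator (C n) x) = (indicator (\<Union>n. C n) x :: ennreal)"
    proof (cases "x \<in> (\<Union>n. C n)")
      case True
      then obtain n where "x \<in> C n" by auto
      then show ?thesis using True
        by (intro antisym SUP_least SUP_upper2[of n]) (auto simp: indicator_def)
    qed (auto simp: indicator_def)
  qed
  moreover have "incseq (\<lambda>n x. u x * indicator (C n) x)"
    using \<open>incseq C\<close> unfolding incseq_def le_fun_def
    by (auto intro!: mult_left_mono simp: indicator_def)
  ultimately show ?thesis
    by (subst nn_integral_monotone_convergence_SUP[symmetric]) (auto simp: fun_eq_iff)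
qed

lemma open_Int_closed_exhaustion:
  fixes U :: "'a::euclidean_space set"
  assumes "open U" "closed A"
  obtains C :: "nat \<Rightarrow> 'a set" where "\<And>n. compact (C n)" "incseq C" "(\<Union>n. C n) = U \<inter> A"
proof -
  obtain C where C: "\<And>n. compact (C n)" "\<And>n. C n \<subseteq> U" "\<And>n. C n \<subseteq> interior (C (Suc n))" "\<Union>(range C) = U"
    using open_Union_compact_subsets[OF assms(1)] by metis
  show ?thesis
  proof
    show "compact (C n \<inter> A)" for n using C(1) assms(2) by (rule compact_Int_closed)
    show "incseq (\<lambda>n. C n \<inter> A)"
      using C(3) interior_subset by (intro incseq_SucI) blast
    show "(\<Union>n. C n \<inter> A) = U \<inter> A" using C(4) by blast
  qed
qed

lemma compact_lebesgue [simp]: "compact K \<Longrightarrow> (K :: 'a::euclidean_space set) \<in> sets lebesgue"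
  using sets_completionI_sets[of K lborel] by (simp add: borel_compact)

lemma nn_integral_open_leI:
  fixes U :: "'a::euclidean_space set"
  assumes "open U" and [measurable]: "u \<in> borel_measurable lebesgue"
    and le: "\<And>K. compact K \<Longrightarrow> K \<subseteq> U \<Longrightarrow> (\<integral>\<^sup>+x\<in>K. u x \<partial>lebesgue) \<le> B"
  shows "(\<integral>\<^sup>+x\<in>U. u x \<partial>lebesgue) \<le> B"
proof -
  obtain C :: "nat \<Rightarrow> 'a set" where C: "\<And>n. compact (C n)" "incseq C" "(\<Union>n. C n) = U \<inter> UNIV"
    using open_Int_closed_exhaustion[OF assms(1) closed_UNIV] by metis
  have "(\<integral>\<^sup>+x\<in>(\<Union>n. C n). u x \<partial>lebesgue) = (SUP n. \<integral>\<^sup>+x\<in>C n. u x \<partial>lebesgue)"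
    using C by (intro nn_integral_incseq_sets) auto
  also have "\<dots> \<le> B" using C by (intro SUP_least le) auto
  finally show ?thesis using C(3) by simp
qed

text \<open>Selecting the largest cube and discarding all cubes that meet it, repeatedly.\<close>

lemma Vitali_cubes_finite:
  assumes "finite I" "\<And>q. q \<in> I \<Longrightarrow> 0 < snd q"
  shows "\<exists>J\<subseteq>I. disjoint_family_on cube J \<and> (\<forall>q\<in>I. \<exists>p\<in>J. cube q \<subseteq> cube (tripled p))"
  using assms
proof (induction I rule: finite_psubset_induct)
  case (psubset I)
  show ?case
  proof (cases "I = {}")
    case False
    then have "Max (snd ` I) \<in> snd ` I" using psubset(1) by (intro Max_in) auto
    then obtain p where p: "p \<in> I" "snd p = Max (snd ` I)" by auto
    then have pmax: "snd q \<le> snd p" if "q \<in> I" for q using psubset(1) that by simp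
    define I' where "I' = {q \<in> I. cube q \<inter> cube p = {}}"
    have "fst p \<in> cube p" using psubset(3)[OF p(1)] by (simp add: mem_cube)
    then have "I' \<subset> I" using p(1) by (auto simp: I'_def)
    then obtain J where J: "J \<subseteq> I'" "disjoint_family_on cube J"
        "\<And>q. q \<in> I' \<Longrightarrow> \<exists>p\<in>J. cube q \<subseteq> cube (tripled p)"
      using psubset(2)[of I'] psubset(3) by blast
    have "disjoint_family_on cube (insert p J)"
      using J(1,2) by (auto simp: disjoint_family_on_def I'_def)
    moreover have "\<exists>p'\<in>insert p J. cube q \<subseteq> cube (tripled p')" if q: "q \<in> I" for q
    proof (cases "q \<in> I'")
      case False
      then have "cube q \<subseteq> cube (tripled p)"
        using q pmax[OF q] psubset(3)[OF q] by (intro cube_subset_tripled) (auto simp: I'_def)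
      then show ?thesis by blast
    next
      case True
      from J(3)[OF this] show ?thesis by blast
    qed
    ultimately show ?thesis using J(1) p(1) \<open>I' \<subset> I\<close>
      by (intro exI[of _ "insert p J"]) auto
  next
    case True
    then show ?thesis by (intro exI[of _ "{}"]) (simp add: disjoint_family_on_def)
  qed
qed

lemma compact_Vitali_cubes:
  assumes "compact K" and S: "\<And>q. q \<in> S \<Longrightarrow> 0 < snd q"
    and cover: "\<And>x. x \<in> K \<Longrightarrow> \<exists>q\<in>S. x \<in> interior (cube q)"
  obtains J where "finite J" "J \<subseteq> S" "disjoint_family_on cube J" "K \<subseteq> (\<Union>q\<in>J. cube (tripled q))"
proof -
  have "K \<subseteq> (\<Union>q\<in>S. interior (cube q))" using cover by blast
  then obtain I where I: "I \<subseteq> S" "finite I" "K \<subseteq> (\<Union>q\<in>I. interior (cube q))"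
    using compactE_image[OF assms(1), of S "\<lambda>q. interior (cube q)"] by (metis open_interior)
  obtain J where J: "J \<subseteq> I" "disjoint_family_on cube J" "\<forall>q\<in>I. \<exists>p\<in>J. cube q \<subseteq> cube (tripled p)"
    using Vitali_cubes_finite[OF I(2)] S I(1) by blast
  have "K \<subseteq> (\<Union>q\<in>J. cube (tripled q))"
    using I(3) J(3) interior_subset by blast
  with J I show ?thesis by (intro that[of J]) (auto intro: finite_subset)
qed

lemma nn_integral_cover_le:
  assumes "finite J" "K \<subseteq> (\<Union>q\<in>J. cube (tripled q))" "\<And>q. q \<in> J \<Longrightarrow> 0 < snd q"
    and [measurable]: "u \<in> borel_measurable lebesgue"
  shows "(\<integral>\<^sup>+x\<in>K. u x \<partial>lebesgue) \<le> (\<Sum>q\<in>J. \<integral>\<^sup>+x\<in>cube (tripled q). u x \<partial>lebesgue)"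
proof -
  have "(\<integral>\<^sup>+x\<in>K. u x \<partial>lebesgue) \<le> (\<integral>\<^sup>+x. (\<Sum>q\<in>J. u x * indicator (cube (tripled q)) x) \<partial>lebesgue)"
  proof (rule nn_integral_mono)
    fix x
    show "u x * indicator K x \<le> (\<Sum>q\<in>J. u x * indicator (cube (tripled q)) x)"
    proof (cases "x \<in> K")
      case True
      then obtain q where "q \<in> J" "x \<in> cube (tripled q)" using assms(2) by blast
      then have "u x * indicator K x \<le> u x * indicator (cube (tripled q)) x" using True by simp
      also have "\<dots> \<le> (\<Sum>q\<in>J. u x * indicator (cube (tripled q)) x)"
        using \<open>q \<in> J\<close> assms(1) by (intro member_le_sum) auto
      finally show ?thesis .
    qed simp
  qed
  also have "\<dots> = (\<Sum>q\<in>J. \<integral>\<^sup>+x\<in>cube (tripled q). u x \<partial>lebesgue)"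
    by (rule nn_integral_sum) measurable
  finally show ?thesis .
qed

lemma cube_subset_own_tripled: "0 < snd q \<Longrightarrow> cube q \<subseteq> cube (tripled q)"
proof -
  assume q: "0 < snd q"
  then have "fst q \<in> cube q" by (simp add: mem_cube)
  then show ?thesis using q by (intro cube_subset_tripled) auto
qed

text \<open>
  Fefferman and Stein's weighted weak-type inequality: the cubes of a disjoint family
  carry the mass of \<open>f\<close>, their triples cover the level set, and the average of the weight
  over a triple is a lower bound for its maximal function on the cube.
\<close>

lemma weak_type_weighted:
  fixes f h :: "'a::euclidean_space \<Rightarrow> ennreal"
  assumes [measurable]: "f \<in> borel_measurable lebesgue" "h \<in> borel_measurable lebesgue"
  shows "t * (\<integral>\<^sup>+x\<in>{x. t < hl_max f x}. h x \<partial>lebesgue) \<le>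
    3 ^ DIM('a) * (\<integral>\<^sup>+x. f x * hl_max h x \<partial>lebesgue)"
proof -
  have "(\<integral>\<^sup>+x\<in>{x. t < hl_max f x}. t * h x \<partial>lebesgue) \<le>
    3 ^ DIM('a) * (\<integral>\<^sup>+x. f x * hl_max h x \<partial>lebesgue)"
  proof (rule nn_integral_open_leI[OF open_hl_max_greater])
    fix K assume K: "compact K" "K \<subseteq> {x. t < hl_max f x}"
    define S where "S = {q. 0 < snd q \<and> t < avg f q}"
    have "\<exists>q\<in>S. x \<in> interior (cube q)" if "x \<in> K" for x
      using that K(2) less_hl_max_interiorE[of t f x] unfolding S_def by blast
    then obtain J where J: "finite J" "J \<subseteq> S" "disjoint_family_on cube J" "K \<subseteq> (\<Union>q\<in>J. cube (tripled q))"
      using compact_Vitali_cubes[OF K(1), of S] by (auto simp: S_def)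
    have pos: "0 < snd q" "t < avg f q" if "q \<in> J" for q using that J(2) by (auto simp: S_def)
    have *: "(\<integral>\<^sup>+x\<in>cube (tripled q). t * h x \<partial>lebesgue) \<le>
        3 ^ DIM('a) * (\<integral>\<^sup>+x\<in>cube q. f x * hl_max h x \<partial>lebesgue)" if q: "q \<in> J" for q
    proof -
      have "(\<integral>\<^sup>+x\<in>cube (tripled q). t * h x \<partial>lebesgue) = t * (avg h (tripled q) * (3 ^ DIM('a) * emeasure lebesgue (cube q)))"
        using pos(1)[OF q]
        by (simp add: mult.assoc nn_integral_cmult set_nn_integral_cube emeasure_tripled)
      also have "\<dots> \<le> avg f q * (avg h (tripled q) * (3 ^ DIM('a) * emeasure lebesgue (cube q)))"
        using pos(2)[OF q] by (intro mult_right_mono) auto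
      also have "\<dots> = 3 ^ DIM('a) * (avg h (tripled q) * (\<integral>\<^sup>+x\<in>cube q. f x \<partial>lebesgue))"
        using pos(1)[OF q] by (simp add: set_nn_integral_cube mult_ac)
      also have "avg h (tripled q) * (\<integral>\<^sup>+x\<in>cube q. f x \<partial>lebesgue) = (\<integral>\<^sup>+x\<in>cube q. f x * avg h (tripled q) \<partial>lebesgue)"
        by (simp add: nn_integral_cmult[symmetric] mult_ac)
      also have "\<dots> \<le> (\<integral>\<^sup>+x\<in>cube q. f x * hl_max h x \<partial>lebesgue)"
        using pos(1)[OF q] cube_subset_own_tripled[OF pos(1)[OF q]]
        by (intro nn_integral_mono) (auto simp: indicator_def intro!: mult_left_mono avg_le_hl_max)
      finally show ?thesis by (simp add: mult_left_mono)
    qed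
    have "(\<integral>\<^sup>+x\<in>K. t * h x \<partial>lebesgue) \<le> (\<Sum>q\<in>J. \<integral>\<^sup>+x\<in>cube (tripled q). t * h x \<partial>lebesgue)"
      using J pos by (intro nn_integral_cover_le) auto
    also have "\<dots> \<le> (\<Sum>q\<in>J. 3 ^ DIM('a) * (\<integral>\<^sup>+x\<in>cube q. f x * hl_max h x \<partial>lebesgue))"
      by (intro sum_mono *)
    also have "\<dots> = 3 ^ DIM('a) * (\<Sum>q\<in>J. \<integral>\<^sup>+x\<in>cube q. f x * hl_max h x \<partial>lebesgue)"
      by (simp add: sum_distrib_left)
    also have "\<dots> \<le> 3 ^ DIM('a) * (1 * (\<integral>\<^sup>+x. f x * hl_max h x \<partial>lebesgue))"
      using J sum_indicator_disjoint_le[OF J(1,3)]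
      by (intro mult_left_mono sum_nn_integral_overlap) auto
    finally show "(\<integral>\<^sup>+x\<in>K. t * h x \<partial>lebesgue) \<le> 3 ^ DIM('a) * (\<integral>\<^sup>+x. f x * hl_max h x \<partial>lebesgue)"
      by simp
  qed measurable
  then show ?thesis by (simp add: mult.assoc nn_integral_cmult)
qed

lemma weak_type:
  fixes f :: "'a::euclidean_space \<Rightarrow> ennreal"
  assumes [measurable]: "f \<in> borel_measurable lebesgue"
  shows "t * emeasure lebesgue {x. t < hl_max f x} \<le> 3 ^ DIM('a) * (\<integral>\<^sup>+x. f x \<partial>lebesgue)"
proof -
  have "t * emeasure lebesgue {x. t < hl_max f x} = t * (\<integral>\<^sup>+x\<in>{x. t < hl_max f x}. 1 \<partial>lebesgue)"
    by simp
  also have "\<dots> \<le> 3 ^ DIM('a) * (\<integral>\<^sup>+x. f x * hl_max (\<lambda>_. 1) x \<partial>lebesgue)"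
    by (rule weak_type_weighted) auto
  also have "\<dots> \<le> 3 ^ DIM('a) * (\<integral>\<^sup>+x. f x * 1 \<partial>lebesgue)"
    by (intro mult_left_mono nn_integral_mono hl_max_const_le) auto
  finally show ?thesis by simp
qed

section \<open>The Fefferman--Stein inequality\<close>

text \<open>
  Discrete layer-cake decompositions, in which summation over the levels \<open>2\<^sup>k d\<close> takes the place of
  integration over all levels. A power of \<open>t\<close> is dominated by the single layer that contains \<open>t\<close>.
\<close>

lemma dyadic_layer_pick:
  assumes "0 < d" "0 < r" "ennreal d < t"
  shows "t epowr r \<le> (\<Sum>k::nat. ennreal ((2 ^ (k+1) * d) powr r) * indicator {s. ennreal (2 ^ k * d) < s} t)"
proof (cases t)
  case top
  have "top = (\<Sum>k::nat. ennreal (d powr r))"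
    using assms by (auto simp: suminf_eq_SUP ennreal_SUP_of_nat_eq_top ennreal_of_nat_eq_real_of_nat[symmetric] SUP_mult_right_ennreal[symmetric] ennreal_top_mult)
  also have "\<dots> \<le> (\<Sum>k::nat. ennreal ((2 ^ (k+1) * d) powr r) * indicator {s. ennreal (2 ^ k * d) < s} t)"
  proof (intro suminf_le)
    fix k :: nat
    have "1 * d \<le> 2 ^ (k+1) * d" using assms by (intro mult_right_mono one_le_power) auto
    then have "d \<le> 2 ^ (k+1) * d" by simp
    then have "d powr r \<le> (2 ^ (k+1) * d) powr r" using assms by (intro powr_mono2) auto
    then show "ennreal (d powr r) \<le> ennreal ((2 ^ (k+1) * d) powr r) * indicator {s. ennreal (2 ^ k * d) < s} t"
      using top by (simp add: ennreal_leI)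
  qed auto
  finally show ?thesis unfolding top epowr_top .
next
  case (real s)
  then have ds: "d < s" using assms by (simp add: ennreal_less_iff)
  obtain n where "s / d < 2 ^ n" using real_arch_pow[of 2 "s/d"] by auto
  then have n: "s \<le> 2 ^ n * d" using assms by (simp add: field_simps)
  define m where "m = (LEAST n. s \<le> 2 ^ n * d)"
  have m: "s \<le> 2 ^ m * d" unfolding m_def using n by (rule LeastI)
  have "m \<noteq> 0" using m ds by (cases "m = 0") auto
  then obtain k where k: "m = Suc k" by (cases m) auto
  have "\<not> s \<le> 2 ^ k * d" using not_less_Least[of k "\<lambda>n. s \<le> 2 ^ n * d"] k by (simp add: m_def)
  then have ks: "2 ^ k * d < s" by simp
  have "t epowr r = ennreal (s powr r)" using real by (simp add: epowr_ennreal)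
  also have "\<dots> \<le> ennreal ((2 ^ (k+1) * d) powr r) * indicator {s. ennreal (2 ^ k * d) < s} t"
    using ks real assms m k by (auto simp: ennreal_less_iff intro!: ennreal_leI powr_mono2)
  also have "\<dots> \<le> (\<Sum>k::nat. ennreal ((2 ^ (k+1) * d) powr r) * indicator {s. ennreal (2 ^ k * d) < s} t)"
    (is "_ \<le> suminf ?F")
  proof -
    have "sum ?F {k} \<le> suminf ?F" by (intro sum_le_suminf) auto
    then show ?thesis by (simp only: sum.insert sum.empty finite.emptyI empty_iff not_False_eq_True add_0_right)
  qed
  finally show ?thesis .
qed

text \<open>
  The layers below \<open>t\<close> form a geometric series dominated by its last term.
\<close>

lemma dyadic_layer_sum:
  assumes "0 < d" "0 < r"
  shows "(\<Sum>k::nat. ennreal ((2 ^ k * d) powr r) * indicator {s. ennreal (2 ^ k * d) \<le> s} t) \<le>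
    ennreal (2 powr r / (2 powr r - 1)) * t epowr r"
proof (cases t)
  case top
  have "1 < 2 powr r" using assms by simp
  then have "0 < 2 powr r / (2 powr r - 1)" by (intro divide_pos_pos) auto
  then have nz: "ennreal (2 powr r / (2 powr r - 1)) \<noteq> 0" by (simp only: ennreal_eq_0_iff not_le)
  show ?thesis
    unfolding top epowr_top ennreal_top_mult_left[OF nz] by (rule top_greatest)
next
  case (real s)
  define b where "b k = (2 ^ k * d) powr r" for k
  define c where "c = 2 powr r"
  have c: "1 < c" using assms by (simp add: c_def)
  have b: "b (Suc k) = c * b k" for k
    using assms by (simp add: b_def c_def powr_mult)
  have bpos: "0 < b k" for k using assms by (simp add: b_def)
  have T: "(\<Sum>k<n. b k) \<le> b n / (c - 1)" for n
  proof (induction n)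
    case (Suc n)
    then have "(\<Sum>k<Suc n. b k) \<le> b n / (c - 1) + b n" by simp
    also have "\<dots> = b (Suc n) / (c - 1)" using c by (simp add: b field_simps)
    finally show ?case .
  qed (use bpos[of 0] c in simp)
  have S: "(\<Sum>k<n. b k * indicator {k. 2 ^ k * d \<le> s} k) \<le> c / (c - 1) * s powr r" for n :: nat
  proof (induction n)
    case (Suc n)
    show ?case
    proof (cases "2 ^ n * d \<le> s")
      case True
      have "(\<Sum>k<Suc n. b k * indicator {k. 2 ^ k * d \<le> s} k) \<le> (\<Sum>k<Suc n. b k)"
        using bpos by (intro sum_mono) (auto simp: indicator_def less_imp_le)
      also have "\<dots> \<le> b n / (c - 1) + b n" using T[of n] by simp
      also have "\<dots> = c / (c - 1) * b n" using c by (simp add: field_simps)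
      also have "\<dots> \<le> c / (c - 1) * s powr r"
        using True assms c unfolding b_def by (intro mult_left_mono powr_mono2) auto
      finally show ?thesis .
    qed (use Suc in simp)
  qed (use c in simp)
  have "(\<Sum>k<n. ennreal (b k) * indicator {s. ennreal (2 ^ k * d) \<le> s} t) \<le> ennreal (c / (c - 1)) * t epowr r" for n :: nat
  proof -
    have "(\<Sum>k<n. ennreal (b k) * indicator {s. ennreal (2 ^ k * d) \<le> s} t) =
        (\<Sum>k<n. ennreal (b k * indicator {k. 2 ^ k * d \<le> s} k))"
      using real by (intro sum.cong) (auto simp: indicator_def)
    also have "\<dots> = ennreal (\<Sum>k<n. b k * indicator {k. 2 ^ k * d \<le> s} k)"
      using bpos by (intro sum_ennreal) (auto simp: less_imp_le)
    also have "\<dots> \<le> ennreal (c / (c - 1) * s powr r)" by (intro ennreal_leI S)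
    also have "\<dots> = ennreal (c / (c - 1)) * t epowr r"
      using real c by (simp add: epowr_ennreal ennreal_mult[symmetric])
    finally show ?thesis .
  qed
  then show ?thesis unfolding b_def c_def
    by (subst suminf_eq_SUP) (auto intro: SUP_least)
qed

text \<open>
  The strong-type inequality of Fefferman and Stein. At each dyadic level the part of
  \<open>f\<close> below half that level does not contribute, and the weak-type inequality for the
  remaining part is summed over all levels.
\<close>

lemma Fefferman_Stein:
  assumes r: "1 < r"
  shows "\<exists>C>0. \<forall>(f::'a::euclidean_space \<Rightarrow> ennreal)\<in>borel_measurable lebesgue. \<forall>h\<in>borel_measurable lebesgue.
    (\<integral>\<^sup>+x. hl_max f x epowr r * h x \<partial>lebesgue) \<le>
    ennreal C * (\<integral>\<^sup>+x. f x epowr r * hl_max h x \<partial>lebesgue)"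
proof -
  define c where "c = 2 powr (r-1) / (2 powr (r-1) - 1)"
  have c: "0 < c" using r by (simp add: c_def)
  define C where "C = 2 powr (2 * r) * 3 ^ DIM('a) * c"
  show ?thesis
  proof (intro exI[of _ C] conjI ballI)
    show "0 < C" using c by (simp add: C_def)
    fix f h :: "'a \<Rightarrow> ennreal"
    assume [measurable]: "f \<in> borel_measurable lebesgue" "h \<in> borel_measurable lebesgue"
    define I where "I = (\<integral>\<^sup>+x. f x epowr r * hl_max h x \<partial>lebesgue)"
    have level: "(\<integral>\<^sup>+x\<in>{x. ennreal d < hl_max f x}. hl_max f x epowr r * h x \<partial>lebesgue) \<le> ennreal C * I"
      if d: "0 < d" for d :: real
    proof -
      define b where "b k = 2 ^ k * (d/2)" for k :: nat
      have b: "0 < b k" for k using d by (simp add: b_def)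
      have layer: "ennreal ((4 * b k) powr r) * (\<integral>\<^sup>+x\<in>{x. ennreal (2 * b k) < hl_max f x}. h x \<partial>lebesgue) \<le>
          ennreal (2 powr (2 * r) * 3 ^ DIM('a)) *
          (\<integral>\<^sup>+x. f x * hl_max h x * (ennreal (b k powr (r-1)) * indicator {s. ennreal (b k) \<le> s} (f x)) \<partial>lebesgue)" (is "?L \<le> _") for k
      proof -
        \<comment> \<open>Removing the part of \<open>f\<close> below \<open>b k\<close> lowers the maximal function by at most \<open>b k\<close>.\<close>
        define g where "g x = f x * indicator {x. ennreal (b k) \<le> f x} x" for x
        have [measurable]: "g \<in> borel_measurable lebesgue" unfolding g_def by measurable
        have f_le: "f x \<le> g x + ennreal (b k)" for x
          by (auto simp: g_def indicator_def)
        have split: "hl_max f x \<le> hl_max g x + ennreal (b k)" for x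
        proof -
          have "hl_max f x \<le> hl_max (\<lambda>x. g x + ennreal (b k)) x" by (intro hl_max_mono f_le)
          also have "\<dots> \<le> hl_max g x + hl_max (\<lambda>x. ennreal (b k)) x" by (rule hl_max_add_le) auto
          also have "\<dots> \<le> hl_max g x + ennreal (b k)" by (intro add_left_mono hl_max_const_le)
          finally show ?thesis .
        qed
        have double: "ennreal (2 * b k) = ennreal (b k) + ennreal (b k)"
          using b[of k] by (simp flip: ennreal_plus)
        have sub: "{x. ennreal (2 * b k) < hl_max f x} \<subseteq> {x. ennreal (b k) < hl_max g x}"
        proof (intro subsetI CollectI)
          fix x assume "x \<in> {x. ennreal (2 * b k) < hl_max f x}"
          then have "ennreal (b k) + ennreal (b k) < hl_max g x + ennreal (b k)"
            unfolding double[symmetric] mem_Collect_eq by (rule less_le_trans[OF _ split])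
          then show "ennreal (b k) < hl_max g x"
            by (meson add_right_mono not_le)
        qed
        have e4: "(4 * b k) powr r = 2 powr (2 * r) * b k powr (r-1) * b k"
          using b[of k] powr_powr[of 2 2 r] by (simp add: powr_mult powr_diff)
        have "?L \<le>
            ennreal ((4 * b k) powr r) * (\<integral>\<^sup>+x\<in>{x. ennreal (b k) < hl_max g x}. h x \<partial>lebesgue)"
          using sub by (intro mult_left_mono nn_integral_mono) (auto simp: indicator_def)
        also have "\<dots> =
            ennreal (2 powr (2 * r) * b k powr (r-1)) * (ennreal (b k) * (\<integral>\<^sup>+x\<in>{x. ennreal (b k) < hl_max g x}. h x \<partial>lebesgue))"
          unfolding e4 using b[of k] by (simp add: ennreal_mult mult.assoc)
        also have "\<dots> \<le> ennreal (2 powr (2 * r) * b k powr (r-1)) * (3 ^ DIM('a) * (\<integral>\<^sup>+x. g x * hl_max h x \<partial>lebesgue))"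
          by (intro mult_left_mono weak_type_weighted) auto
        also have "\<dots> = ennreal (2 powr (2 * r) * 3 ^ DIM('a)) * (ennreal (b k powr (r-1)) * (\<integral>\<^sup>+x. g x * hl_max h x \<partial>lebesgue))"
          by (simp add: ennreal_mult mult_ac ennreal_power[symmetric])
        also have "ennreal (b k powr (r-1)) * (\<integral>\<^sup>+x. g x * hl_max h x \<partial>lebesgue) =
          (\<integral>\<^sup>+x. f x * hl_max h x * (ennreal (b k powr (r-1)) * indicator {s. ennreal (b k) \<le> s} (f x)) \<partial>lebesgue)"
          by (subst nn_integral_cmult[symmetric], measurable)
             (intro nn_integral_cong, simp add: g_def indicator_def mult_ac)
        finally show ?thesis .
      qed
      have "(\<integral>\<^sup>+x\<in>{x. ennreal d < hl_max f x}. hl_max f x epowr r * h x \<partial>lebesgue) \<le>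
        (\<integral>\<^sup>+x. (\<Sum>k. ennreal ((4 * b k) powr r) * (h x * indicator {x. ennreal (2 * b k) < hl_max f x} x)) \<partial>lebesgue)"
      proof (rule nn_integral_mono)
        fix x
        show "hl_max f x epowr r * h x * indicator {x. ennreal d < hl_max f x} x \<le>
          (\<Sum>k. ennreal ((4 * b k) powr r) * (h x * indicator {x. ennreal (2 * b k) < hl_max f x} x))"
        proof (cases "ennreal d < hl_max f x")
          case True
          have "hl_max f x epowr r \<le> (\<Sum>k. ennreal ((2 ^ (k+1) * d) powr r) * indicator {s. ennreal (2 ^ k * d) < s} (hl_max f x))"
            using d r True by (intro dyadic_layer_pick) auto
          then have "hl_max f x epowr r * h x \<le> (\<Sum>k. ennreal ((2 ^ (k+1) * d) powr r) * indicator {s. ennreal (2 ^ k * d) < s} (hl_max f x)) * h x"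
            by (rule mult_right_mono) auto
          also have "\<dots> = (\<Sum>k. ennreal ((4 * b k) powr r) * (h x * indicator {x. ennreal (2 * b k) < hl_max f x} x))"
            unfolding ennreal_suminf_multc[symmetric]
            by (intro suminf_cong) (auto simp: b_def indicator_def algebra_simps)
          finally show ?thesis using True by simp
        qed simp
      qed
      also have "\<dots> = (\<Sum>k. ennreal ((4 * b k) powr r) * (\<integral>\<^sup>+x\<in>{x. ennreal (2 * b k) < hl_max f x}. h x \<partial>lebesgue))"
        by (subst nn_integral_suminf) (auto intro!: suminf_cong nn_integral_cmult)
      also have "\<dots> \<le> (\<Sum>k. ennreal (2 powr (2 * r) * 3 ^ DIM('a)) *
          (\<integral>\<^sup>+x. f x * hl_max h x * (ennreal (b k powr (r-1)) * indicator {s. ennreal (b k) \<le> s} (f x)) \<partial>lebesgue))"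
        by (intro suminf_le layer) auto
      also have "\<dots> = ennreal (2 powr (2 * r) * 3 ^ DIM('a)) *
          (\<integral>\<^sup>+x. f x * hl_max h x * (\<Sum>k. ennreal (b k powr (r-1)) * indicator {s. ennreal (b k) \<le> s} (f x)) \<partial>lebesgue)"
        unfolding ennreal_suminf_cmult
      proof (subst nn_integral_suminf[symmetric])
        show "(\<lambda>x. f x * hl_max h x * (ennreal (b k powr (r-1)) * indicator {s. ennreal (b k) \<le> s} (f x)))
          \<in> borel_measurable lebesgue" for k
          by measurable
      qed (simp add: ennreal_suminf_cmult)
      also have "\<dots> \<le> ennreal (2 powr (2 * r) * 3 ^ DIM('a)) *
          (\<integral>\<^sup>+x. f x * hl_max h x * (ennreal c * f x epowr (r-1)) \<partial>lebesgue)"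
        using d r unfolding b_def c_def
        by (intro mult_left_mono nn_integral_mono dyadic_layer_sum) auto
      also have "\<dots> = ennreal (2 powr (2 * r) * 3 ^ DIM('a)) *
          (\<integral>\<^sup>+x. ennreal c * (f x epowr r * hl_max h x) \<partial>lebesgue)"
        using epowr_add[of "f _" 1 "r-1"] by (simp add: mult_ac)
      also have "\<dots> = ennreal C * I"
        using c by (simp add: nn_integral_cmult I_def C_def ennreal_mult mult_ac)
      finally show ?thesis .
    qed
    \<comment> \<open>The levels below \<open>d\<close> were omitted; the constant does not depend on \<open>d\<close>, so \<open>d\<close> may tend to 0.\<close>
    have "(\<Union>n. {x. ennreal (1 / real (Suc n)) < hl_max f x}) = {x. 0 < hl_max f x}"
    proof (intro equalityI subsetI)
      fix x assume "x \<in> {x. 0 < hl_max f x}"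
      then obtain y where y: "0 < y" "y < hl_max f x" using dense by auto
      have "y < top" using less_le_trans[OF y(2) top_greatest] .
      then have e: "0 < enn2real y" "ennreal (enn2real y) < hl_max f x"
        using y by (simp_all add: enn2real_positive_iff)
      obtain n where n: "1 / real (Suc n) < enn2real y" using nat_approx_posE[OF e(1)] .
      have "ennreal (1 / real (Suc n)) < hl_max f x"
        by (rule less_trans[OF ennreal_lessI[OF e(1) n] e(2)])
      then show "x \<in> (\<Union>n. {x. ennreal (1 / real (Suc n)) < hl_max f x})" by blast
    next
      fix x assume "x \<in> (\<Union>n. {x. ennreal (1 / real (Suc n)) < hl_max f x})"
      then obtain n where "ennreal (1 / real (Suc n)) < hl_max f x" by blast
      then show "x \<in> {x. 0 < hl_max f x}" using le_less_trans[OF zero_le] by blast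
    qed
    then have "(\<integral>\<^sup>+x\<in>{x. 0 < hl_max f x}. hl_max f x epowr r * h x \<partial>lebesgue) =
       (\<integral>\<^sup>+x\<in>(\<Union>n. {x. ennreal (1 / real (Suc n)) < hl_max f x}). hl_max f x epowr r * h x \<partial>lebesgue)"
      by simp
    also have "\<dots> = (SUP n. \<integral>\<^sup>+x\<in>{x. ennreal (1 / real (Suc n)) < hl_max f x}. hl_max f x epowr r * h x \<partial>lebesgue)"
    proof (rule nn_integral_incseq_sets)
      show "incseq (\<lambda>n. {x. ennreal (1 / real (Suc n)) < hl_max f x})"
      proof (intro incseq_SucI subsetI CollectI)
        fix n x assume *: "x \<in> {x. ennreal (1 / real (Suc n)) < hl_max f x}"
        have "ennreal (1 / real (Suc (Suc n))) \<le> ennreal (1 / real (Suc n))"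
          by (intro ennreal_leI frac_le) auto
        also have "\<dots> < hl_max f x" using * by simp
        finally show "ennreal (1 / real (Suc (Suc n))) < hl_max f x" .
      qed
    qed auto
    also have "\<dots> \<le> ennreal C * I" by (intro SUP_least level) auto
    also have "(\<integral>\<^sup>+x\<in>{x. 0 < hl_max f x}. hl_max f x epowr r * h x \<partial>lebesgue) = (\<integral>\<^sup>+x. hl_max f x epowr r * h x \<partial>lebesgue)"
      by (intro nn_integral_cong) (auto simp: indicator_def zero_less_iff_neq_zero)
    finally show "(\<integral>\<^sup>+x. hl_max f x epowr r * h x \<partial>lebesgue) \<le> ennreal C * (\<integral>\<^sup>+x. f x epowr r * hl_max h x \<partial>lebesgue)"
      by (simp add: I_def)
  qed
qed

section \<open>Differentiation\<close>

lemma null_sets_level_gap: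
  fixes F :: "'a::euclidean_space \<Rightarrow> ennreal" and n s t :: real
  assumes [measurable]: "F \<in> borel_measurable lebesgue" and "0 < n" "0 < t" "t < s"
  defines "N \<equiv> {x \<in> cbox (- (n *\<^sub>R One)) (n *\<^sub>R One). ennreal s < F x \<and> hl_max F x \<le> ennreal t}"
  shows "emeasure lebesgue N = 0"
proof (rule ccontr)
  define a b :: 'a where "a = - (n *\<^sub>R One)" and "b = n *\<^sub>R One"
  have N_eq: "N = cbox a b \<inter> ({x. ennreal s < F x} - {x. ennreal t < hl_max F x})"
    by (auto simp: N_def a_def b_def)
  have "{x \<in> space lebesgue. ennreal s < F x} \<in> sets lebesgue" by measurable
  then have N[measurable]: "N \<in> sets lebesgue"
    unfolding N_eq by (intro sets.Int sets.Diff sets_hl_max_greater) auto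
  assume nz: "emeasure lebesgue N \<noteq> 0"
  have "emeasure lebesgue N \<le> emeasure lebesgue (cbox a b)"
    unfolding N_eq by (intro emeasure_mono) auto
  also have "\<dots> < top"
    using emeasure_lborel_cbox_finite[of a b] by (simp add: emeasure_completion)
  finally have m2: "emeasure lebesgue N = ennreal (measure lebesgue N)"
    by (intro emeasure_eq_ennreal_measure) simp
  then have "0 < measure lebesgue N" using nz by (cases "measure lebesgue N = 0") (auto simp: less_le)
  note m = this m2
  define m where "m = measure lebesgue N"
  have mpos: "0 < m" using m(1) by (simp add: m_def)
  have epos: "0 < m * (s / t - 1)" using mpos \<open>0 < t\<close> \<open>t < s\<close> by simp
  then obtain T where T: "open T" "N \<subseteq> T" "emeasure lebesgue (T - N) < ennreal (m * (s / t - 1))"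
    using sets_lebesgue_outer_open[OF N] by metis
  have T_sets[measurable]: "T \<in> sets lebesgue"
    using T(1) sets_completionI_sets[of T lborel] by (simp add: borel_open)
  have "emeasure lebesgue T = emeasure lebesgue N + emeasure lebesgue (T - N)"
    using T(2) by (subst plus_emeasure) (auto simp: Un_absorb1)
  also have "\<dots> < ennreal m + ennreal (m * (s / t - 1))"
    using T(3) m(2) by (simp add: m_def ennreal_add_left_cancel_less)
  also have "\<dots> = ennreal (m * (s / t))"
    using mpos epos by (subst ennreal_plus[symmetric]) (simp_all add: algebra_simps less_imp_le)
  finally have T_less: "emeasure lebesgue T < ennreal (m * (s / t))" .
  \<comment> \<open>The gauge confines the covering cubes, each of which contains a point of \<open>N\<close>, to the open set.\<close>
  define g where "g x = (if x \<in> T then T else UNIV)" for x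
  have g: "gauge g" using T(1) by (auto simp: gauge_def g_def)
  have "box a b \<noteq> {}" using \<open>0 < n\<close> by (auto simp: box_ne_empty a_def b_def)
  moreover have "N \<subseteq> cbox a b" by (auto simp: N_eq)
  ultimately obtain D where D: "countable D"
      "\<And>K. K \<in> D \<Longrightarrow> interior K \<noteq> {} \<and> (\<exists>c d. K = cbox c d)"
      "pairwise (\<lambda>A B. interior A \<inter> interior B = {}) D"
      "\<And>K. K \<in> D \<Longrightarrow> \<exists>x\<in>N \<inter> K. K \<subseteq> g x"
      "\<And>u v. cbox u v \<in> D \<Longrightarrow> \<exists>n. \<forall>i\<in>Basis. v \<bullet> i - u \<bullet> i = (b \<bullet> i - a \<bullet> i) / 2 ^ n"
      "N \<subseteq> \<Union>D"
    using covering_lemma[OF _ _ g, of N a b] by metis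
  have KT: "K \<subseteq> T" if K: "K \<in> D" for K
  proof -
    obtain x where "x \<in> N" "K \<subseteq> g x" using D(4)[OF K] by blast
    moreover have "g x = T" using T(2) \<open>x \<in> N\<close> by (auto simp: g_def)
    ultimately show ?thesis by simp
  qed
  have cube: "\<exists>q. 0 < snd q \<and> K = cube q" if K: "K \<in> D" for K
  proof -
    obtain c d where cd: "K = cbox c d" using D(2)[OF K] by blast
    obtain k where k: "\<And>i. i \<in> Basis \<Longrightarrow> d \<bullet> i - c \<bullet> i = (b \<bullet> i - a \<bullet> i) / 2 ^ k"
      using D(5)[of c d] K cd by blast
    have "d = c + (2 * n / 2 ^ k) *\<^sub>R One"
    proof (rule euclidean_eqI)
      fix i :: 'a assume i: "i \<in> Basis"
      show "d \<bullet> i = (c + (2 * n / 2 ^ k) *\<^sub>R One) \<bullet> i"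
        using k[OF i] i by (simp add: a_def b_def inner_add_left inner_sum_left_Basis)
    qed
    then show ?thesis using cd \<open>0 < n\<close> by (intro exI[of _ "(c, 2 * n / 2 ^ k)"]) (simp add: cube_def)
  qed
  have K_sets[measurable]: "K \<in> sets lebesgue" if "K \<in> D" for K using cube[OF that] by auto
  have int_sets: "interior K \<in> sets lebesgue" for K :: "'a set"
    using sets_completionI_sets[of "interior K" lborel] by (simp add: borel_open)
  have int_null: "K - interior K \<in> null_sets lebesgue" if K: "K \<in> D" for K
  proof -
    obtain c d where "K = cbox c d" using D(2)[OF K] by blast
    then show ?thesis using negligible_frontier_interval[of c d]
      by (simp add: interior_cbox negligible_iff_null_sets)
  qed
  have int_meas: "emeasure lebesgue (interior K) = emeasure lebesgue K" if "K \<in> D" for K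
  proof -
    have "emeasure lebesgue (K - (K - interior K)) = emeasure lebesgue K"
      using int_null[OF that] K_sets[OF that] by (rule emeasure_Diff_null_set)
    moreover have "K - (K - interior K) = interior K" using interior_subset by blast
    ultimately show ?thesis by simp
  qed
  have dis: "disjoint_family_on interior D"
    using D(3) by (auto simp: disjoint_family_on_def pairwise_def)
  \<comment> \<open>A covering cube contains a point of \<open>N\<close>, so the average of \<open>F\<close> over it is at most \<open>t\<close>.\<close>
  have piece: "ennreal s * emeasure lebesgue (N \<inter> interior K) \<le> ennreal t * emeasure lebesgue (interior K)"
    if K: "K \<in> D" for K
  proof -
    obtain q where q: "0 < snd q" "K = cube q" using cube[OF K] by blast
    obtain x where x: "x \<in> N" "x \<in> K" using D(4)[OF K] by blast
    have "ennreal s * emeasure lebesgue (N \<inter> interior K) = (\<integral>\<^sup>+x. ennreal s * indicator (N \<inter> interior K) x \<partial>lebesgue)"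
      using N int_sets by (subst nn_integral_cmult_indicator) auto
    also have "\<dots> \<le> (\<integral>\<^sup>+x\<in>K. F x \<partial>lebesgue)"
      using interior_subset[of K] by (intro nn_integral_mono) (auto simp: indicator_def N_eq)
    also have "\<dots> = avg F q * emeasure lebesgue K" unfolding q(2) by (rule set_nn_integral_cube[OF q(1)])
    also have "avg F q \<le> ennreal t"
      using avg_le_hl_max[OF q(1), of x F] x q(2) by (auto simp: N_eq)
    finally show ?thesis unfolding int_meas[OF K] by (simp add: mult_right_mono)
  qed
  have null: "(\<Union>K\<in>D. K - interior K) \<in> null_sets lebesgue"
    using D(1) int_null by (rule null_sets_UN')
  have "emeasure lebesgue N \<le> emeasure lebesgue ((\<Union>K\<in>D. N \<inter> interior K) \<union> (\<Union>K\<in>D. K - interior K))"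
    using D(6) null N int_sets D(1) by (intro emeasure_mono sets.Un sets.countable_UN') auto
  also have "\<dots> = emeasure lebesgue (\<Union>K\<in>D. N \<inter> interior K)"
    using null N int_sets D(1) by (intro emeasure_Un_null_set sets.countable_UN') auto
  also have "\<dots> = (\<integral>\<^sup>+K. emeasure lebesgue (N \<inter> interior K) \<partial>count_space D)"
    using N int_sets D(1) dis by (intro emeasure_UN_countable) (auto simp: disjoint_family_on_def)
  finally have "ennreal s * emeasure lebesgue N \<le> ennreal s * (\<integral>\<^sup>+K. emeasure lebesgue (N \<inter> interior K) \<partial>count_space D)"
    by (rule mult_left_mono) simp
  also have "\<dots> = (\<integral>\<^sup>+K. ennreal s * emeasure lebesgue (N \<inter> interior K) \<partial>count_space D)"
    by (rule nn_integral_cmult[symmetric]) simp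
  also have "\<dots> \<le> (\<integral>\<^sup>+K. ennreal t * emeasure lebesgue (interior K) \<partial>count_space D)"
    by (intro nn_integral_mono) (simp add: piece)
  also have "\<dots> = ennreal t * (\<integral>\<^sup>+K. emeasure lebesgue (interior K) \<partial>count_space D)"
    by (rule nn_integral_cmult) simp
  also have "(\<integral>\<^sup>+K. emeasure lebesgue (interior K) \<partial>count_space D) = emeasure lebesgue (\<Union>K\<in>D. interior K)"
    using int_sets D(1) dis by (intro emeasure_UN_countable[symmetric]) auto
  also have "ennreal t * emeasure lebesgue (\<Union>K\<in>D. interior K) \<le> ennreal t * emeasure lebesgue T"
    using KT interior_subset T_sets by (intro mult_left_mono emeasure_mono zero_le) blast+
  also have "\<dots> < ennreal t * ennreal (m * (s / t))"
    using T_less \<open>0 < t\<close> by (intro ennreal_mult_strict_left_mono) auto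
  also have "\<dots> = ennreal s * emeasure lebesgue N"
    unfolding m(2) m_def[symmetric] using mpos \<open>0 < t\<close> \<open>t < s\<close> by (simp add: ennreal_mult[symmetric])
  finally show False by simp
qed

text \<open>
  The weak form of Lebesgue's differentiation theorem. A set on which \<open>F > s\<close> while every
  cube meeting it has average at most \<open>t < s\<close> is covered, inside an open set of almost the
  same measure, by non-overlapping cubes that meet it, and this forces it to be null.
\<close>

lemma AE_le_hl_max:
  fixes F :: "'a::euclidean_space \<Rightarrow> ennreal"
  assumes [measurable]: "F \<in> borel_measurable lebesgue"
  shows "AE x in lebesgue. F x \<le> hl_max F x"
proof -
  define N where "N n s t = {x \<in> cbox (- (n *\<^sub>R One)) (n *\<^sub>R One). ennreal s < F x \<and> hl_max F x \<le> ennreal t}"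
    for n s t :: real
  define I where "I = {(n::real, s::real, t::real). 0 < n \<and> 0 < t \<and> t < s \<and> n \<in> \<nat> \<and> s \<in> \<rat> \<and> t \<in> \<rat>}"
  have "I \<subseteq> \<nat> \<times> \<rat> \<times> \<rat>" by (auto simp: I_def)
  then have "countable I"
    by (rule countable_subset) (intro countable_SIGMA countable_rat, simp add: Nats_def)
  moreover have "N n s t \<in> null_sets lebesgue" if "(n, s, t) \<in> I" for n s t
  proof (rule null_setsI)
    show "emeasure lebesgue (N n s t) = 0"
      using that unfolding N_def I_def by (intro null_sets_level_gap) auto
    have "{x \<in> space lebesgue. ennreal s < F x \<and> hl_max F x \<le> ennreal t} \<in> sets lebesgue" by measurable
    then have "cbox (- (n *\<^sub>R One)) (n *\<^sub>R One) \<inter> {x. ennreal s < F x \<and> hl_max F x \<le> ennreal t} \<in> sets lebesgue"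
      by (intro sets.Int) auto
    then show "N n s t \<in> sets lebesgue" unfolding N_def Int_def by simp
  qed
  ultimately have "(\<Union>(n, s, t)\<in>I. N n s t) \<in> null_sets lebesgue"
    by (intro null_sets_UN') (simp_all add: split_beta)
  then show ?thesis
  proof (rule AE_I', intro subsetI)
    fix x assume "x \<in> {x \<in> space lebesgue. \<not> F x \<le> hl_max F x}"
    then have lt: "hl_max F x < F x" by auto
    obtain t where t: "hl_max F x < ennreal (real_of_rat t)" "ennreal (real_of_rat t) < F x" "0 < t"
    proof -
      obtain t where "hl_max F x < ennreal (real_of_rat t)" "ennreal (real_of_rat t) < F x"
        using ennreal_rat_dense[OF lt] by auto
      moreover from this have "0 < ennreal (real_of_rat t)" using le_less_trans[OF zero_le] by blast
      ultimately show ?thesis using that by simp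
    qed
    obtain s where s: "ennreal (real_of_rat t) < ennreal (real_of_rat s)" "ennreal (real_of_rat s) < F x"
      using ennreal_rat_dense[OF t(2)] by auto
    obtain k where "norm x \<le> real k" using real_arch_simple by blast
    then have n: "norm x \<le> real (Suc k)" by simp
    have "x \<in> cbox (- (real (Suc k) *\<^sub>R One)) (real (Suc k) *\<^sub>R One)"
      unfolding mem_box
    proof
      fix i :: 'a assume i: "i \<in> Basis"
      have "\<bar>x \<bullet> i\<bar> \<le> real (Suc k)" using Basis_le_norm[OF i, of x] n by linarith
      then show "- (real (Suc k) *\<^sub>R One) \<bullet> i \<le> x \<bullet> i \<and> x \<bullet> i \<le> (real (Suc k) *\<^sub>R One) \<bullet> i"
        using i by (simp add: inner_sum_left_Basis del: of_nat_Suc) linarith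
    qed
    then have "x \<in> N (real (Suc k)) (real_of_rat s) (real_of_rat t)"
      using t s by (simp add: N_def less_imp_le)
    moreover have "(real (Suc k), real_of_rat s, real_of_rat t) \<in> I"
      using t(3) s(1) by (auto simp: I_def ennreal_less_iff less_imp_le simp del: of_nat_Suc)
    ultimately show "x \<in> (\<Union>(n, s, t)\<in>I. N n s t)" by blast
  qed
qed

section \<open>Reverse Hoelder inequality for \<open>A\<^sub>1\<close> weights\<close>

text \<open>
  For a weight that satisfies the \<open>A\<^sub>1\<close> condition, the weak-type inequality can be
  reversed inside a cube. Above the average over the cube, every point of the level set
  lies in a cube of almost maximal side on which the level is exceeded; on its triple the average has already
  dropped, while on the cube itself the \<open>A\<^sub>1\<close> condition bounds the weight from below.
\<close>

lemma reverse_weak_type_A1: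
  fixes w :: "'a::euclidean_space \<Rightarrow> ennreal"
  assumes [measurable]: "w \<in> borel_measurable lebesgue"
    and A1: "AE x in lebesgue. hl_max w x \<le> A * w x"
    and Q: "0 < snd Q" and t: "avg w Q \<le> t" "0 < t" "t < top"
  shows "(\<integral>\<^sup>+x\<in>cube Q. w x * indicator {s. t < s} (w x) \<partial>lebesgue) \<le>
    3 ^ DIM('a) * (t * (\<integral>\<^sup>+x\<in>cube (tripled Q). indicator {s. t \<le> s} (A * w x) \<partial>lebesgue))"
proof -
  define f where "f x = w x * indicator (cube Q) x" for x
  have [measurable]: "f \<in> borel_measurable lebesgue" unfolding f_def by measurable
  define G where "G x = (indicator {s. t \<le> s} (A * w x) :: ennreal)" for x
  have [measurable]: "G \<in> borel_measurable lebesgue" unfolding G_def by measurable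
  have f_le: "f x \<le> w x" for x by (simp add: f_def indicator_def)
  have "AE x in lebesgue. f x \<le> hl_max f x" by (rule AE_le_hl_max) measurable
  then have "(\<integral>\<^sup>+x\<in>cube Q. w x * indicator {s. t < s} (w x) \<partial>lebesgue) \<le> (\<integral>\<^sup>+x\<in>{x. t < hl_max f x}. f x \<partial>lebesgue)"
    by (intro nn_integral_mono_AE, eventually_elim) (auto simp: f_def indicator_def)
  also have "\<dots> \<le> 3 ^ DIM('a) * (t * (\<integral>\<^sup>+x\<in>cube (tripled Q). G x \<partial>lebesgue))"
  proof (rule nn_integral_open_leI[OF open_hl_max_greater])
    fix K assume K: "compact K" "K \<subseteq> {x. t < hl_max f x}"
    define S where "S = {q. 0 < snd q \<and> t < avg f q \<and> avg f (tripled q) \<le> t}"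
    \<comment> \<open>The function \<open>f\<close> vanishes off \<open>Q\<close>, so a cube with an average above \<open>t\<close> has smaller volume than \<open>Q\<close>.\<close>
    have smaller: "snd q < snd Q" if q: "0 < snd q" "t < avg f q" for q
    proof -
      have "t * emeasure lebesgue (cube q) < avg f q * emeasure lebesgue (cube q)"
        using q emeasure_cube_pos[OF q(1)] by (intro ennreal_mult_strict_right_mono) (auto simp: zero_less_iff_neq_zero)
      also have "\<dots> = (\<integral>\<^sup>+x\<in>cube q. f x \<partial>lebesgue)" by (rule set_nn_integral_cube[OF q(1), symmetric])
      also have "\<dots> \<le> (\<integral>\<^sup>+x\<in>cube Q. w x \<partial>lebesgue)"
        by (intro nn_integral_mono) (auto simp: f_def indicator_def)
      also have "\<dots> = avg w Q * emeasure lebesgue (cube Q)" by (rule set_nn_integral_cube[OF Q])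
      also have "\<dots> \<le> t * emeasure lebesgue (cube Q)" using t by (intro mult_right_mono) auto
      finally have lt: "t * emeasure lebesgue (cube q) < t * emeasure lebesgue (cube Q)" .
      have "emeasure lebesgue (cube q) < emeasure lebesgue (cube Q)"
      proof (rule ccontr)
        assume "\<not> emeasure lebesgue (cube q) < emeasure lebesgue (cube Q)"
        then have "t * emeasure lebesgue (cube Q) \<le> t * emeasure lebesgue (cube q)"
          by (intro mult_left_mono) auto
        with lt show False by simp
      qed
      then have "snd q ^ DIM('a) < snd Q ^ DIM('a)"
        using q Q by (simp add: emeasure_cube ennreal_less_iff)
      then show ?thesis by (rule power_less_imp_less_base) (use Q in simp)
    qed
    have "\<exists>q\<in>S. x \<in> interior (cube q)" if "x \<in> K" for x
    proof -
      define P where "P = {q. 0 < snd q \<and> x \<in> interior (cube q) \<and> t < avg f q}"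
      have "t < hl_max f x" using that K(2) by blast
      then obtain p where "0 < snd p" "x \<in> interior (cube p)" "t < avg f p"
        by (rule less_hl_max_interiorE)
      then have ne: "P \<noteq> {}" unfolding P_def by blast
      have bdd: "bdd_above (snd ` P)"
        using smaller unfolding P_def by (intro bdd_aboveI2[of _ _ "snd Q"]) (simp add: less_imp_le)
      have "0 < Sup (snd ` P)"
      proof -
        obtain q where "q \<in> P" using ne by blast
        then have "snd q \<le> Sup (snd ` P)" "0 < snd q"
          using cSUP_upper[OF _ bdd, of q] by (simp_all add: P_def)
        then show ?thesis by linarith
      qed
      \<comment> \<open>A side above a third of the supremum makes the triple too large to exceed the level.\<close>
      then have "Sup (snd ` P) / 3 < Sup (snd ` P)" by simp
      then obtain q where q: "q \<in> P" "Sup (snd ` P) / 3 < snd q"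
        using less_cSUP_iff[OF ne bdd] by blast
      have "tripled q \<notin> P"
      proof
        assume "tripled q \<in> P"
        then have "snd (tripled q) \<le> Sup (snd ` P)" by (rule cSUP_upper[OF _ bdd])
        then show False using q(2) by simp
      qed
      then have "avg f (tripled q) \<le> t"
        using q(1) interior_cube_subset_interior_tripled[of q] unfolding P_def
        by (auto simp: subset_iff)
      then have "q \<in> S" "x \<in> interior (cube q)" using q(1) by (simp_all add: P_def S_def)
      then show ?thesis by blast
    qed
    then obtain J where J: "finite J" "J \<subseteq> S" "disjoint_family_on cube J" "K \<subseteq> (\<Union>q\<in>J. cube (tripled q))"
      using compact_Vitali_cubes[OF K(1), of S] by (auto simp: S_def)
    have pos: "0 < snd q" "t < avg f q" "avg f (tripled q) \<le> t" if "q \<in> J" for q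
      using that J(2) by (auto simp: S_def)
    have *: "(\<integral>\<^sup>+x\<in>cube (tripled q). f x \<partial>lebesgue) \<le>
        3 ^ DIM('a) * (t * (\<integral>\<^sup>+x\<in>cube q. G x * indicator (cube (tripled Q)) x \<partial>lebesgue))" if q: "q \<in> J" for q
    proof -
      note p = pos[OF q]
      have "cube q \<inter> cube Q \<noteq> {}"
      proof
        assume disj: "cube q \<inter> cube Q = {}"
        then have "(\<integral>\<^sup>+x\<in>cube q. f x \<partial>lebesgue) = (\<integral>\<^sup>+x. 0 \<partial>(lebesgue :: 'a measure))"
          by (intro nn_integral_cong) (auto simp: f_def indicator_def)
        then show False using p(2) by (simp add: avg_def)
      qed
      then have sub: "cube q \<subseteq> cube (tripled Q)"
        using smaller[OF p(1,2)] p(1) by (intro cube_subset_tripled) auto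
      have "AE x in lebesgue. indicator (cube q) x \<le> G x * indicator (cube (tripled Q)) x * indicator (cube q) x"
        using A1
      proof eventually_elim
        fix x assume x: "hl_max w x \<le> A * w x"
        show "(indicator (cube q) x :: ennreal) \<le> G x * indicator (cube (tripled Q)) x * indicator (cube q) x"
        proof (cases "x \<in> cube q")
          case True
          have "t \<le> avg f q" using p(2) by simp
          also have "\<dots> \<le> avg w q" by (intro avg_mono f_le)
          also have "\<dots> \<le> hl_max w x" by (rule avg_le_hl_max[OF p(1) True])
          also note x
          finally show ?thesis using sub True by (auto simp: G_def)
        qed simp
      qed
      then have "(\<integral>\<^sup>+x. indicator (cube q) x \<partial>lebesgue) \<le>
         (\<integral>\<^sup>+x\<in>cube q. G x * indicator (cube (tripled Q)) x \<partial>lebesgue)"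
        by (rule nn_integral_mono_AE)
      then have vol: "emeasure lebesgue (cube q) \<le> (\<integral>\<^sup>+x\<in>cube q. G x * indicator (cube (tripled Q)) x \<partial>lebesgue)"
        by simp
      have "(\<integral>\<^sup>+x\<in>cube (tripled q). f x \<partial>lebesgue) = avg f (tripled q) * (3 ^ DIM('a) * emeasure lebesgue (cube q))"
        using p(1) by (simp add: set_nn_integral_cube emeasure_tripled)
      also have "\<dots> \<le> t * (3 ^ DIM('a) * (\<integral>\<^sup>+x\<in>cube q. G x * indicator (cube (tripled Q)) x \<partial>lebesgue))"
        using p(3) vol by (intro mult_mono) auto
      finally show ?thesis by (simp add: mult.left_commute)
    qed
    have "(\<integral>\<^sup>+x\<in>K. f x \<partial>lebesgue) \<le> (\<Sum>q\<in>J. \<integral>\<^sup>+x\<in>cube (tripled q). f x \<partial>lebesgue)"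
      using J pos by (intro nn_integral_cover_le) auto
    also have "\<dots> \<le> (\<Sum>q\<in>J. 3 ^ DIM('a) * (t * (\<integral>\<^sup>+x\<in>cube q. G x * indicator (cube (tripled Q)) x \<partial>lebesgue)))"
      by (intro sum_mono *)
    also have "\<dots> = 3 ^ DIM('a) * (t * (\<Sum>q\<in>J. \<integral>\<^sup>+x\<in>cube q. G x * indicator (cube (tripled Q)) x \<partial>lebesgue))"
      by (simp add: sum_distrib_left)
    also have "\<dots> \<le> 3 ^ DIM('a) * (t * (1 * (\<integral>\<^sup>+x\<in>cube (tripled Q). G x \<partial>lebesgue)))"
      using J sum_indicator_disjoint_le[OF J(1,3)]
      by (intro mult_left_mono sum_nn_integral_overlap) auto
    finally show "(\<integral>\<^sup>+x\<in>K. f x \<partial>lebesgue) \<le> 3 ^ DIM('a) * (t * (\<integral>\<^sup>+x\<in>cube (tripled Q). G x \<partial>lebesgue))"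
      by simp
  qed measurable
  finally show ?thesis by (simp add: G_def)
qed

text \<open>
  The layers weighted by the increments of the power function. The small factor \<open>2\<^sup>e - 1\<close> is what makes
  the absorption in the reverse Hoelder inequality possible.
\<close>

lemma dyadic_layer_telescope:
  assumes "0 < d" "0 < e" "0 \<le> s"
  shows "ennreal (s powr e) \<le> ennreal (d powr e) +
    (\<Sum>k::nat. ennreal ((2 powr e - 1) * (2 ^ k * d) powr e) * indicator {u. ennreal (2 ^ k * d) < u} (ennreal s))"
    (is "_ \<le> _ + suminf ?F")
proof (cases "s \<le> d")
  case True
  then have "ennreal (s powr e) \<le> ennreal (d powr e)"
    using assms by (intro ennreal_leI powr_mono2) auto
  then show ?thesis by (rule order_trans) simp
next
  case False
  obtain n where "s / d < 2 ^ n" using real_arch_pow[of 2 "s/d"] by auto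
  then have n: "s \<le> 2 ^ n * d" using assms by (simp add: field_simps)
  define m where "m = (LEAST n. s \<le> 2 ^ n * d)"
  have m: "s \<le> 2 ^ m * d" unfolding m_def using n by (rule LeastI)
  have below: "2 ^ k * d < s" if "k < m" for k
    using not_less_Least[of k "\<lambda>n. s \<le> 2 ^ n * d"] that by (simp add: m_def not_le)
  have tele: "d powr e + (\<Sum>k<m. (2 powr e - 1) * (2 ^ k * d) powr e) = (2 ^ m * d) powr e"
  proof (induction m)
    case (Suc m)
    have "(2 ^ Suc m * d) powr e = 2 powr e * (2 ^ m * d) powr e"
      using assms by (simp add: powr_mult)
    then show ?case using Suc by (simp add: algebra_simps)
  qed simp
  have "1 \<le> 2 powr e" using assms(2) by (intro ge_one_powr_ge_zero) auto
  then have nonneg: "0 \<le> (2 powr e - 1) * (2 ^ k * d) powr e" for k by simp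
  have "ennreal (s powr e) \<le> ennreal ((2 ^ m * d) powr e)"
    using m assms by (intro ennreal_leI powr_mono2) auto
  also have "\<dots> = ennreal (d powr e) + (\<Sum>k<m. ennreal ((2 powr e - 1) * (2 ^ k * d) powr e))"
    unfolding tele[symmetric] using nonneg by (subst sum_ennreal) (simp_all add: sum_nonneg)
  also have "(\<Sum>k<m. ennreal ((2 powr e - 1) * (2 ^ k * d) powr e)) = sum ?F {..<m}"
    using below assms by (intro sum.cong) (auto simp: ennreal_less_iff)
  also have "ennreal (d powr e) + sum ?F {..<m} \<le> ennreal (d powr e) + suminf ?F"
    by (intro add_left_mono sum_le_suminf) auto
  finally show ?thesis .
qed

text \<open>
  The layers of \<open>w\<^bsup>1+e\<^esup>\<close> above the average of \<open>w\<close> are estimated by the reversed weak-type inequality and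
  summed over the triple; the part below the average gives the first term.
\<close>

lemma avg_epowr_A1_le:
  fixes w :: "'a::euclidean_space \<Rightarrow> ennreal"
  assumes [measurable]: "w \<in> borel_measurable lebesgue"
    and bdd: "\<And>x. w x \<le> ennreal n"
    and A1: "AE x in lebesgue. hl_max w x \<le> ennreal A * w x"
    and A: "1 \<le> A" and e: "0 < e" "e \<le> 1" and Q: "0 < snd Q"
  shows "avg (\<lambda>x. w x epowr (1 + e)) Q \<le> (avg w Q) epowr (1 + e) +
    ennreal (2 * 9 ^ DIM('a) * A\<^sup>2 * (2 powr e - 1)) * avg (\<lambda>x. w x epowr (1 + e)) (tripled Q)"
proof (cases "avg w Q = 0")
  case True
  then have "(\<integral>\<^sup>+x\<in>cube Q. w x \<partial>lebesgue) = 0"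
    using Q by (simp add: set_nn_integral_cube)
  then have "AE x in lebesgue. w x * indicator (cube Q) x = 0"
    by (subst (asm) nn_integral_0_iff_AE) auto
  then have "AE x in lebesgue. w x epowr (1 + e) * indicator (cube Q) x = 0"
    by eventually_elim auto
  then have "(\<integral>\<^sup>+x\<in>cube Q. w x epowr (1 + e) \<partial>lebesgue) = 0"
    by (subst nn_integral_0_iff_AE) auto
  then show ?thesis by (simp add: avg_def)
next
  case False
  have "avg w Q \<le> ennreal n" using avg_mono[of w "\<lambda>_. ennreal n" Q, OF bdd] Q by (simp add: avg_const)
  then have fin: "avg w Q < top" by (rule le_less_trans) simp
  define d where "d = enn2real (avg w Q)"
  have d: "0 < d" "avg w Q = ennreal d"
    using False fin by (simp_all add: d_def enn2real_positive_iff zero_less_iff_neq_zero)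
  define b where "b k = 2 ^ k * d" for k :: nat
  have b: "0 < b k" "d \<le> b k" for k
    using d(1) mult_right_mono[of 1 "2 ^ k" d] by (simp_all add: b_def)
  define c where "c = 2 powr e - 1"
  have c: "0 < c" using e by (simp add: c_def)
  define I where "I = (\<integral>\<^sup>+x\<in>cube (tripled Q). w x epowr (1 + e) \<partial>lebesgue)"
  have two: "2 powr (1 + e) / (2 powr (1 + e) - 1) \<le> 2"
  proof -
    have "2 powr 1 \<le> 2 powr (1 + e)" using e by (intro powr_mono) auto
    then show ?thesis by (simp add: field_simps)
  qed
  define L where "L k x = w x * (ennreal (c * b k powr e) * indicator {s. ennreal (b k) < s} (w x)) * indicator (cube Q) x"
    for k x
  define R where "R k x = ennreal (b k powr (1+e)) * indicator {s. ennreal (b k) \<le> s} (ennreal A * w x) * indicator (cube (tripled Q)) x"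
    for k x
  have [measurable]: "L k \<in> borel_measurable lebesgue" "R k \<in> borel_measurable lebesgue" for k
    unfolding L_def R_def by measurable
  have layer: "(\<integral>\<^sup>+x. L k x \<partial>lebesgue) \<le> ennreal (c * 3 ^ DIM('a)) * (\<integral>\<^sup>+x. R k x \<partial>lebesgue)" for k
  proof -
    have "(\<integral>\<^sup>+x. L k x \<partial>lebesgue) =
      ennreal (c * b k powr e) * (\<integral>\<^sup>+x\<in>cube Q. w x * indicator {s. ennreal (b k) < s} (w x) \<partial>lebesgue)"
      unfolding L_def by (subst nn_integral_cmult[symmetric]) (auto simp: mult_ac)
    also have "\<dots> \<le> ennreal (c * b k powr e) * (3 ^ DIM('a) * (ennreal (b k) *
        (\<integral>\<^sup>+x\<in>cube (tripled Q). indicator {s. ennreal (b k) \<le> s} (ennreal A * w x) \<partial>lebesgue)))"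
      using b[of k] d(2) by (intro mult_left_mono reverse_weak_type_A1 A1 Q) (simp_all add: ennreal_leI)
    also have "\<dots> = ennreal (c * b k powr e) * ennreal (3 ^ DIM('a)) * ennreal (b k) *
        (\<integral>\<^sup>+x\<in>cube (tripled Q). indicator {s. ennreal (b k) \<le> s} (ennreal A * w x) \<partial>lebesgue)"
      by (simp add: mult.assoc ennreal_power[symmetric])
    also have "ennreal (c * b k powr e) * ennreal (3 ^ DIM('a)) * ennreal (b k) = ennreal (c * 3 ^ DIM('a)) * ennreal (b k powr (1+e))"
      using b[of k] c by (simp add: ennreal_mult[symmetric] powr_add mult_ac)
    also have "\<dots> * (\<integral>\<^sup>+x\<in>cube (tripled Q). indicator {s. ennreal (b k) \<le> s} (ennreal A * w x) \<partial>lebesgue) =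
       ennreal (c * 3 ^ DIM('a)) * (\<integral>\<^sup>+x. R k x \<partial>lebesgue)"
      unfolding R_def by (simp add: mult.assoc nn_integral_cmult)
    finally show ?thesis .
  qed
  have "(\<integral>\<^sup>+x\<in>cube Q. w x epowr (1 + e) \<partial>lebesgue) \<le>
    (\<integral>\<^sup>+x. ennreal (d powr e) * (w x * indicator (cube Q) x) + (\<Sum>k. L k x) \<partial>lebesgue)"
  proof (rule nn_integral_mono)
    fix x
    obtain s where s: "0 \<le> s" "w x = ennreal s"
      using bdd[of x] less_top_ennreal[of "w x"] le_less_trans[OF bdd ennreal_less_top] by blast
    have "w x epowr (1 + e) * indicator (cube Q) x = w x * indicator (cube Q) x * ennreal (s powr e)"
      using s by (simp add: epowr_add epowr_ennreal mult_ac)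
    also have "\<dots> \<le> w x * indicator (cube Q) x * (ennreal (d powr e) +
       (\<Sum>k. ennreal (c * b k powr e) * indicator {s. ennreal (b k) < s} (w x)))"
      unfolding s(2) c_def b_def
      by (intro mult_left_mono dyadic_layer_telescope d(1) e(1) s(1)) simp
    also have "\<dots> = ennreal (d powr e) * (w x * indicator (cube Q) x) +
       (\<Sum>k. w x * indicator (cube Q) x * (ennreal (c * b k powr e) * indicator {s. ennreal (b k) < s} (w x)))"
      unfolding ennreal_suminf_cmult by (simp add: distrib_left mult.commute)
    also have "\<dots> = ennreal (d powr e) * (w x * indicator (cube Q) x) + (\<Sum>k. L k x)"
      unfolding L_def by (simp only: mult_ac)
    finally show "w x epowr (1 + e) * indicator (cube Q) x \<le> ennreal (d powr e) * (w x * indicator (cube Q) x) + (\<Sum>k. L k x)" .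
  qed
  also have "\<dots> = (\<integral>\<^sup>+x. ennreal (d powr e) * (w x * indicator (cube Q) x) \<partial>lebesgue) + (\<integral>\<^sup>+x. (\<Sum>k. L k x) \<partial>lebesgue)"
    by (rule nn_integral_add) measurable
  also have "(\<integral>\<^sup>+x. (\<Sum>k. L k x) \<partial>lebesgue) = (\<Sum>k. \<integral>\<^sup>+x. L k x \<partial>lebesgue)"
    by (rule nn_integral_suminf) measurable
  also have "(\<integral>\<^sup>+x. ennreal (d powr e) * (w x * indicator (cube Q) x) \<partial>lebesgue) + (\<Sum>k. \<integral>\<^sup>+x. L k x \<partial>lebesgue) \<le>
    (\<integral>\<^sup>+x. ennreal (d powr e) * (w x * indicator (cube Q) x) \<partial>lebesgue) +
    (\<Sum>k. ennreal (c * 3 ^ DIM('a)) * (\<integral>\<^sup>+x. R k x \<partial>lebesgue))"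
    by (intro add_left_mono suminf_le layer) auto
  also have "(\<integral>\<^sup>+x. ennreal (d powr e) * (w x * indicator (cube Q) x) \<partial>lebesgue) = ennreal (d powr e) * (\<integral>\<^sup>+x\<in>cube Q. w x \<partial>lebesgue)"
    by (rule nn_integral_cmult) measurable
  also have "(\<Sum>k. ennreal (c * 3 ^ DIM('a)) * (\<integral>\<^sup>+x. R k x \<partial>lebesgue)) =
    ennreal (c * 3 ^ DIM('a)) * (\<integral>\<^sup>+x. (\<Sum>k. R k x) \<partial>lebesgue)"
    unfolding ennreal_suminf_cmult by (subst nn_integral_suminf) simp_all
  finally have main1: "(\<integral>\<^sup>+x\<in>cube Q. w x epowr (1 + e) \<partial>lebesgue) \<le>
    ennreal (d powr e) * (\<integral>\<^sup>+x\<in>cube Q. w x \<partial>lebesgue) + ennreal (c * 3 ^ DIM('a)) * (\<integral>\<^sup>+x. (\<Sum>k. R k x) \<partial>lebesgue)" .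
  have "(\<integral>\<^sup>+x. (\<Sum>k. R k x) \<partial>lebesgue) \<le> (\<integral>\<^sup>+x. ennreal (2 * A\<^sup>2) * (w x epowr (1+e) * indicator (cube (tripled Q)) x) \<partial>lebesgue)"
  proof (rule nn_integral_mono)
    fix x
    have "(\<Sum>k. ennreal (b k powr (1+e)) * indicator {s. ennreal (b k) \<le> s} (ennreal A * w x)) \<le>
      ennreal (2 powr (1+e) / (2 powr (1+e) - 1)) * (ennreal A * w x) epowr (1+e)"
      unfolding b_def using d(1) e(1) by (intro dyadic_layer_sum) auto
    also have "\<dots> \<le> ennreal 2 * (ennreal A * w x) epowr (1+e)"
      by (intro mult_right_mono ennreal_leI two) auto
    also have "(ennreal A * w x) epowr (1+e) = ennreal (A powr (1+e)) * w x epowr (1+e)"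
      using A by (simp add: epowr_mult epowr_ennreal)
    also have "ennreal 2 * (ennreal (A powr (1+e)) * w x epowr (1+e)) \<le> ennreal 2 * (ennreal (A powr 2) * w x epowr (1+e))"
      using A e by (intro mult_left_mono mult_right_mono ennreal_leI powr_mono) auto
    also have "\<dots> = ennreal (2 * A\<^sup>2) * w x epowr (1+e)"
      using A by (simp add: ennreal_mult mult.assoc powr_numeral)
    finally have "(\<Sum>k. ennreal (b k powr (1+e)) * indicator {s. ennreal (b k) \<le> s} (ennreal A * w x)) * indicator (cube (tripled Q)) x
        \<le> ennreal (2 * A\<^sup>2) * w x epowr (1+e) * indicator (cube (tripled Q)) x"
      by (rule mult_right_mono) simp
    then show "(\<Sum>k. R k x) \<le> ennreal (2 * A\<^sup>2) * (w x epowr (1+e) * indicator (cube (tripled Q)) x)"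
      unfolding R_def ennreal_suminf_multc by (simp only: mult.assoc)
  qed
  also have "\<dots> = ennreal (2 * A\<^sup>2) * I"
    unfolding I_def by (rule nn_integral_cmult) measurable
  finally have main2: "(\<integral>\<^sup>+x. (\<Sum>k. R k x) \<partial>lebesgue) \<le> ennreal (2 * A\<^sup>2) * I" .
  have "(\<integral>\<^sup>+x\<in>cube Q. w x \<partial>lebesgue) = ennreal d * emeasure lebesgue (cube Q)"
    using Q d(2) by (simp add: set_nn_integral_cube)
  with main1 main2 have main: "(\<integral>\<^sup>+x\<in>cube Q. w x epowr (1 + e) \<partial>lebesgue) \<le>
    ennreal (d powr e) * (ennreal d * emeasure lebesgue (cube Q)) + ennreal (c * 3 ^ DIM('a)) * (ennreal (2 * A\<^sup>2) * I)"
    by (auto elim!: order_trans intro!: add_left_mono mult_left_mono)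
  have I: "I = avg (\<lambda>x. w x epowr (1 + e)) (tripled Q) * (ennreal (3 ^ DIM('a)) * emeasure lebesgue (cube Q))"
    using Q by (simp add: I_def set_nn_integral_cube emeasure_tripled ennreal_power[symmetric])
  have nine: "c * 3 ^ DIM('a) * (2 * A\<^sup>2) * 3 ^ DIM('a) = 2 * 9 ^ DIM('a) * A\<^sup>2 * c"
    using power_mult_distrib[of 3 "3::real" "DIM('a)"] by simp
  have "ennreal (c * 3 ^ DIM('a)) * (ennreal (2 * A\<^sup>2) * I) =
     ennreal (c * 3 ^ DIM('a)) * ennreal (2 * A\<^sup>2) * ennreal (3 ^ DIM('a)) * avg (\<lambda>x. w x epowr (1 + e)) (tripled Q) * emeasure lebesgue (cube Q)"
    unfolding I by (simp only: mult_ac)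
  also have "ennreal (c * 3 ^ DIM('a)) * ennreal (2 * A\<^sup>2) * ennreal (3 ^ DIM('a)) = ennreal (2 * 9 ^ DIM('a) * A\<^sup>2 * c)"
    unfolding nine[symmetric] using c by (simp add: ennreal_mult)
  finally have "(\<integral>\<^sup>+x\<in>cube Q. w x epowr (1 + e) \<partial>lebesgue) \<le>
     (ennreal (d powr e) * ennreal d + ennreal (2 * 9 ^ DIM('a) * A\<^sup>2 * c) * avg (\<lambda>x. w x epowr (1 + e)) (tripled Q)) * emeasure lebesgue (cube Q)"
    using main by (simp add: distrib_right mult.assoc)
  also have "ennreal (d powr e) * ennreal d = avg w Q epowr (1 + e)"
    using d by (simp add: epowr_add epowr_ennreal mult.commute)
  finally show ?thesis
    unfolding c_def avg_def[of "\<lambda>x. w x epowr (1 + e)" Q]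
    using emeasure_cube_pos[OF Q] by (intro divide_le_posI_ennreal) (auto simp: zero_less_iff_neq_zero mult.commute)
qed

text \<open>
  The reverse Hoelder inequality for \<open>A\<^sub>1\<close> weights in the form of a bound for maximal
  functions. For bounded weights the estimate over cubes and their triples bounds the
  maximal function of \<open>w\<^bsup>1+e\<^esup>\<close> by itself with a small factor, and this term is absorbed;
  truncations of \<open>A\<^sub>1\<close> weights are \<open>A\<^sub>1\<close> weights.
\<close>

lemma reverse_Hoelder_A1:
  assumes A: "1 \<le> A"
  shows "\<exists>e0>0. \<forall>e\<in>{0<..e0}. \<forall>(w::'a::euclidean_space \<Rightarrow> ennreal)\<in>borel_measurable lebesgue.
    (AE x in lebesgue. hl_max w x \<le> ennreal A * w x) \<longrightarrow>
    (\<forall>x. hl_max (\<lambda>y. w y epowr (1 + e)) x \<le> 2 * hl_max w x epowr (1 + e))"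
proof (intro exI conjI ballI impI allI)
  define B where "B = 2 * 9 ^ DIM('a) * A\<^sup>2"
  have "1 * 1 \<le> (9::real) ^ DIM('a) * A\<^sup>2"
    using one_le_power[OF A, of 2] one_le_power[of "9::real" "DIM('a)"] by (intro mult_mono) auto
  then have B: "2 \<le> B" by (simp add: B_def)
  show "0 < 1 / (2 * B)" using B by simp
  fix e :: real and w :: "'a \<Rightarrow> ennreal" and x
  assume e: "e \<in> {0<..1 / (2 * B)}" and [measurable]: "w \<in> borel_measurable lebesgue"
    and A1: "AE x in lebesgue. hl_max w x \<le> ennreal A * w x"
  have e1: "0 < e" "e \<le> 1" "B * e \<le> 1/2"
  proof -
    have "1 / (2 * B) \<le> 1" using B by simp
    then show "0 < e" "e \<le> 1" using e by auto
    have "B * e \<le> B * (1 / (2 * B))" using e B by (intro mult_left_mono) auto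
    then show "B * e \<le> 1/2" using B by simp
  qed
  have "2 powr e \<le> 1 + e"
    using Youngs_inequality_0[of e "1 - e" 2 1] e1 by (simp add: algebra_simps)
  then have small: "B * (2 powr e - 1) \<le> 1/2"
    using e1(3) B mult_left_mono[of "2 powr e - 1" e B] by linarith
  have bounded: "hl_max (\<lambda>y. v y epowr (1 + e)) x \<le> 2 * hl_max v x epowr (1 + e)"
    if [measurable]: "v \<in> borel_measurable lebesgue" and n: "\<And>x. v x \<le> ennreal n"
      and v: "AE x in lebesgue. hl_max v x \<le> ennreal A * v x" for v :: "'a \<Rightarrow> ennreal" and n x
  proof -
    define H where "H = hl_max (\<lambda>y. v y epowr (1 + e)) x"
    have "H \<le> ennreal n epowr (1 + e)"
      unfolding H_def using n e1 by (intro hl_max_bounded epowr_mono) auto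
    then have fin: "H < top" by (rule le_less_trans) simp
    \<comment> \<open>The factor in front of the averages over triples is at most 1/2.\<close>
    have "H \<le> hl_max v x epowr (1 + e) + ennreal (1/2) * H"
      unfolding H_def
    proof (rule hl_max_leI)
      fix q :: "'a \<times> real" assume q: "0 < snd q" "x \<in> cube q"
      have "avg (\<lambda>y. v y epowr (1 + e)) q \<le> (avg v q) epowr (1 + e) +
          ennreal (B * (2 powr e - 1)) * avg (\<lambda>x. v x epowr (1 + e)) (tripled q)"
        unfolding B_def using v n A e1 q by (intro avg_epowr_A1_le) auto
      also have "\<dots> \<le> hl_max v x epowr (1 + e) + ennreal (1/2) * hl_max (\<lambda>y. v y epowr (1 + e)) x"
        using q e1 small cube_subset_own_tripled[OF q(1)]
        by (intro add_mono mult_mono epowr_mono avg_le_hl_max ennreal_leI) auto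
      finally show "avg (\<lambda>y. v y epowr (1 + e)) q \<le> hl_max v x epowr (1 + e) + ennreal (1/2) * hl_max (\<lambda>y. v y epowr (1 + e)) x" .
    qed
    moreover have "H = ennreal (1/2) * H + ennreal (1/2) * H"
      unfolding distrib_right[symmetric] by (subst ennreal_plus[symmetric]) auto
    moreover have "ennreal (1/2) * H < top" using fin by (simp add: ennreal_mult_less_top del: ennreal_half)
    ultimately have "ennreal (1/2) * H \<le> hl_max v x epowr (1 + e)"
      by (metis add.commute ennreal_add_left_cancel_le infinity_ennreal_def less_irrefl)
    then have "2 * (ennreal (1/2) * H) \<le> 2 * hl_max v x epowr (1 + e)" by (rule mult_left_mono) simp
    moreover have "2 * (ennreal (1/2) * H) = ennreal (2 * (1/2)) * H"
      by (subst ennreal_mult) (auto simp: mult.assoc)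
    ultimately show ?thesis by (simp add: H_def)
  qed
  define v where "v n y = min (w y) (ennreal (real n))" for n :: nat and y
  have v[measurable]: "v n \<in> borel_measurable lebesgue" for n unfolding v_def by measurable
  have v_A1: "AE y in lebesgue. hl_max (v n) y \<le> ennreal A * v n y" for n
    using A1
  proof eventually_elim
    fix y assume y: "hl_max w y \<le> ennreal A * w y"
    have "hl_max (v n) y \<le> hl_max w y" by (intro hl_max_mono) (simp add: v_def)
    moreover have "hl_max (v n) y \<le> ennreal (real n)" by (intro hl_max_bounded) (simp add: v_def)
    moreover have "ennreal (real n) \<le> ennreal A * ennreal (real n)"
      using A mult_right_mono[of 1 "ennreal A" "ennreal (real n)"] by simp
    ultimately show "hl_max (v n) y \<le> ennreal A * v n y"
      using y unfolding v_def by (auto simp: min_def intro: order_trans)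
  qed
  have sup: "(SUP n. v n y) = w y" for y
  proof (rule antisym)
    show "(SUP n. v n y) \<le> w y" by (intro SUP_least) (simp add: v_def)
    show "w y \<le> (SUP n. v n y)"
    proof (cases "w y")
      case (real r)
      obtain n where "r \<le> real n" using real_arch_simple by blast
      then show ?thesis using real by (intro SUP_upper2[of n]) (auto simp: v_def ennreal_leI)
    next
      case top
      then have "v n y = of_nat n" for n by (simp add: v_def ennreal_of_nat_eq_real_of_nat)
      then show ?thesis by (simp add: ennreal_SUP_of_nat_eq_top)
    qed
  qed
  have inc: "incseq (\<lambda>n y. v n y epowr (1 + e))"
    unfolding incseq_def le_fun_def v_def
    using e1 by (auto intro!: epowr_mono min.mono ennreal_leI)
  have "hl_max (\<lambda>y. w y epowr (1 + e)) x = hl_max (\<lambda>y. SUP n. v n y epowr (1 + e)) x"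
    using e1 by (simp add: sup[symmetric] SUP_epowr)
  also have "\<dots> = (SUP n. hl_max (\<lambda>y. v n y epowr (1 + e)) x)"
    using inc by (intro hl_max_SUP) measurable
  also have "\<dots> \<le> 2 * hl_max w x epowr (1 + e)"
  proof (rule SUP_least)
    fix n
    have "hl_max (\<lambda>y. v n y epowr (1 + e)) x \<le> 2 * hl_max (v n) x epowr (1 + e)"
      by (rule bounded[of _ "real n"]) (auto simp: v_def intro: v[unfolded v_def] v_A1[unfolded v_def])
    also have "\<dots> \<le> 2 * hl_max w x epowr (1 + e)"
      using e1 by (intro mult_left_mono epowr_mono hl_max_mono) (auto simp: v_def)
    finally show "hl_max (\<lambda>y. v n y epowr (1 + e)) x \<le> 2 * hl_max w x epowr (1 + e)" .
  qed
  finally show "hl_max (\<lambda>y. w y epowr (1 + e)) x \<le> 2 * hl_max w x epowr (1 + e)" .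
qed

section \<open>Sparse domination\<close>

text \<open>
  The sets \<open>E i\<close> are large parts of the cubes that are almost disjoint; an overlap of two is what the
  construction in \<open>sparse_domination\<close> produces.
\<close>

definition sparse_family :: "'i set \<Rightarrow> ('i \<Rightarrow> 'a::euclidean_space \<times> real) \<Rightarrow> ('i \<Rightarrow> 'a set) \<Rightarrow> bool" where
  "sparse_family I Q E \<longleftrightarrow> finite I \<and>
     (\<forall>i\<in>I. 0 < snd (Q i) \<and> E i \<in> sets lebesgue \<and> E i \<subseteq> cube (Q i) \<and>
        emeasure lebesgue (cube (Q i)) \<le> 2 * emeasure lebesgue (E i)) \<and>
     (\<forall>x. (\<Sum>i\<in>I. indicator (E i) x) \<le> (2 :: ennreal))"

definition cube_sum :: "'i set \<Rightarrow> ('i \<Rightarrow> 'a::euclidean_space \<times> real) \<Rightarrow> ('i \<Rightarrow> ennreal) \<Rightarrow> 'a \<Rightarrow> ennreal" where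
  "cube_sum I Q \<alpha> x = (\<Sum>i\<in>I. \<alpha> i * indicator (cube (Q i)) x)"

lemma measurable_cube_sum [measurable]: "cube_sum I Q \<alpha> \<in> borel_measurable lebesgue"
  unfolding cube_sum_def by measurable

text \<open>
  Passing from the cubes to their large, almost disjoint parts costs only a constant; this
  is how sums over a sparse family are dominated by integrals of maximal functions.
\<close>

lemma sparse_family_nn_integral_le:
  assumes sp: "sparse_family I Q E"
    and [measurable]: "v \<in> borel_measurable lebesgue" "G \<in> borel_measurable lebesgue"
    and G: "\<And>i x. i \<in> I \<Longrightarrow> x \<in> cube (Q i) \<Longrightarrow> \<alpha> i * avg v (Q i) \<le> G x"
  shows "(\<integral>\<^sup>+x. cube_sum I Q \<alpha> x * v x \<partial>lebesgue) \<le> 4 * (\<integral>\<^sup>+x. G x \<partial>lebesgue)"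
proof -
  have fin: "finite I" using sp by (simp add: sparse_family_def)
  have E: "0 < snd (Q i)" "E i \<in> sets lebesgue" "E i \<subseteq> cube (Q i)"
      "emeasure lebesgue (cube (Q i)) \<le> 2 * emeasure lebesgue (E i)" if "i \<in> I" for i
    using sp that by (simp_all add: sparse_family_def)
  have "(\<integral>\<^sup>+x. cube_sum I Q \<alpha> x * v x \<partial>lebesgue) =
     (\<integral>\<^sup>+x. (\<Sum>i\<in>I. \<alpha> i * (v x * indicator (cube (Q i)) x)) \<partial>lebesgue)"
    by (simp only: cube_sum_def sum_distrib_right mult.assoc mult.commute[of "indicator _ _"])
  also have "\<dots> = (\<Sum>i\<in>I. \<integral>\<^sup>+x. \<alpha> i * (v x * indicator (cube (Q i)) x) \<partial>lebesgue)"
    by (rule nn_integral_sum) measurable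
  also have "\<dots> \<le> (\<Sum>i\<in>I. 2 * (\<integral>\<^sup>+x\<in>E i. G x \<partial>lebesgue))"
  proof (rule sum_mono)
    fix i assume i: "i \<in> I"
    have "(\<integral>\<^sup>+x. \<alpha> i * (v x * indicator (cube (Q i)) x) \<partial>lebesgue) = \<alpha> i * (avg v (Q i) * emeasure lebesgue (cube (Q i)))"
      using E(1)[OF i] by (simp add: nn_integral_cmult set_nn_integral_cube)
    also have "\<dots> \<le> \<alpha> i * (avg v (Q i) * (2 * emeasure lebesgue (E i)))"
      by (intro mult_left_mono E(4) i) auto
    also have "\<dots> = 2 * (\<integral>\<^sup>+x\<in>E i. \<alpha> i * avg v (Q i) \<partial>lebesgue)"
      using E(2)[OF i] by (simp add: nn_integral_cmult mult.assoc mult.left_commute)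
    also have "\<dots> \<le> 2 * (\<integral>\<^sup>+x\<in>E i. G x \<partial>lebesgue)"
      using E(3)[OF i] by (intro mult_left_mono nn_integral_mono) (auto simp: indicator_def intro!: G i)
    finally show "(\<integral>\<^sup>+x. \<alpha> i * (v x * indicator (cube (Q i)) x) \<partial>lebesgue) \<le> 2 * (\<integral>\<^sup>+x\<in>E i. G x \<partial>lebesgue)" .
  qed
  also have "\<dots> = 2 * (\<Sum>i\<in>I. \<integral>\<^sup>+x\<in>E i. G x \<partial>lebesgue)" by (simp add: sum_distrib_left)
  also have "\<dots> \<le> 2 * (2 * (\<integral>\<^sup>+x. G x \<partial>lebesgue))"
    using sp E(2) fin by (intro mult_left_mono sum_nn_integral_overlap) (auto simp: sparse_family_def)
  finally show ?thesis by (simp add: mult.assoc[symmetric])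
qed

lemma avg_le_avg_tripled:
  fixes q :: "'a::euclidean_space \<times> real"
  assumes q: "0 < snd q"
  shows "avg F q \<le> 3 ^ DIM('a) * avg F (tripled q)"
proof -
  have "(\<integral>\<^sup>+x\<in>cube q. F x \<partial>lebesgue) \<le> (\<integral>\<^sup>+x\<in>cube (tripled q). F x \<partial>lebesgue)"
    using cube_subset_own_tripled[OF q] by (intro nn_integral_mono) (auto simp: indicator_def)
  also have "\<dots> = emeasure lebesgue (cube q) * (3 ^ DIM('a) * avg F (tripled q))"
    using q by (simp add: set_nn_integral_cube emeasure_tripled mult_ac)
  finally show ?thesis
    unfolding avg_def[of F q] using emeasure_cube_pos[OF q]
    by (intro divide_le_posI_ennreal) (auto simp: zero_less_iff_neq_zero)
qed

lemma geometric_level: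
  fixes a t :: real
  assumes "1 < a" "0 < t"
  obtains k :: int where "a powr k < t" "t \<le> a powr (k + 1)"
proof
  have c: "real_of_int (\<lceil>log a t\<rceil> - 1) < log a t" "log a t \<le> real_of_int (\<lceil>log a t\<rceil> - 1 + 1)"
    by linarith+
  show "a powr real_of_int (\<lceil>log a t\<rceil> - 1) < t" using c(1) assms by (simp only: less_log_iff)
  show "t \<le> a powr real_of_int (\<lceil>log a t\<rceil> - 1 + 1)" using c(2) assms by (simp only: log_le_iff)
qed

text \<open>
  Let \<open>x\<^sub>0 \<in> Q\<close> have \<open>hl_max h x\<^sub>0 \<le> t\<close>, and let the maximal function at a point of \<open>Q\<close> be much
  larger than \<open>t\<close>. The cubes responsible for this cannot be larger than \<open>Q\<close>, because their
  triples would contain \<open>x\<^sub>0\<close>. So only the part of \<open>h\<close> near \<open>Q\<close> matters, and by the weak-type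
  inequality such points fill at most half of \<open>Q\<close>.
\<close>

lemma cube_high_level_le_half:
  fixes h :: "'a::euclidean_space \<Rightarrow> ennreal"
  assumes [measurable]: "h \<in> borel_measurable lebesgue"
    and q: "0 < snd q" and x0: "x0 \<in> cube q" "hl_max h x0 \<le> ennreal t" and t: "0 < t"
  shows "emeasure lebesgue (cube q) \<le>
    2 * emeasure lebesgue (cube q - {x. ennreal (2 * 9 ^ DIM('a) * t) < hl_max h x})"
proof -
  define s where "s = 2 * 9 ^ DIM('a) * t"
  define g where "g x = h x * indicator (cube (tripled q)) x" for x
  have [measurable]: "g \<in> borel_measurable lebesgue" unfolding g_def by measurable
  define X where "X = cube q \<inter> {x. ennreal s < hl_max h x}"
  have X_sets: "X \<in> sets lebesgue" by (simp add: X_def)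
  have "(3::real) ^ DIM('a) \<le> 9 ^ DIM('a)" by (intro power_mono) auto
  moreover have "0 \<le> (9::real) ^ DIM('a)" by (intro zero_le_power) auto
  ultimately have "3 ^ DIM('a) \<le> 2 * (9::real) ^ DIM('a)" by linarith
  then have s_ge: "3 ^ DIM('a) * t \<le> s" using t unfolding s_def by (intro mult_right_mono) auto
  have x0t: "x0 \<in> cube (tripled q)" using x0(1) cube_subset_own_tripled[OF q] by blast
  have "X \<subseteq> {x. ennreal s < hl_max g x}"
  proof (intro subsetI CollectI)
    fix x assume "x \<in> X"
    then have x: "x \<in> cube q" "ennreal s < hl_max h x" by (auto simp: X_def)
    from x(2) obtain p where p: "0 < snd p" "x \<in> cube p" "ennreal s < avg h p" by (rule less_hl_maxE)
    have small: "snd p \<le> snd q"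
    proof (rule ccontr)
      assume "\<not> snd p \<le> snd q"
      then have "cube q \<subseteq> cube (tripled p)"
        using x(1) p q by (intro cube_subset_tripled) auto
      then have "avg h (tripled p) \<le> hl_max h x0"
        using x0(1) p(1) by (intro avg_le_hl_max) auto
      then have "3 ^ DIM('a) * avg h (tripled p) \<le> ennreal (3 ^ DIM('a)) * ennreal t"
        using x0(2) by (simp add: ennreal_power[symmetric] mult_left_mono)
      then have "avg h p \<le> ennreal (3 ^ DIM('a) * t)"
        using avg_le_avg_tripled[OF p(1), of h] t by (simp add: ennreal_mult order_trans)
      also have "\<dots> \<le> ennreal s" by (intro ennreal_leI s_ge)
      finally show False using p(3) by simp
    qed
    have sub: "cube p \<subseteq> cube (tripled q)"
      using small x(1) p by (intro cube_subset_tripled) auto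
    have "avg g p = avg h p"
      unfolding avg_def g_def using sub
      by (intro arg_cong2[where f = "(/)"] nn_integral_cong) (auto simp: indicator_def)
    then show "ennreal s < hl_max g x"
      using p(3) avg_le_hl_max[OF p(1,2), of g] by simp
  qed
  then have "ennreal s * emeasure lebesgue X \<le> ennreal s * emeasure lebesgue {x. ennreal s < hl_max g x}"
    by (intro mult_left_mono emeasure_mono) auto
  also have "\<dots> \<le> 3 ^ DIM('a) * (\<integral>\<^sup>+x. g x \<partial>lebesgue)" by (rule weak_type) measurable
  also have "(\<integral>\<^sup>+x. g x \<partial>lebesgue) = avg h (tripled q) * (3 ^ DIM('a) * emeasure lebesgue (cube q))"
    using q by (simp add: g_def set_nn_integral_cube emeasure_tripled)
  also have "3 ^ DIM('a) * (avg h (tripled q) * (3 ^ DIM('a) * emeasure lebesgue (cube q))) \<le>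
      3 ^ DIM('a) * (ennreal t * (3 ^ DIM('a) * emeasure lebesgue (cube q)))"
    using q x0t by (intro mult_left_mono mult_right_mono order_trans[OF avg_le_hl_max x0(2)]) auto
  also have "\<dots> = ennreal (3 ^ DIM('a)) * ennreal (3 ^ DIM('a)) * ennreal t * emeasure lebesgue (cube q)"
    by (simp add: ennreal_power[symmetric] mult_ac)
  also have "ennreal (3 ^ DIM('a)) * ennreal (3 ^ DIM('a)) * ennreal t = ennreal (s / 2)"
    using t power_mult_distrib[of 3 "3::real" "DIM('a)"] by (simp add: s_def ennreal_mult[symmetric])
  also have "ennreal s = ennreal (s / 2) * 2"
    using t by (simp add: s_def ennreal_mult[symmetric] ennreal_numeral[symmetric] del: ennreal_numeral)
  finally have "ennreal (s / 2) * (2 * emeasure lebesgue X) \<le> ennreal (s / 2) * emeasure lebesgue (cube q)"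
    by (simp only: mult.assoc)
  moreover have "0 < s / 2" using t by (simp add: s_def)
  ultimately have half: "2 * emeasure lebesgue X \<le> emeasure lebesgue (cube q)"
    by (subst (asm) ennreal_mult_le_mult_iff) auto
  define Y where "Y = cube q - {x. ennreal s < hl_max h x}"
  have Y_sets: "Y \<in> sets lebesgue" by (simp add: Y_def)
  have XY: "emeasure lebesgue (cube q) = emeasure lebesgue X + emeasure lebesgue Y"
    using X_sets Y_sets by (subst plus_emeasure) (auto simp: X_def Y_def intro!: arg_cong[where f = "emeasure lebesgue"])
  have "emeasure lebesgue X < top" using XY emeasure_cube_pos(2)[OF q] by auto
  moreover have "emeasure lebesgue X + emeasure lebesgue X \<le> emeasure lebesgue X + emeasure lebesgue Y"
    using half XY by (simp add: mult_2)
  ultimately have "emeasure lebesgue X \<le> emeasure lebesgue Y"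
    by (auto simp: ennreal_add_left_cancel_le)
  then have "emeasure lebesgue X + emeasure lebesgue Y \<le> emeasure lebesgue Y + emeasure lebesgue Y"
    by (rule add_right_mono)
  then have "emeasure lebesgue (cube q) \<le> 2 * emeasure lebesgue Y"
    using XY by (simp only: mult_2)
  then show ?thesis by (simp add: Y_def s_def)
qed

text \<open>
  Sparse domination of the bilinear form of the maximal operator. The cubes at level \<open>k\<close>
  meet the set where the maximal function lies between \<open>a\<^sup>k\<close> and \<open>a\<^bsup>k+1\<^esup>\<close>, their triples
  cover almost all of it, and the preceding lemma yields the large parts; every point lies
  in the large parts of cubes of at most two levels.
\<close>

lemma sparse_domination:
  fixes h u :: "'a::euclidean_space \<Rightarrow> ennreal"
  assumes [measurable]: "h \<in> borel_measurable lebesgue" "u \<in> borel_measurable lebesgue"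
    and bdd: "\<And>x. h x \<le> ennreal B" and c: "c < (\<integral>\<^sup>+x. hl_max h x * u x \<partial>lebesgue)"
  obtains I :: "(int \<times> 'a \<times> real) set" and E where "sparse_family I snd E"
    and "c \<le> ennreal (2 * 27 ^ DIM('a)) * (\<integral>\<^sup>+x. h x * cube_sum I snd (\<lambda>i. avg u (tripled (snd i))) x \<partial>lebesgue)"
proof -
  \<comment> \<open>With this ratio of consecutive levels, the points two levels up fill at most half of a cube.\<close>
  define a :: real where "a = 2 * 9 ^ DIM('a)"
  have "1 \<le> (9::real) ^ DIM('a)" by (intro one_le_power) auto
  then have a: "1 < a" unfolding a_def by linarith
  define lev where "lev k = a powr real_of_int k" for k :: int
  have lev: "0 < lev k" for k using a by (simp add: lev_def)
  have lev_Suc: "lev (k + 1) = a * lev k" for k using a by (simp add: lev_def powr_add)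
  have lev_less: "lev k < lev j \<longleftrightarrow> k < j" for j k using a by (simp add: lev_def)
  define \<Omega> where "\<Omega> k = {x. ennreal (lev k) < hl_max h x}" for k
  have \<Omega>: "open (\<Omega> k)" "\<Omega> k \<in> sets lebesgue" for k
    unfolding \<Omega>_def by (simp_all add: open_hl_max_greater)
  have "\<exists>C :: nat \<Rightarrow> 'a set. (\<forall>n. compact (C n)) \<and> incseq C \<and> (\<Union>n. C n) = \<Omega> k \<inter> - \<Omega> (k + 1)" for k
    using open_Int_closed_exhaustion[of "\<Omega> k" "- \<Omega> (k + 1)"] \<Omega>(1) by (metis closed_Compl)
  then obtain C :: "int \<Rightarrow> nat \<Rightarrow> 'a set" where
    C: "\<And>k n. compact (C k n)" "\<And>k. incseq (C k)" "\<And>k. (\<Union>n. C k n) = \<Omega> k \<inter> - \<Omega> (k + 1)"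
    by metis
  \<comment> \<open>Compact parts of the layers, as the covering lemma needs compactness; finitely many layers
    keep the family of cubes finite.\<close>
  define V where "V n = (\<Union>k\<in>{- int n..int n}. C k n)" for n
  have V_sets: "V n \<in> sets lebesgue" for n
    unfolding V_def using C(1) by (intro sets.finite_UN) auto
  have "incseq V"
  proof (intro incseq_SucI subsetI)
    fix n x assume "x \<in> V n"
    then obtain k where k: "k \<in> {- int n..int n}" "x \<in> C k n" by (auto simp: V_def)
    have "x \<in> C k (Suc n)" using incseq_SucD[OF C(2)[of k], of n] k(2) by blast
    moreover have "k \<in> {- int (Suc n)..int (Suc n)}" using k(1) by auto
    ultimately show "x \<in> V (Suc n)" unfolding V_def by blast
  qed
  have in_V: "x \<in> (\<Union>n. V n)" if "hl_max h x \<noteq> 0" for x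
  proof -
    have "hl_max h x < top" using hl_max_bounded[of h, OF bdd] by (rule le_less_trans) simp
    then obtain t where t: "0 < t" "hl_max h x = ennreal t"
      using \<open>hl_max h x \<noteq> 0\<close> by (cases "hl_max h x") (auto simp: less_le)
    obtain k where "a powr real_of_int k < t" "t \<le> a powr real_of_int (k + 1)"
      using geometric_level[OF a t(1)] by blast
    then have "x \<in> \<Omega> k \<inter> - \<Omega> (k + 1)"
      using t lev[of k] lev[of "k+1"] by (simp add: \<Omega>_def lev_def ennreal_less_iff)
    then obtain n where n: "x \<in> C k n" using C(3)[of k] by blast
    define m where "m = max n (nat \<bar>k\<bar>)"
    have "x \<in> C k m" using n incseqD[OF C(2)[of k], of n m] by (auto simp: m_def)
    moreover have "k \<in> {- int m..int m}" by (auto simp: m_def)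
    ultimately show ?thesis unfolding V_def by blast
  qed
  have "(\<integral>\<^sup>+x. hl_max h x * u x \<partial>lebesgue) = (\<integral>\<^sup>+x\<in>(\<Union>n. V n). hl_max h x * u x \<partial>lebesgue)"
    using in_V by (intro nn_integral_cong) (auto simp: indicator_def)
  also have "\<dots> = (SUP n. \<integral>\<^sup>+x\<in>V n. hl_max h x * u x \<partial>lebesgue)"
    using V_sets \<open>incseq V\<close> by (intro nn_integral_incseq_sets) auto
  finally obtain n where n: "c < (\<integral>\<^sup>+x\<in>V n. hl_max h x * u x \<partial>lebesgue)"
    using c by (auto simp: less_SUP_iff)
  define N where "N = {- int n..int n}"
  have CD: "x \<in> \<Omega> k" "x \<notin> \<Omega> (k + 1)" if "x \<in> C k n" for x k
    using that C(3)[of k] by blast+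
  have "\<exists>J. finite J \<and> (\<forall>q\<in>J. 0 < snd q \<and> ennreal (lev k) < avg h q \<and> cube q \<inter> C k n \<noteq> {}) \<and>
     disjoint_family_on cube J \<and> C k n \<subseteq> (\<Union>q\<in>J. cube (tripled q))" for k
  proof -
    define S where "S = {q. 0 < snd q \<and> ennreal (lev k) < avg h q \<and> cube q \<inter> C k n \<noteq> {}}"
    have cov: "\<exists>q\<in>S. x \<in> interior (cube q)" if x: "x \<in> C k n" for x
    proof -
      have "ennreal (lev k) < hl_max h x" using CD(1)[OF x] by (simp add: \<Omega>_def)
      then obtain q where q: "0 < snd q" "x \<in> interior (cube q)" "ennreal (lev k) < avg h q"
        by (rule less_hl_max_interiorE)
      then have "q \<in> S" using x interior_subset[of "cube q"] by (auto simp: S_def)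
      then show ?thesis using q(2) by blast
    qed
    have S_pos: "0 < snd q" if "q \<in> S" for q using that by (simp add: S_def)
    obtain J where "finite J" "J \<subseteq> S" "disjoint_family_on cube J" "C k n \<subseteq> (\<Union>q\<in>J. cube (tripled q))"
      using compact_Vitali_cubes[OF C(1) S_pos cov] by metis
    then show ?thesis by (intro exI[of _ J]) (auto simp: S_def)
  qed
  then obtain J where J: "\<And>k. finite (J k)" "\<And>k q. q \<in> J k \<Longrightarrow> 0 < snd q"
      "\<And>k q. q \<in> J k \<Longrightarrow> ennreal (lev k) < avg h q" "\<And>k q. q \<in> J k \<Longrightarrow> cube q \<inter> C k n \<noteq> {}"
      "\<And>k. disjoint_family_on cube (J k)" "\<And>k. C k n \<subseteq> (\<Union>q\<in>J k. cube (tripled q))"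
    by metis
  define I where "I = Sigma N J"
  define E where "E i = cube (snd i) - \<Omega> (fst i + 2)" for i :: "int \<times> 'a \<times> real"
  have fin: "finite I" unfolding I_def N_def using J(1) by (intro finite_SigmaI) auto
  have overlap: "(\<Sum>i\<in>I. indicator (E i) x) \<le> (2::ennreal)" for x
  proof -
    \<comment> \<open>A cube of level \<open>k\<close> lies in \<open>\<Omega> k\<close>, and the cubes of one level are disjoint.\<close>
    define K where "K = {k \<in> N. x \<in> \<Omega> k \<and> x \<notin> \<Omega> (k + 2)}"
    have finK: "finite K" by (rule finite_subset[of _ N]) (auto simp: K_def N_def)
    have "card K \<le> 2"
    proof (cases "K = {}")
      case False
      have "K \<subseteq> {Min K, Min K + 1}"
      proof
        fix k assume k: "k \<in> K"
        have "Min K \<in> K" using False finK by (rule Min_in[rotated])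
        then have "hl_max h x \<le> ennreal (lev (Min K + 2))" by (simp add: K_def \<Omega>_def not_less)
        moreover have "ennreal (lev k) < hl_max h x" using k by (simp add: K_def \<Omega>_def)
        ultimately have "ennreal (lev k) < ennreal (lev (Min K + 2))" by (rule less_le_trans[rotated])
        then have "k < Min K + 2" using lev[of k] by (simp add: ennreal_less_iff lev_less)
        moreover have "Min K \<le> k" using finK k by simp
        ultimately show "k \<in> {Min K, Min K + 1}" by auto
      qed
      then have "card K \<le> card {Min K, Min K + 1}" by (intro card_mono) auto
      then show ?thesis by simp
    qed simp
    have "(\<Sum>i\<in>I. indicator (E i) x) = (\<Sum>k\<in>N. \<Sum>q\<in>J k. indicator (E (k, q)) x :: ennreal)"
      unfolding I_def using J(1) by (subst sum.Sigma) (auto simp: N_def)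
    also have "\<dots> \<le> (\<Sum>k\<in>N. indicator K k)"
    proof (rule sum_mono)
      fix k assume k: "k \<in> N"
      show "(\<Sum>q\<in>J k. indicator (E (k, q)) x) \<le> (indicator K k :: ennreal)"
      proof (cases "k \<in> K")
        case True
        have "(\<Sum>q\<in>J k. indicator (E (k, q)) x) \<le> (\<Sum>q\<in>J k. indicator (cube q) x :: ennreal)"
          by (intro sum_mono) (auto simp: E_def indicator_def)
        also have "\<dots> \<le> 1" by (rule sum_indicator_disjoint_le[OF J(1,5)])
        finally show ?thesis using True by simp
      next
        case False
        have "indicator (E (k, q)) x = (0::ennreal)" if q: "q \<in> J k" for q
        proof (rule ccontr)
          assume "indicator (E (k, q)) x \<noteq> (0::ennreal)"
          then have x: "x \<in> cube q" "x \<notin> \<Omega> (k + 2)" by (auto simp: E_def indicator_def split: if_splits)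
          have "x \<in> \<Omega> k"
            using less_le_trans[OF J(3)[OF q] avg_le_hl_max[OF J(2)[OF q] x(1)]] by (simp add: \<Omega>_def)
          then show False using False x(2) k by (simp add: K_def)
        qed
        then show ?thesis by simp
      qed
    qed
    also have "\<dots> = of_nat (card K)"
    proof -
      have "(\<Sum>k\<in>N. indicator K k) = (\<Sum>k\<in>N \<inter> K. 1 :: ennreal)"
        by (rule sum.inter_restrict[symmetric, THEN trans[OF sum.cong, rotated 2]]) (auto simp: N_def indicator_def)
      moreover have "N \<inter> K = K" by (auto simp: K_def)
      ultimately show ?thesis by simp
    qed
    also have "\<dots> \<le> 2" using \<open>card K \<le> 2\<close> of_nat_mono[of "card K" 2, where ?'a = ennreal] by simp
    finally show ?thesis .
  qed
  have "sparse_family I snd E"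
    unfolding sparse_family_def
  proof (intro conjI ballI allI fin overlap)
    fix i assume "i \<in> I"
    then obtain k q where i: "i = (k, q)" "k \<in> N" "q \<in> J k" by (auto simp: I_def)
    show "0 < snd (snd i)" using J(2)[OF i(3)] i(1) by simp
    show "E i \<in> sets lebesgue" unfolding E_def using \<Omega>(2) by (intro sets.Diff) auto
    show "E i \<subseteq> cube (snd i)" by (auto simp: E_def)
    obtain x0 where x0: "x0 \<in> cube q" "x0 \<in> C k n" using J(4)[OF i(3)] by blast
    have "hl_max h x0 \<le> ennreal (lev (k + 1))" using CD(2)[OF x0(2)] by (simp add: \<Omega>_def)
    then have "emeasure lebesgue (cube q) \<le>
      2 * emeasure lebesgue (cube q - {x. ennreal (2 * 9 ^ DIM('a) * lev (k + 1)) < hl_max h x})"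
      using J(2)[OF i(3)] x0(1) lev by (intro cube_high_level_le_half) auto
    moreover have "2 * 9 ^ DIM('a) * lev (k + 1) = lev (k + 2)"
      using lev_Suc[of "k + 1"] by (simp add: a_def add.commute[of k 2])
    ultimately show "emeasure lebesgue (cube (snd i)) \<le> 2 * emeasure lebesgue (E i)"
      by (simp add: i(1) E_def \<Omega>_def)
  qed
  moreover have "c \<le> ennreal (2 * 27 ^ DIM('a)) *
      (\<integral>\<^sup>+x. h x * cube_sum I snd (\<lambda>i. avg u (tripled (snd i))) x \<partial>lebesgue)"
  proof -
    have [measurable]: "C k n \<in> sets lebesgue" for k using C(1) by simp
    have "c \<le> (\<integral>\<^sup>+x. (\<Sum>k\<in>N. ennreal (lev (k + 1)) * (u x * indicator (C k n) x)) \<partial>lebesgue)"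
    proof (rule order_trans[OF less_imp_le[OF n] nn_integral_mono])
      fix x
      show "hl_max h x * u x * indicator (V n) x \<le> (\<Sum>k\<in>N. ennreal (lev (k + 1)) * (u x * indicator (C k n) x))"
      proof (cases "x \<in> V n")
        case True
        then obtain k where k: "k \<in> N" "x \<in> C k n" by (auto simp: V_def N_def)
        have "hl_max h x \<le> ennreal (lev (k + 1))" using CD(2)[OF k(2)] by (simp add: \<Omega>_def)
        then have "hl_max h x * u x * indicator (V n) x \<le> ennreal (lev (k + 1)) * (u x * indicator (C k n) x)"
          using True k(2) by (simp add: mult_right_mono)
        also have "\<dots> \<le> (\<Sum>k\<in>N. ennreal (lev (k + 1)) * (u x * indicator (C k n) x))"
          using k(1) by (intro member_le_sum) (auto simp: N_def)
        finally show ?thesis .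
      qed simp
    qed
    also have "\<dots> = (\<Sum>k\<in>N. \<integral>\<^sup>+x. ennreal (lev (k + 1)) * (u x * indicator (C k n) x) \<partial>lebesgue)"
      by (intro nn_integral_sum) measurable
    also have "\<dots> = (\<Sum>k\<in>N. ennreal (lev (k + 1)) * (\<integral>\<^sup>+x\<in>C k n. u x \<partial>lebesgue))"
      by (intro sum.cong refl nn_integral_cmult) measurable
    also have "\<dots> \<le> (\<Sum>k\<in>N. \<Sum>q\<in>J k. ennreal a * (avg h q * (\<integral>\<^sup>+x\<in>cube (tripled q). u x \<partial>lebesgue)))"
    proof (rule sum_mono)
      fix k
      have "ennreal (lev (k + 1)) * (\<integral>\<^sup>+x\<in>C k n. u x \<partial>lebesgue) \<le>
        ennreal (lev (k + 1)) * (\<Sum>q\<in>J k. \<integral>\<^sup>+x\<in>cube (tripled q). u x \<partial>lebesgue)"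
        using J by (intro mult_left_mono nn_integral_cover_le) auto
      also have "\<dots> = (\<Sum>q\<in>J k. ennreal a * (ennreal (lev k) * (\<integral>\<^sup>+x\<in>cube (tripled q). u x \<partial>lebesgue)))"
        using a lev[of k] by (simp add: sum_distrib_left lev_Suc ennreal_mult mult.assoc)
      also have "\<dots> \<le> (\<Sum>q\<in>J k. ennreal a * (avg h q * (\<integral>\<^sup>+x\<in>cube (tripled q). u x \<partial>lebesgue)))"
        by (intro sum_mono mult_left_mono mult_right_mono less_imp_le[OF J(3)]) simp_all
      finally show "ennreal (lev (k + 1)) * (\<integral>\<^sup>+x\<in>C k n. u x \<partial>lebesgue) \<le>
        (\<Sum>q\<in>J k. ennreal a * (avg h q * (\<integral>\<^sup>+x\<in>cube (tripled q). u x \<partial>lebesgue)))" .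
    qed
    also have "\<dots> = (\<Sum>i\<in>I. ennreal a * (avg h (snd i) * (\<integral>\<^sup>+x\<in>cube (tripled (snd i)). u x \<partial>lebesgue)))"
      unfolding I_def using J(1) by (subst sum.Sigma) (auto simp: N_def split_beta)
    also have "\<dots> = (\<Sum>i\<in>I. ennreal (2 * 27 ^ DIM('a)) * (\<integral>\<^sup>+x. h x * (avg u (tripled (snd i)) * indicator (cube (snd i)) x) \<partial>lebesgue))"
    proof (rule sum.cong[OF refl])
      fix i assume "i \<in> I"
      then have q: "0 < snd (snd i)" using J(2) by (auto simp: I_def)
      have "ennreal a * (avg h (snd i) * (\<integral>\<^sup>+x\<in>cube (tripled (snd i)). u x \<partial>lebesgue)) =
        ennreal a * ennreal (3 ^ DIM('a)) * (avg u (tripled (snd i)) * (avg h (snd i) * emeasure lebesgue (cube (snd i))))"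
        using q by (simp add: set_nn_integral_cube emeasure_tripled ennreal_power[symmetric] mult_ac)
      also have "ennreal a * ennreal (3 ^ DIM('a)) = ennreal (2 * 27 ^ DIM('a))"
        using a power_mult_distrib[of 9 "3::real" "DIM('a)"] by (simp add: ennreal_mult[symmetric] a_def)
      also have "avg h (snd i) * emeasure lebesgue (cube (snd i)) = (\<integral>\<^sup>+x\<in>cube (snd i). h x \<partial>lebesgue)"
        using q by (simp add: set_nn_integral_cube)
      also have "avg u (tripled (snd i)) * (\<integral>\<^sup>+x\<in>cube (snd i). h x \<partial>lebesgue) =
          (\<integral>\<^sup>+x. avg u (tripled (snd i)) * (h x * indicator (cube (snd i)) x) \<partial>lebesgue)"
        by (rule nn_integral_cmult[symmetric]) measurable
      finally show "ennreal a * (avg h (snd i) * (\<integral>\<^sup>+x\<in>cube (tripled (snd i)). u x \<partial>lebesgue)) =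
        ennreal (2 * 27 ^ DIM('a)) * (\<integral>\<^sup>+x. h x * (avg u (tripled (snd i)) * indicator (cube (snd i)) x) \<partial>lebesgue)"
        by (simp only: mult.left_commute)
    qed
    also have "\<dots> = ennreal (2 * 27 ^ DIM('a)) * (\<Sum>i\<in>I. \<integral>\<^sup>+x. h x * (avg u (tripled (snd i)) * indicator (cube (snd i)) x) \<partial>lebesgue)"
      by (rule sum_distrib_left[symmetric])
    also have "(\<Sum>i\<in>I. \<integral>\<^sup>+x. h x * (avg u (tripled (snd i)) * indicator (cube (snd i)) x) \<partial>lebesgue) =
        (\<integral>\<^sup>+x. (\<Sum>i\<in>I. h x * (avg u (tripled (snd i)) * indicator (cube (snd i)) x)) \<partial>lebesgue)"
      by (rule nn_integral_sum[symmetric]) measurable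
    finally show ?thesis by (simp only: cube_sum_def sum_distrib_left)
  qed
  ultimately show ?thesis by (rule that)
qed

section \<open>Balls of function norms, polars and powers\<close>

text \<open>
  Solidity and the Fatou property of a unit ball. The limits in the latter may be infinite on sets of
  positive measure, so that no finiteness has to be checked in limit arguments.
\<close>

definition normal_ball :: "('a::euclidean_space \<Rightarrow> ennreal) set \<Rightarrow> bool" where
  "normal_ball B \<longleftrightarrow> B \<subseteq> borel_measurable lebesgue \<and> (\<lambda>x. 0) \<in> B \<and>
     (\<forall>F\<in>B. \<forall>G\<in>borel_measurable lebesgue. (AE x in lebesgue. G x \<le> F x) \<longrightarrow> G \<in> B) \<and>
     (\<forall>F :: nat \<Rightarrow> 'a \<Rightarrow> ennreal. (\<forall>n. F n \<in> B) \<longrightarrow> incseq F \<longrightarrow> (\<lambda>x. SUP n. F n x) \<in> B)"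

definition convex_ball :: "('a::euclidean_space \<Rightarrow> ennreal) set \<Rightarrow> bool" where
  "convex_ball B \<longleftrightarrow> (\<forall>F\<in>B. \<forall>G\<in>B. \<forall>s\<ge>0. \<forall>t\<ge>0. s + t = 1 \<longrightarrow>
     (\<lambda>x. ennreal s * F x + ennreal t * G x) \<in> B)"

definition polar :: "('a::euclidean_space \<Rightarrow> ennreal) set \<Rightarrow> ('a \<Rightarrow> ennreal) set" where
  "polar B = {G \<in> borel_measurable lebesgue. \<forall>F\<in>B. (\<integral>\<^sup>+x. F x * G x \<partial>lebesgue) \<le> 1}"

definition ball_power :: "('a::euclidean_space \<Rightarrow> ennreal) set \<Rightarrow> real \<Rightarrow> ('a \<Rightarrow> ennreal) set" where
  "ball_power B p = {F \<in> borel_measurable lebesgue. (\<lambda>x. F x epowr (1/p)) \<in> B}"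

text \<open>
  If \<open>B\<close> is the unit ball of a norm, \<open>C\<close> is a bound for the operator norm.
\<close>

definition ball_maximal :: "('a::euclidean_space \<Rightarrow> ennreal) set \<Rightarrow> bool" where
  "ball_maximal B \<longleftrightarrow> (\<exists>C>0. \<forall>F\<in>B. (\<lambda>x. hl_max F x / ennreal C) \<in> B)"

lemma normal_ballD:
  assumes "normal_ball B"
  shows "F \<in> B \<Longrightarrow> F \<in> borel_measurable lebesgue" and "(\<lambda>x. 0) \<in> B"
    and "F \<in> B \<Longrightarrow> G \<in> borel_measurable lebesgue \<Longrightarrow> AE x in lebesgue. G x \<le> F x \<Longrightarrow> G \<in> B"
    and "(\<And>n::nat. H n \<in> B) \<Longrightarrow> incseq H \<Longrightarrow> (\<lambda>x. SUP n. H n x) \<in> B"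
  using assms by (auto simp: normal_ball_def)

lemma normal_ball_mono:
  assumes "normal_ball B" "F \<in> B" "G \<in> borel_measurable lebesgue" "\<And>x. G x \<le> F x"
  shows "G \<in> B"
  using normal_ballD(3)[OF assms(1,2,3)] assms(4) by simp

lemma polar_measurable: "G \<in> polar B \<Longrightarrow> G \<in> borel_measurable lebesgue"
  by (simp add: polar_def)

lemma polarD: "G \<in> polar B \<Longrightarrow> F \<in> B \<Longrightarrow> (\<integral>\<^sup>+x. F x * G x \<partial>lebesgue) \<le> 1"
  by (simp add: polar_def)

lemma polarI:
  "G \<in> borel_measurable lebesgue \<Longrightarrow> (\<And>F. F \<in> B \<Longrightarrow> (\<integral>\<^sup>+x. F x * G x \<partial>lebesgue) \<le> 1) \<Longrightarrow> G \<in> polar B"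
  by (simp add: polar_def)

lemma normal_ball_polar:
  assumes meas: "B \<subseteq> borel_measurable lebesgue"
  shows "normal_ball (polar B)"
  unfolding normal_ball_def
proof (intro conjI ballI allI impI)
  show "polar B \<subseteq> borel_measurable lebesgue" by (auto simp: polar_def)
  show "(\<lambda>x. 0) \<in> polar B" by (simp add: polar_def)
next
  fix F G :: "'a \<Rightarrow> ennreal" assume F: "F \<in> polar B" and G: "G \<in> borel_measurable lebesgue" and le: "AE x in lebesgue. G x \<le> F x"
  show "G \<in> polar B"
  proof (rule polarI[OF G])
    fix H assume H: "H \<in> B"
    have "(\<integral>\<^sup>+x. H x * G x \<partial>lebesgue) \<le> (\<integral>\<^sup>+x. H x * F x \<partial>lebesgue)"
      using le by (intro nn_integral_mono_AE, eventually_elim) (simp add: mult_left_mono)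
    also have "\<dots> \<le> 1" by (rule polarD[OF F H])
    finally show "(\<integral>\<^sup>+x. H x * G x \<partial>lebesgue) \<le> 1" .
  qed
next
  fix F :: "nat \<Rightarrow> 'a \<Rightarrow> ennreal" assume F: "\<forall>n. F n \<in> polar B" and inc: "incseq F"
  have [measurable]: "F n \<in> borel_measurable lebesgue" for n using F polar_measurable by blast
  show "(\<lambda>x. SUP n. F n x) \<in> polar B"
  proof (rule polarI)
    fix H assume H: "H \<in> B"
    have [measurable]: "H \<in> borel_measurable lebesgue" using H meas by blast
    have "(\<integral>\<^sup>+x. H x * (SUP n. F n x) \<partial>lebesgue) = (\<integral>\<^sup>+x. (SUP n. H x * F n x) \<partial>lebesgue)"
      by (simp add: SUP_mult_left_ennreal)
    also have "\<dots> = (SUP n. \<integral>\<^sup>+x. H x * F n x \<partial>lebesgue)"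
      using inc by (intro nn_integral_monotone_convergence_SUP) (auto simp: incseq_def le_fun_def mult_left_mono)
    also have "\<dots> \<le> 1" using F H by (intro SUP_least polarD) auto
    finally show "(\<integral>\<^sup>+x. H x * (SUP n. F n x) \<partial>lebesgue) \<le> 1" .
  qed measurable
qed

lemma convex_ball_polar:
  assumes meas: "B \<subseteq> borel_measurable lebesgue"
  shows "convex_ball (polar B)"
  unfolding convex_ball_def
proof (intro ballI allI impI)
  fix F G :: "'a \<Rightarrow> ennreal" and s t :: real
  assume F: "F \<in> polar B" and G: "G \<in> polar B" and st: "0 \<le> s" "0 \<le> t" "s + t = 1"
  have [measurable]: "F \<in> borel_measurable lebesgue" "G \<in> borel_measurable lebesgue"
    using F G by (auto intro: polar_measurable)
  show "(\<lambda>x. ennreal s * F x + ennreal t * G x) \<in> polar B"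
  proof (rule polarI)
    fix H assume H: "H \<in> B"
    have [measurable]: "H \<in> borel_measurable lebesgue" using H meas by blast
    have "(\<integral>\<^sup>+x. H x * (ennreal s * F x + ennreal t * G x) \<partial>lebesgue) =
      (\<integral>\<^sup>+x. ennreal s * (H x * F x) + ennreal t * (H x * G x) \<partial>lebesgue)"
      by (simp add: distrib_left mult.left_commute)
    also have "\<dots> = ennreal s * (\<integral>\<^sup>+x. H x * F x \<partial>lebesgue) + ennreal t * (\<integral>\<^sup>+x. H x * G x \<partial>lebesgue)"
      by (simp add: nn_integral_add nn_integral_cmult)
    also have "\<dots> \<le> ennreal s * 1 + ennreal t * 1"
      using F G H by (intro add_mono mult_left_mono polarD) auto
    also have "\<dots> = 1" using st by (simp add: ennreal_plus[symmetric] del: ennreal_plus)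
    finally show "(\<integral>\<^sup>+x. H x * (ennreal s * F x + ennreal t * G x) \<partial>lebesgue) \<le> 1" .
  qed measurable
qed

lemma normal_ball_power:
  assumes B: "normal_ball B" and p: "0 < p"
  shows "normal_ball (ball_power B p)"
  unfolding normal_ball_def
proof (intro conjI ballI allI impI)
  show "ball_power B p \<subseteq> borel_measurable lebesgue" by (auto simp: ball_power_def)
  show "(\<lambda>x. 0) \<in> ball_power B p" using normal_ballD(2)[OF B] by (simp add: ball_power_def)
next
  fix F G :: "'a \<Rightarrow> ennreal"
  assume F: "F \<in> ball_power B p" and [measurable]: "G \<in> borel_measurable lebesgue" and le: "AE x in lebesgue. G x \<le> F x"
  have "AE x in lebesgue. G x epowr (1/p) \<le> F x epowr (1/p)"
    using le by eventually_elim (use p in \<open>simp add: epowr_mono\<close>)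
  moreover have "(\<lambda>x. F x epowr (1/p)) \<in> B" using F by (simp add: ball_power_def)
  moreover have "(\<lambda>x. G x epowr (1/p)) \<in> borel_measurable lebesgue" by measurable
  ultimately have "(\<lambda>x. G x epowr (1/p)) \<in> B"
    using normal_ballD(3)[OF B] by blast
  then show "G \<in> ball_power B p" by (simp add: ball_power_def)
next
  fix F :: "nat \<Rightarrow> 'a \<Rightarrow> ennreal" assume F: "\<forall>n. F n \<in> ball_power B p" and inc: "incseq F"
  have [measurable]: "F n \<in> borel_measurable lebesgue" for n using F by (auto simp: ball_power_def)
  have "incseq (\<lambda>n x. F n x epowr (1/p))"
    using inc p by (auto simp: incseq_def le_fun_def intro!: epowr_mono)
  then have "(\<lambda>x. SUP n. F n x epowr (1/p)) \<in> B"
    by (rule normal_ballD(4)[OF B, rotated]) (use F in \<open>simp add: ball_power_def\<close>)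
  then show "(\<lambda>x. SUP n. F n x) \<in> ball_power B p"
    using p by (simp add: ball_power_def SUP_epowr)
qed

lemma ball_power_one: "normal_ball B \<Longrightarrow> ball_power B 1 = B"
  using normal_ballD(1) by (auto simp: ball_power_def)

text \<open>
  The tangent of the power function at the convex combination lies below its graph; this is Young's
  inequality.
\<close>

lemma epowr_convex:
  assumes a: "1 \<le> a" and st: "0 \<le> s" "0 \<le> t" "s + t = 1"
  shows "(ennreal s * x + ennreal t * y) epowr a \<le> ennreal s * x epowr a + ennreal t * y epowr a"
proof (cases "a = 1 \<or> s = 0 \<or> t = 0")
  case True
  with st show ?thesis by auto
next
  case False
  then have *: "1 < a" "0 < s" "0 < t" using a st by auto
  show ?thesis
  proof (cases x; cases y)
    fix u v :: real assume uv: "0 \<le> u" "x = ennreal u" "0 \<le> v" "y = ennreal v"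
    define m where "m = s * u + t * v"
    have m: "0 \<le> m" using uv st by (simp add: m_def)
    have tangent: "a * (z * m powr (a - 1)) - (a - 1) * m powr a \<le> z powr a" if "0 \<le> z" for z
    proof -
      have "1/a + 1/(a/(a-1)) = 1" "1 < a/(a-1)" using *(1) by (simp_all add: field_simps)
      then have "z * m powr (a - 1) \<le> z powr a / a + (m powr (a - 1)) powr (a/(a-1)) / (a/(a-1))"
        using *(1) that by (intro Youngs_inequality) auto
      also have "(m powr (a - 1)) powr (a/(a-1)) = m powr a"
        using *(1) by (simp add: powr_powr)
      finally have "a * (z * m powr (a - 1)) \<le> a * (z powr a / a + m powr a / (a/(a-1)))"
        using *(1) by (intro mult_left_mono) auto
      also have "\<dots> = z powr a + (a - 1) * m powr a" using *(1) by (simp add: field_simps)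
      finally show ?thesis by simp
    qed
    have mm: "m * m powr (a - 1) = m powr a"
    proof (cases "m = 0")
      case False
      then show ?thesis using m powr_add[of m 1 "a-1"] by simp
    qed simp
    have "s * (a * (u * P) - (a - 1) * R) + t * (a * (v * P) - (a - 1) * R) =
        a * ((s * u + t * v) * P) - (s + t) * ((a - 1) * R)" for P R
      by (simp add: algebra_simps)
    from this[of "m powr (a - 1)" "m powr a"]
    have "m powr a = s * (a * (u * m powr (a - 1)) - (a - 1) * m powr a) + t * (a * (v * m powr (a - 1)) - (a - 1) * m powr a)"
      unfolding m_def[symmetric] mm st(3) by (simp add: left_diff_distrib)
    also have "\<dots> \<le> s * u powr a + t * v powr a"
      using uv st by (intro add_mono mult_left_mono tangent) auto
    finally have "m powr a \<le> s * u powr a + t * v powr a" .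
    then show ?thesis using uv st m
      by (simp add: epowr_ennreal ennreal_mult[symmetric] ennreal_plus[symmetric] m_def del: ennreal_plus)
  qed (use * in \<open>auto simp: ennreal_mult_top\<close>)
qed

text \<open>
  Convexity passes to smaller powers because a power with exponent at least one is a convex function.
\<close>

lemma convex_ball_power_mono:
  assumes B: "normal_ball B" and conv: "convex_ball (ball_power B p)" and q: "0 < q" "q \<le> p"
  shows "convex_ball (ball_power B q)"
  unfolding convex_ball_def
proof (intro ballI allI impI)
  fix F G :: "'a \<Rightarrow> ennreal" and s t :: real
  assume F: "F \<in> ball_power B q" and G: "G \<in> ball_power B q" and st: "0 \<le> s" "0 \<le> t" "s + t = 1"
  have [measurable]: "F \<in> borel_measurable lebesgue" "G \<in> borel_measurable lebesgue"
    using F G by (auto simp: ball_power_def)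
  have "(\<lambda>x. F x epowr (p/q)) \<in> ball_power B p" "(\<lambda>x. G x epowr (p/q)) \<in> ball_power B p"
    using F G q by (auto simp: ball_power_def)
  then have "(\<lambda>x. ennreal s * F x epowr (p/q) + ennreal t * G x epowr (p/q)) \<in> ball_power B p"
    by (rule conv[unfolded convex_ball_def, rule_format, OF _ _ st])
  then have in_B: "(\<lambda>x. (ennreal s * F x epowr (p/q) + ennreal t * G x epowr (p/q)) epowr (1/p)) \<in> B"
    by (simp add: ball_power_def)
  have "(\<lambda>x. (ennreal s * F x + ennreal t * G x) epowr (1/q)) \<in> B"
  proof (rule normal_ball_mono[OF B in_B])
    fix x
    have "(ennreal s * F x + ennreal t * G x) epowr (1/q) = ((ennreal s * F x + ennreal t * G x) epowr (p/q)) epowr (1/p)"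
      using q by simp
    also have "\<dots> \<le> (ennreal s * F x epowr (p/q) + ennreal t * G x epowr (p/q)) epowr (1/p)"
      using q st by (intro epowr_mono epowr_convex) auto
    finally show "(ennreal s * F x + ennreal t * G x) epowr (1/q) \<le>
      (ennreal s * F x epowr (p/q) + ennreal t * G x epowr (p/q)) epowr (1/p)" .
  qed measurable
  then show "(\<lambda>x. ennreal s * F x + ennreal t * G x) \<in> ball_power B q"
    by (simp add: ball_power_def)
qed

text \<open>
  Truncation in height and in space; it makes integrals finite, so that they can be absorbed.
\<close>

definition trunc :: "nat \<Rightarrow> ('a::euclidean_space \<Rightarrow> ennreal) \<Rightarrow> 'a \<Rightarrow> ennreal" where
  "trunc n F x = min (F x) (ennreal (real n)) * indicator (cbox (- (real n *\<^sub>R One)) (real n *\<^sub>R One)) x"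

lemma measurable_trunc [measurable]:
  assumes [measurable]: "F \<in> borel_measurable lebesgue"
  shows "trunc n F \<in> borel_measurable lebesgue"
proof -
  have [measurable]: "cbox (- (real n *\<^sub>R One)) (real n *\<^sub>R One :: 'a) \<in> sets lebesgue" by simp
  show ?thesis unfolding trunc_def by measurable
qed

lemma trunc_le: "trunc n F x \<le> F x" "trunc n F x \<le> ennreal (real n)"
  by (auto simp: trunc_def indicator_def)

lemma cbox_One_mono:
  "m \<le> n \<Longrightarrow> cbox (- (real m *\<^sub>R One)) (real m *\<^sub>R One) \<subseteq> cbox (- (real n *\<^sub>R One)) (real n *\<^sub>R One :: 'a::euclidean_space)"
  by (auto simp: subset_box inner_sum_left_Basis)

lemma in_cbox_One:
  fixes x :: "'a::euclidean_space"
  obtains n where "x \<in> cbox (- (real n *\<^sub>R One)) (real n *\<^sub>R One)"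
proof -
  obtain n where n: "norm x \<le> real n" using real_arch_simple by blast
  have "x \<in> cbox (- (real n *\<^sub>R One)) (real n *\<^sub>R One)"
    unfolding mem_box
  proof
    fix i :: 'a assume i: "i \<in> Basis"
    have "\<bar>x \<bullet> i\<bar> \<le> real n" using Basis_le_norm[OF i, of x] n by linarith
    then show "- (real n *\<^sub>R One) \<bullet> i \<le> x \<bullet> i \<and> x \<bullet> i \<le> (real n *\<^sub>R One) \<bullet> i"
      using i by (auto simp: inner_sum_left_Basis abs_le_iff)
  qed
  then show ?thesis by (rule that)
qed

lemma incseq_trunc: "incseq (\<lambda>n. trunc n F)"
proof (intro incseq_SucI le_funI)
  fix n x
  show "trunc n F x \<le> trunc (Suc n) F x"
    using cbox_One_mono[of n "Suc n"] unfolding trunc_def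
    by (intro mult_mono min.mono ennreal_leI) (auto simp: indicator_def)
qed

lemma SUP_trunc: "(SUP n. trunc n F x) = F x"
proof (rule antisym)
  show "(SUP n. trunc n F x) \<le> F x" by (intro SUP_least trunc_le)
  show "F x \<le> (SUP n. trunc n F x)"
  proof (rule dense_le)
    fix y assume y: "y < F x"
    have "y < top" using less_le_trans[OF y top_greatest] .
    then obtain r where r: "0 \<le> r" "y = ennreal r" by (auto simp: less_top_ennreal)
    obtain k where k: "r \<le> real k" using real_arch_simple by blast
    obtain m where m: "x \<in> cbox (- (real m *\<^sub>R One)) (real m *\<^sub>R One)" by (rule in_cbox_One)
    have "x \<in> cbox (- (real (max k m) *\<^sub>R One)) (real (max k m) *\<^sub>R One)"
      using m cbox_One_mono[of m "max k m"] by auto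
    moreover have "y \<le> ennreal (real (max k m))" using k r by (auto intro!: ennreal_leI)
    ultimately have "y \<le> trunc (max k m) F x" using y by (simp add: trunc_def)
    then show "y \<le> (SUP n. trunc n F x)" by (rule SUP_upper2[OF UNIV_I])
  qed
qed

section \<open>The bipolar theorem\<close>

text \<open>
  The heart of the bipolar theorem, where Hahn--Banach is replaced by projection in
  \<open>L\<^sup>2\<close>. Among the elements of the ball below \<open>f\<close> there is one, \<open>u\<close>, closest to \<open>f\<close> in
  mean square: a minimizing sequence is Cauchy by the parallelogram law and its pointwise
  limit stays in the ball by the Fatou property. First-order optimality says that
  the functional given by \<open>f - u\<close> attains its supremum over the ball at \<open>u\<close>, so it is a multiple of an element
  of the polar, and testing \<open>f\<close> against it gives \<open>\<integral>(f - u)\<^sup>2 \<le> 0\<close>.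
\<close>

lemma bipolar_bounded:
  fixes f :: "'a::euclidean_space \<Rightarrow> real"
  assumes B: "normal_ball B" and conv: "convex_ball B"
    and f_meas[measurable]: "f \<in> borel_measurable lebesgue" and f: "\<And>x. 0 \<le> f x" "\<And>x. f x \<le> M"
    and supp: "\<And>x. x \<notin> cbox a b \<Longrightarrow> f x = 0"
    and bipolar: "(\<lambda>x. ennreal (f x)) \<in> polar (polar B)"
  shows "(\<lambda>x. ennreal (f x)) \<in> B"
proof -
  have cb[measurable]: "cbox a b \<in> sets lebesgue" by simp
  have cb_fin: "emeasure lebesgue (cbox a b) < \<infinity>"
    using emeasure_lborel_cbox_finite[of a b] by (simp add: emeasure_completion)
  have intgr: "integrable lebesgue w"
    if "w \<in> borel_measurable lebesgue" "\<And>x. \<bar>w x\<bar> \<le> K" "\<And>x. x \<notin> cbox a b \<Longrightarrow> w x = 0" for w :: "'a \<Rightarrow> real" and K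
    using that by (intro integrableI_bounded_set[OF cb _ cb_fin, of w K]) auto
  define S where "S = {v \<in> borel_measurable lebesgue. (\<forall>x. 0 \<le> v x \<and> v x \<le> f x) \<and> (\<lambda>x. ennreal (v x)) \<in> B}"
  have SD: "v \<in> borel_measurable lebesgue" "\<And>x. 0 \<le> v x" "\<And>x. v x \<le> f x" "(\<lambda>x. ennreal (v x)) \<in> B" if "v \<in> S" for v
    using that by (auto simp: S_def)
  define D where "D v = (\<integral>x. (f x - v x)\<^sup>2 \<partial>lebesgue)" for v
  have zero_S: "(\<lambda>x. 0) \<in> S" using f(1) normal_ballD(2)[OF B] by (simp add: S_def)
  have D_int: "integrable lebesgue (\<lambda>x. (f x - v x)\<^sup>2)" if "v \<in> S" for v
  proof (rule intgr)
    note [measurable] = SD(1)[OF that]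
    show "(\<lambda>x. (f x - v x)\<^sup>2) \<in> borel_measurable lebesgue" by measurable
    show "\<bar>(f x - v x)\<^sup>2\<bar> \<le> M\<^sup>2" for x
      using SD(2,3)[OF that, of x] f(2)[of x] by (simp add: power_mono)
    show "(f x - v x)\<^sup>2 = 0" if "x \<notin> cbox a b" for x
      using SD(2,3)[OF \<open>v \<in> S\<close>, of x] supp[OF that] by simp
  qed
  have D_nonneg: "0 \<le> D v" for v by (simp add: D_def)
  define d where "d = (INF v\<in>S. D v)"
  have bdd: "bdd_below (D ` S)" using D_nonneg by (intro bdd_belowI2[of _ 0]) auto
  have d_le: "d \<le> D v" if "v \<in> S" for v unfolding d_def using bdd that by (rule cINF_lower)
  have "\<exists>v\<in>S. D v < d + (1/4)^n" for n :: nat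
  proof (rule ccontr)
    assume "\<not> (\<exists>v\<in>S. D v < d + (1/4)^n)"
    then have "d + (1/4)^n \<le> (INF v\<in>S. D v)" using zero_S by (intro cINF_greatest) (auto simp: not_less)
    moreover have "0 < (1/4::real)^n" by (rule zero_less_power) simp
    ultimately show False unfolding d_def[symmetric] by linarith
  qed
  then obtain v where v: "\<And>n. v n \<in> S" "\<And>n. D (v n) < d + (1/4)^n" by metis
  note vS = SD[OF v(1)]
  note [measurable] = vS(1)
  have v_supp: "v n x = 0" if "x \<notin> cbox a b" for n x using vS(2,3)[of n x] supp[OF that] by simp
  \<comment> \<open>By the parallelogram law the steps decrease geometrically in \<open>L\<^sup>2\<close>. On the box this carries over to
    \<open>L\<^sup>1\<close> by \<open>2 z \<le> 2\<^sup>n z\<^sup>2 + 2\<^sup>-\<^sup>n\<close>, and so the sequence converges almost everywhere.\<close>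
  have step: "(\<integral>x. \<bar>v (Suc n) x - v n x\<bar> \<partial>lebesgue) \<le> (1/2)^n * (2 + measure lebesgue (cbox a b) / 2)" for n
  proof -
    define m where "m x = (v (Suc n) x + v n x) / 2" for x
    have m_eq: "ennreal (m x) = ennreal (1/2) * ennreal (v (Suc n) x) + ennreal (1/2) * ennreal (v n x)" for x
      using vS(2) by (simp add: m_def ennreal_mult[symmetric] ennreal_plus[symmetric] add_divide_distrib del: ennreal_plus ennreal_half)
    have "(\<lambda>x. ennreal (m x)) \<in> B"
      unfolding m_eq by (rule conv[unfolded convex_ball_def, rule_format, OF vS(4) vS(4)]) auto
    moreover have "m \<in> borel_measurable lebesgue" unfolding m_def by measurable
    moreover have "0 \<le> m x \<and> m x \<le> f x" for x
      using vS(2,3)[of n x] vS(2,3)[of "Suc n" x] by (simp add: m_def)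
    ultimately have mS: "m \<in> S" by (simp add: S_def)
    have pw: "(v (Suc n) x - v n x)\<^sup>2 = 2 * (f x - v (Suc n) x)\<^sup>2 + 2 * (f x - v n x)\<^sup>2 - 4 * (f x - m x)\<^sup>2" for x
      by (simp add: m_def power2_eq_square field_simps)
    note ints = D_int[OF v(1)[of n]] D_int[OF v(1)[of "Suc n"]] D_int[OF mS]
    have sq_int: "integrable lebesgue (\<lambda>x. (v (Suc n) x - v n x)\<^sup>2)"
      unfolding pw by (intro Bochner_Integration.integrable_diff Bochner_Integration.integrable_add integrable_mult_right ints)
    have "(\<integral>x. (v (Suc n) x - v n x)\<^sup>2 \<partial>lebesgue) = 2 * D (v (Suc n)) + 2 * D (v n) - 4 * D m"
      unfolding pw D_def using ints
      by (subst Bochner_Integration.integral_diff, (intro Bochner_Integration.integrable_add integrable_mult_right ints)+,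
          subst Bochner_Integration.integral_add, (intro integrable_mult_right ints)+) simp
    also have "\<dots> \<le> 4 * (1/4)^n"
    proof -
      have "(1/4)^Suc n \<le> ((1/4)^n :: real)" by simp
      then show ?thesis using v(2)[of n] v(2)[of "Suc n"] d_le[OF mS] by linarith
    qed
    finally have sq: "(\<integral>x. (v (Suc n) x - v n x)\<^sup>2 \<partial>lebesgue) \<le> 4 * (1/4)^n" .
    have ind_int: "integrable lebesgue (\<lambda>x. (1/2)^n / 2 * indicat_real (cbox a b) x)"
      using cb cb_fin by (intro integrable_mult_right integrable_real_indicator) auto
    have sq_int': "integrable lebesgue (\<lambda>x. 2^n / 2 * (v (Suc n) x - v n x)\<^sup>2)"
      by (intro integrable_mult_right sq_int)
    have "(\<integral>x. \<bar>v (Suc n) x - v n x\<bar> \<partial>lebesgue) \<le>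
        (\<integral>x. 2^n / 2 * (v (Suc n) x - v n x)\<^sup>2 + (1/2)^n / 2 * indicat_real (cbox a b) x \<partial>lebesgue)"
    proof (rule Bochner_Integration.integral_mono')
      show "integrable lebesgue (\<lambda>x. 2^n / 2 * (v (Suc n) x - v n x)\<^sup>2 + (1/2)^n / 2 * indicat_real (cbox a b) x)"
        by (intro Bochner_Integration.integrable_add sq_int' ind_int)
      fix x
      show "\<bar>v (Suc n) x - v n x\<bar> \<le> 2^n / 2 * (v (Suc n) x - v n x)\<^sup>2 + (1/2)^n / 2 * indicat_real (cbox a b) x"
      proof (cases "x \<in> cbox a b")
        case True
        define z where "z = \<bar>v (Suc n) x - v n x\<bar>"
        have "0 \<le> (2^n * z - 1)\<^sup>2 / 2^n" by simp
        also have "\<dots> = 2^n * z\<^sup>2 - 2 * z + 1 / 2^n" by (simp add: power2_eq_square field_simps)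
        finally have "z \<le> 2^n / 2 * z\<^sup>2 + 1 / 2^n / 2" by simp
        then show ?thesis using True by (simp add: z_def power_one_over)
      qed (simp add: v_supp)
      show "0 \<le> 2^n / 2 * (v (Suc n) x - v n x)\<^sup>2 + (1/2)^n / 2 * indicat_real (cbox a b) x" by simp
    qed
    also have "\<dots> = 2^n / 2 * (\<integral>x. (v (Suc n) x - v n x)\<^sup>2 \<partial>lebesgue) + (1/2)^n / 2 * measure lebesgue (cbox a b)"
      by (subst Bochner_Integration.integral_add[OF sq_int' ind_int]) simp
    also have "\<dots> \<le> 2^n / 2 * (4 * (1/4)^n) + (1/2)^n / 2 * measure lebesgue (cbox a b)"
      by (intro add_right_mono mult_left_mono sq) auto
    also have "2^n / 2 * (4 * (1/4)^n) = 2 * ((1/2)^n :: real)"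
      using power_mult_distrib[of 2 "1/4::real" n] by simp
    finally show ?thesis by (simp add: algebra_simps)
  qed
  have diff_int: "integrable lebesgue (\<lambda>x. \<bar>v (Suc n) x - v n x\<bar>)" for n
  proof (rule intgr)
    show "\<bar>\<bar>v (Suc n) x - v n x\<bar>\<bar> \<le> M" for x
      using vS(2,3)[of n x] vS(2,3)[of "Suc n" x] f(2)[of x] by (simp add: abs_le_iff)
  qed (simp_all add: v_supp)
  have "(\<integral>\<^sup>+x. (\<Sum>n. ennreal \<bar>v (Suc n) x - v n x\<bar>) \<partial>lebesgue) = (\<Sum>n. \<integral>\<^sup>+x. ennreal \<bar>v (Suc n) x - v n x\<bar> \<partial>lebesgue)"
    by (rule nn_integral_suminf) measurable
  also have "\<dots> = (\<Sum>n. ennreal (\<integral>x. \<bar>v (Suc n) x - v n x\<bar> \<partial>lebesgue))"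
    using diff_int by (intro suminf_cong nn_integral_eq_integral) auto
  also have "\<dots> \<le> (\<Sum>n. ennreal ((1/2)^n * (2 + measure lebesgue (cbox a b) / 2)))"
    by (intro suminf_le ennreal_leI step) auto
  also have "\<dots> < top"
    unfolding less_top[symmetric] by (intro ennreal_suminf_neq_top summable_mult2 summable_geometric) auto
  finally have "AE x in lebesgue. (\<Sum>n. ennreal \<bar>v (Suc n) x - v n x\<bar>) \<noteq> \<infinity>"
    by (intro nn_integral_noteq_infinite) auto
  then have convg: "AE x in lebesgue. convergent (\<lambda>n. v n x)"
  proof eventually_elim
    fix x assume "(\<Sum>n. ennreal \<bar>v (Suc n) x - v n x\<bar>) \<noteq> \<infinity>"
    then have "summable (\<lambda>n. \<bar>v (Suc n) x - v n x\<bar>)" by (intro summable_suminf_not_top) auto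
    then have "summable (\<lambda>n. v (Suc n) x - v n x)" by (rule summable_rabs_cancel)
    then have "convergent (\<lambda>n. \<Sum>k<n. v (Suc k) x - v k x)" by (simp add: summable_iff_convergent)
    then have "convergent (\<lambda>n. v n x - v 0 x)" by (simp only: sum_lessThan_telescope[of "\<lambda>n. v n x"])
    then have "convergent (\<lambda>n. v 0 x + (v n x - v 0 x))" by (rule convergent_add[OF convergent_const])
    then show "convergent (\<lambda>n. v n x)" by simp
  qed
  \<comment> \<open>The lower limit belongs to the ball by solidity and the Fatou property, without any exceptional set.\<close>
  define U where "U x = liminf (\<lambda>n. ennreal (v n x))" for x
  have U_le: "U x \<le> ennreal (f x)" for x
    unfolding U_def liminf_SUP_INF
  proof (rule SUP_least)
    fix n show "(INF m\<in>{n..}. ennreal (v m x)) \<le> ennreal (f x)"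
      using vS(3)[of n x] by (intro INF_lower2[of n] ennreal_leI) auto
  qed
  define u where "u x = enn2real (U x)" for x
  have U_u: "U x = ennreal (u x)" for x
    using le_less_trans[OF U_le ennreal_less_top] by (simp add: u_def)
  have u_bounds: "0 \<le> u x" "u x \<le> f x" for x
    using U_le[of x] f(1)[of x] by (simp_all add: u_def enn2real_leI)
  have [measurable]: "U \<in> borel_measurable lebesgue" unfolding U_def by measurable
  have u_meas[measurable]: "u \<in> borel_measurable lebesgue" unfolding u_def by measurable
  have "(\<lambda>x. SUP n. INF m\<in>{n..}. ennreal (v m x)) \<in> B"
  proof (rule normal_ballD(4)[OF B])
    fix n
    show "(\<lambda>x. INF m\<in>{n..}. ennreal (v m x)) \<in> B"
      by (rule normal_ball_mono[OF B vS(4)[of n]]) (measurable, auto intro: INF_lower)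
  next
    show "incseq (\<lambda>n x. INF m\<in>{n..}. ennreal (v m x))"
      by (intro incseq_SucI le_funI INF_superset_mono) auto
  qed
  then have uB: "(\<lambda>x. ennreal (u x)) \<in> B" by (simp add: U_u[symmetric] U_def liminf_SUP_INF)
  then have uS: "u \<in> S" using u_bounds u_meas by (simp add: S_def)
  have lim: "AE x in lebesgue. (\<lambda>n. v n x) \<longlonglongrightarrow> u x"
    using convg
  proof eventually_elim
    fix x assume "convergent (\<lambda>n. v n x)"
    then obtain l where l: "(\<lambda>n. v n x) \<longlonglongrightarrow> l" by (auto simp: convergent_def)
    have "0 \<le> l" using l vS(2) by (intro LIMSEQ_le_const[OF l]) auto
    have "(\<lambda>n. ennreal (v n x)) \<longlonglongrightarrow> ennreal l" using l by (rule tendsto_ennrealI)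
    then have "U x = ennreal l" unfolding U_def by (intro lim_imp_Liminf) auto
    then show "(\<lambda>n. v n x) \<longlonglongrightarrow> u x" using l \<open>0 \<le> l\<close> by (simp add: u_def)
  qed
  have Dlim: "(\<lambda>n. D (v n)) \<longlonglongrightarrow> D u"
    unfolding D_def
  proof (rule integral_dominated_convergence[where w = "\<lambda>x. (f x)\<^sup>2"])
    show "integrable lebesgue (\<lambda>x. (f x)\<^sup>2)" using D_int[OF zero_S] by simp
    show "AE x in lebesgue. (\<lambda>n. (f x - v n x)\<^sup>2) \<longlonglongrightarrow> (f x - u x)\<^sup>2"
      using lim by eventually_elim (intro tendsto_intros)
    show "AE x in lebesgue. norm ((f x - v n x)\<^sup>2) \<le> (f x)\<^sup>2" for n
      using vS(2,3)[of n] by (intro AE_I2) (simp add: power_mono)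
  qed measurable
  have dlim: "(\<lambda>n. d + (1/4)^n) \<longlonglongrightarrow> d + 0" by (intro tendsto_intros LIMSEQ_power_zero) simp
  have "D u \<le> d + 0"
    by (rule LIMSEQ_le[OF Dlim dlim]) (auto intro!: exI[of _ 0] less_imp_le[OF v(2)])
  then have Du: "D u \<le> D w" if "w \<in> S" for w using d_le[OF that] by simp
  define g where "g x = f x - u x" for x
  have g: "0 \<le> g x" "g x \<le> f x" for x using u_bounds[of x] by (simp_all add: g_def)
  have [measurable]: "g \<in> borel_measurable lebesgue" unfolding g_def by measurable
  have gu_supp: "g x = 0" "u x = 0" if "x \<notin> cbox a b" for x
    using g[of x] u_bounds[of x] supp[OF that] by auto
  have M: "0 \<le> M" using f[of undefined] by linarith
  \<comment> \<open>The variational inequality: moving from \<open>u\<close> towards \<open>w\<close>, and truncating at \<open>f\<close>, does not decrease the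
    distance.\<close>
  have opt: "(\<integral>x. g x * w x \<partial>lebesgue) \<le> (\<integral>x. g x * u x \<partial>lebesgue)"
    if [measurable]: "w \<in> borel_measurable lebesgue" and w: "\<And>x. 0 \<le> w x" "\<And>x. w x \<le> K" "\<And>x. x \<notin> cbox a b \<Longrightarrow> w x = 0"
      and wB: "(\<lambda>x. ennreal (w x)) \<in> B" for w K
  proof -
    have wu: "\<bar>w x - u x\<bar> \<le> K + M" for x
      using w(1,2)[of x] u_bounds[of x] f(2)[of x] M by (simp add: abs_le_iff)
    have KM: "0 \<le> K + M" using wu[of undefined] by linarith
    have i1: "integrable lebesgue (\<lambda>x. g x * (w x - u x))"
    proof (rule intgr)
      show "\<bar>g x * (w x - u x)\<bar> \<le> M * (K + M)" for x
        unfolding abs_mult using g[of x] f(2)[of x] wu[of x] M by (intro mult_mono) auto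
    qed (auto simp: gu_supp)
    have i2: "integrable lebesgue (\<lambda>x. (w x - u x)\<^sup>2)"
    proof (rule intgr)
      show "\<bar>(w x - u x)\<^sup>2\<bar> \<le> (K + M)\<^sup>2" for x
        using power_mono[OF wu[of x], of 2] by simp
    qed (auto simp: gu_supp w(3))
    define X where "X = (\<integral>x. g x * (w x - u x) \<partial>lebesgue)"
    define Y where "Y = (\<integral>x. (w x - u x)\<^sup>2 \<partial>lebesgue)"
    have Y: "0 \<le> Y" by (simp add: Y_def)
    have var: "2 * X \<le> t * Y" if t: "0 < t" "t \<le> 1" for t
    proof -
      define z where "z x = (1 - t) * u x + t * w x" for x
      have z_eq: "ennreal (z x) = ennreal (1 - t) * ennreal (u x) + ennreal t * ennreal (w x)" for x
        using u_bounds(1)[of x] w(1)[of x] t by (simp add: z_def ennreal_mult[symmetric] ennreal_plus[symmetric] del: ennreal_plus)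
      have zB: "(\<lambda>x. ennreal (z x)) \<in> B"
        unfolding z_eq using t by (intro conv[unfolded convex_ball_def, rule_format, OF uB wB]) auto
      have min_meas[measurable]: "(\<lambda>x. min (f x) (z x)) \<in> borel_measurable lebesgue"
        unfolding z_def by measurable
      have "(\<lambda>x. ennreal (min (f x) (z x))) \<in> B"
        by (rule normal_ball_mono[OF B zB]) (measurable, simp add: ennreal_leI)
      moreover have "0 \<le> z x" for x using u_bounds(1)[of x] w(1)[of x] t by (simp add: z_def)
      ultimately have "(\<lambda>x. min (f x) (z x)) \<in> S"
        using f(1) min_meas by (simp add: S_def)
      then have "D u \<le> D (\<lambda>x. min (f x) (z x))" by (rule Du)
      also have "\<dots> \<le> (\<integral>x. (g x)\<^sup>2 - 2 * t * (g x * (w x - u x)) + t\<^sup>2 * (w x - u x)\<^sup>2 \<partial>lebesgue)"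
        unfolding D_def
      proof (rule Bochner_Integration.integral_mono')
        show "integrable lebesgue (\<lambda>x. (g x)\<^sup>2 - 2 * t * (g x * (w x - u x)) + t\<^sup>2 * (w x - u x)\<^sup>2)"
          using D_int[OF uS] i1 i2 unfolding g_def[symmetric]
          by (intro Bochner_Integration.integrable_add Bochner_Integration.integrable_diff integrable_mult_right)
        fix x
        have sq: "(g x - t * (w x - u x))\<^sup>2 = (g x)\<^sup>2 - 2 * t * (g x * (w x - u x)) + t\<^sup>2 * (w x - u x)\<^sup>2"
          by (simp add: power2_eq_square algebra_simps)
        show "0 \<le> (g x)\<^sup>2 - 2 * t * (g x * (w x - u x)) + t\<^sup>2 * (w x - u x)\<^sup>2"
          unfolding sq[symmetric] by simp
        have "(f x - min (f x) (z x))\<^sup>2 \<le> (f x - z x)\<^sup>2"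
          by (cases "f x \<le> z x") (auto simp: min_def)
        also have "f x - z x = g x - t * (w x - u x)" by (simp add: g_def z_def algebra_simps)
        also note sq
        finally show "(f x - min (f x) (z x))\<^sup>2 \<le> (g x)\<^sup>2 - 2 * t * (g x * (w x - u x)) + t\<^sup>2 * (w x - u x)\<^sup>2" .
      qed
      also have "\<dots> = D u - 2 * t * X + t\<^sup>2 * Y"
      proof -
        note j0 = D_int[OF uS, folded g_def]
        note j1 = integrable_mult_right[OF i1, of "2 * t"] and j2 = integrable_mult_right[OF i2, of "t\<^sup>2"]
        show ?thesis
          unfolding Bochner_Integration.integral_add[OF Bochner_Integration.integrable_diff[OF j0 j1] j2]
            Bochner_Integration.integral_diff[OF j0 j1]
          by (simp add: X_def Y_def D_def g_def)
      qed
      finally have "t * (2 * X) \<le> t * (t * Y)" by (simp add: power2_eq_square)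
      then show ?thesis using t by simp
    qed
    have "X \<le> 0"
    proof (rule ccontr)
      assume "\<not> X \<le> 0"
      then have X: "0 < X" by simp
      define t where "t = min 1 (X / (Y + 1))"
      have t: "0 < t" "t \<le> 1" "t \<le> X / (Y + 1)" using X Y by (auto simp: t_def)
      have "2 * X \<le> t * Y" by (rule var[OF t(1,2)])
      also have "\<dots> \<le> X / (Y + 1) * (Y + 1)" using t Y X by (intro mult_mono) auto
      also have "\<dots> = X" using Y by simp
      finally show False using X by simp
    qed
    have i3: "integrable lebesgue (\<lambda>x. g x * u x)"
    proof (rule intgr)
      show "\<bar>g x * u x\<bar> \<le> M * M" for x
        unfolding abs_mult using g[of x] u_bounds[of x] f(2)[of x] M by (intro mult_mono) auto
    qed (auto simp: gu_supp)
    have "(\<integral>x. g x * w x \<partial>lebesgue) = (\<integral>x. g x * (w x - u x) + g x * u x \<partial>lebesgue)"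
      by (simp add: algebra_simps)
    also have "\<dots> = X + (\<integral>x. g x * u x \<partial>lebesgue)"
      unfolding X_def by (rule Bochner_Integration.integral_add[OF i1 i3])
    finally show ?thesis using \<open>X \<le> 0\<close> by simp
  qed
  define \<kappa> where "\<kappa> = (\<integral>x. g x * u x \<partial>lebesgue)"
  have \<kappa>: "0 \<le> \<kappa>" unfolding \<kappa>_def using g u_bounds by (intro integral_nonneg_AE) auto
  have polar_g: "(\<integral>\<^sup>+x. V x * ennreal (g x) \<partial>lebesgue) \<le> ennreal \<kappa>" if V: "V \<in> B" for V
  proof -
    have [measurable]: "V \<in> borel_measurable lebesgue" using V normal_ballD(1)[OF B] by blast
    have "(\<integral>\<^sup>+x. V x * ennreal (g x) \<partial>lebesgue) = (\<integral>\<^sup>+x. (SUP n. trunc n V x * ennreal (g x)) \<partial>lebesgue)"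
      by (simp add: SUP_mult_right_ennreal[symmetric] SUP_trunc)
    also have "\<dots> = (SUP n. \<integral>\<^sup>+x. trunc n V x * ennreal (g x) \<partial>lebesgue)"
      using incseq_trunc[of V] by (intro nn_integral_monotone_convergence_SUP) (auto simp: incseq_def le_fun_def mult_right_mono)
    also have "\<dots> \<le> ennreal \<kappa>"
    proof (rule SUP_least)
      fix n
      define w where "w x = enn2real (trunc n V x) * indicat_real (cbox a b) x" for x
      have w_eq: "ennreal (w x) = trunc n V x * indicator (cbox a b) x" for x
        using le_less_trans[OF trunc_le(2) ennreal_less_top, of n V x] by (simp add: w_def ennreal_mult indicator_def)
      have [measurable]: "w \<in> borel_measurable lebesgue" unfolding w_def by measurable
      have w0: "0 \<le> w x" for x by (simp add: w_def)
      have wn: "w x \<le> real n" for x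
        using trunc_le(2)[of n V x] by (auto simp: w_def indicator_def enn2real_leI)
      have wB: "(\<lambda>x. ennreal (w x)) \<in> B"
        unfolding w_eq by (rule normal_ball_mono[OF B V]) (measurable, auto simp: indicator_def trunc_le)
      have "(\<integral>\<^sup>+x. trunc n V x * ennreal (g x) \<partial>lebesgue) = (\<integral>\<^sup>+x. ennreal (g x * w x) \<partial>lebesgue)"
        using g w0 by (intro nn_integral_cong) (auto simp: ennreal_mult w_eq indicator_def gu_supp mult.commute)
      also have "\<dots> = ennreal (\<integral>x. g x * w x \<partial>lebesgue)"
      proof (rule nn_integral_eq_integral)
        show "integrable lebesgue (\<lambda>x. g x * w x)"
        proof (rule intgr)
          show "\<bar>g x * w x\<bar> \<le> M * real n" for x
            unfolding abs_mult using g[of x] w0[of x] wn[of x] f(2)[of x] M by (intro mult_mono) auto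
        qed (auto simp: gu_supp)
        show "AE x in lebesgue. 0 \<le> g x * w x" using g w0 by simp
      qed
      also have "\<dots> \<le> ennreal \<kappa>"
        unfolding \<kappa>_def using w0 wn wB by (intro ennreal_leI opt[of w "real n"]) (auto simp: w_def)
      finally show "(\<integral>\<^sup>+x. trunc n V x * ennreal (g x) \<partial>lebesgue) \<le> ennreal \<kappa>" .
    qed
    finally show ?thesis .
  qed
  have fg_int: "integrable lebesgue (\<lambda>x. g x * f x)"
  proof (rule intgr)
    show "\<bar>g x * f x\<bar> \<le> M * M" for x
      unfolding abs_mult using g[of x] f[of x] M by (intro mult_mono) auto
  qed (auto simp: gu_supp)
  \<comment> \<open>Adding \<open>e\<close> avoids division by zero when \<open>\<kappa>\<close> vanishes.\<close>
  have "(\<integral>x. g x * f x \<partial>lebesgue) \<le> \<kappa> + e" if e: "0 < e" for e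
  proof -
    have ke: "0 < \<kappa> + e" using \<kappa> e by simp
    have "(\<lambda>x. ennreal (1 / (\<kappa> + e)) * ennreal (g x)) \<in> polar B"
    proof (rule polarI)
      fix V assume V: "V \<in> B"
      have [measurable]: "V \<in> borel_measurable lebesgue" using V normal_ballD(1)[OF B] by blast
      have "(\<integral>\<^sup>+x. V x * (ennreal (1 / (\<kappa> + e)) * ennreal (g x)) \<partial>lebesgue) = ennreal (1 / (\<kappa> + e)) * (\<integral>\<^sup>+x. V x * ennreal (g x) \<partial>lebesgue)"
        by (subst nn_integral_cmult[symmetric]) (auto simp: mult_ac)
      also have "\<dots> \<le> ennreal (1 / (\<kappa> + e)) * ennreal \<kappa>" by (intro mult_left_mono polar_g[OF V]) simp
      also have "\<dots> = ennreal (\<kappa> / (\<kappa> + e))" using \<kappa> ke by (simp add: ennreal_mult[symmetric])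
      also have "\<dots> \<le> 1" using \<kappa> e by simp
      finally show "(\<integral>\<^sup>+x. V x * (ennreal (1 / (\<kappa> + e)) * ennreal (g x)) \<partial>lebesgue) \<le> 1" .
    qed measurable
    then have "(\<integral>\<^sup>+x. (ennreal (1 / (\<kappa> + e)) * ennreal (g x)) * ennreal (f x) \<partial>lebesgue) \<le> 1"
      by (rule polarD[OF bipolar])
    also have "(\<integral>\<^sup>+x. (ennreal (1 / (\<kappa> + e)) * ennreal (g x)) * ennreal (f x) \<partial>lebesgue) =
        ennreal (1 / (\<kappa> + e)) * (\<integral>\<^sup>+x. ennreal (g x * f x) \<partial>lebesgue)"
      using g f by (subst nn_integral_cmult[symmetric]) (auto simp: ennreal_mult mult.assoc)
    also have "(\<integral>\<^sup>+x. ennreal (g x * f x) \<partial>lebesgue) = ennreal (\<integral>x. g x * f x \<partial>lebesgue)"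
      using fg_int g f by (intro nn_integral_eq_integral) auto
    also have "ennreal (1 / (\<kappa> + e)) * ennreal (\<integral>x. g x * f x \<partial>lebesgue) = ennreal ((\<integral>x. g x * f x \<partial>lebesgue) / (\<kappa> + e))"
      using ke by (subst ennreal_mult'[symmetric]) auto
    finally show ?thesis using ke by simp
  qed
  then have "(\<integral>x. g x * f x \<partial>lebesgue) \<le> \<kappa>" by (rule field_le_epsilon)
  moreover have g2_int: "integrable lebesgue (\<lambda>x. (g x)\<^sup>2)" using D_int[OF uS] by (simp add: g_def)
  moreover have "(\<integral>x. (g x)\<^sup>2 \<partial>lebesgue) = (\<integral>x. g x * f x \<partial>lebesgue) - \<kappa>"
  proof -
    have "(\<integral>x. g x * u x \<partial>lebesgue) = (\<integral>x. g x * f x - (g x)\<^sup>2 \<partial>lebesgue)"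
      by (simp add: g_def power2_eq_square algebra_simps)
    also have "\<dots> = (\<integral>x. g x * f x \<partial>lebesgue) - (\<integral>x. (g x)\<^sup>2 \<partial>lebesgue)"
      by (rule Bochner_Integration.integral_diff[OF fg_int g2_int])
    finally show ?thesis by (simp add: \<kappa>_def)
  qed
  moreover have "0 \<le> (\<integral>x. (g x)\<^sup>2 \<partial>lebesgue)" by simp
  ultimately have "(\<integral>x. (g x)\<^sup>2 \<partial>lebesgue) = 0" by linarith
  then have "AE x in lebesgue. (g x)\<^sup>2 = 0"
    using integral_nonneg_eq_0_iff_AE[OF g2_int] by simp
  then have "AE x in lebesgue. ennreal (f x) \<le> ennreal (u x)"
    by eventually_elim (simp add: g_def)
  then show ?thesis by (rule normal_ballD(3)[OF B uB, rotated]) measurable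
qed

text \<open>The bipolar theorem for norm balls of function spaces, which is the Lorentz--Luxemburg theorem \<open>X'' = X\<close>.\<close>

lemma bipolar_eq:
  assumes B: "normal_ball B" and conv: "convex_ball B"
  shows "polar (polar B) = B"
proof (intro equalityI subsetI)
  fix F :: "'a \<Rightarrow> ennreal" assume F: "F \<in> B"
  show "F \<in> polar (polar B)"
  proof (rule polarI)
    show "F \<in> borel_measurable lebesgue" using F normal_ballD(1)[OF B] by blast
    fix G assume "G \<in> polar B"
    then show "(\<integral>\<^sup>+x. G x * F x \<partial>lebesgue) \<le> 1" using polarD[of G B F] F by (simp add: mult.commute)
  qed
next
  fix F :: "'a \<Rightarrow> ennreal" assume F: "F \<in> polar (polar B)"
  have [measurable]: "F \<in> borel_measurable lebesgue" using F by (rule polar_measurable)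
  have pp: "normal_ball (polar (polar B))" by (intro normal_ball_polar) (auto simp: polar_def)
  have "trunc n F \<in> B" for n
  proof -
    define f where "f x = enn2real (trunc n F x)" for x
    have f_eq: "ennreal (f x) = trunc n F x" for x
      using le_less_trans[OF trunc_le(2) ennreal_less_top, of n F x] by (simp add: f_def)
    have "(\<lambda>x. ennreal (f x)) \<in> B"
    proof (rule bipolar_bounded[OF B conv])
      show "f \<in> borel_measurable lebesgue" unfolding f_def by measurable
      show "0 \<le> f x" for x by (simp add: f_def)
      show "f x \<le> real n" for x using trunc_le(2)[of n F x] by (simp add: f_def enn2real_leI)
      show "f x = 0" if "x \<notin> cbox (- (real n *\<^sub>R One)) (real n *\<^sub>R One)" for x
        using that by (simp add: f_def trunc_def)
      show "(\<lambda>x. ennreal (f x)) \<in> polar (polar B)"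
        unfolding f_eq by (rule normal_ball_mono[OF pp F]) (simp_all add: trunc_le)
    qed
    then show ?thesis by (simp add: f_eq)
  qed
  then have "(\<lambda>x. SUP n. trunc n F x) \<in> B" by (rule normal_ballD(4)[OF B _ incseq_trunc])
  then show "F \<in> B" by (simp add: SUP_trunc)
qed

section \<open>\<open>A\<^sub>1\<close> majorants and pairings\<close>

text \<open>
  Missing terms of a finite convex combination are filled up with the zero function.
\<close>

lemma convex_ball_series:
  assumes B: "normal_ball B" and conv: "convex_ball B" and b: "\<And>k. b k \<in> B"
  shows "(\<lambda>x. \<Sum>k. ennreal ((1/2)^(k+1)) * b k x) \<in> B"
proof -
  have partial: "(\<lambda>x. \<Sum>k<n. ennreal ((1/2)^(k+1)) * b k x) \<in> B" if "\<And>k. b k \<in> B" for n b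
    using that
  proof (induction n arbitrary: b)
    case 0
    then show ?case using normal_ballD(2)[OF B] by simp
  next
    case (Suc n)
    have eq: "(\<Sum>k<Suc n. ennreal ((1/2)^(k+1)) * b k x) =
      ennreal (1/2) * b 0 x + ennreal (1/2) * (\<Sum>k<n. ennreal ((1/2)^(k+1)) * b (Suc k) x)" for x
    proof -
      have "ennreal ((1/2)^(Suc k+1)) = ennreal (1/2) * ennreal ((1/2)^(k+1))" for k
        by (subst ennreal_mult[symmetric]) simp_all
      then show ?thesis
        by (simp only: sum.lessThan_Suc_shift sum_distrib_left mult.assoc) simp
    qed
    have "(\<lambda>x. \<Sum>k<n. ennreal ((1/2)^(k+1)) * b (Suc k) x) \<in> B"
      by (rule Suc.IH) (rule Suc.prems)
    then show ?case
      unfolding eq by (rule conv[unfolded convex_ball_def, rule_format, OF Suc.prems]) auto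
  qed
  have "(\<lambda>x. SUP n. \<Sum>k<n. ennreal ((1/2)^(k+1)) * b k x) \<in> B"
  proof (rule normal_ballD(4)[OF B])
    show "(\<lambda>x. \<Sum>k<n. ennreal ((1/2)^(k+1)) * b k x) \<in> B" for n by (rule partial[OF b])
    show "incseq (\<lambda>n x. \<Sum>k<n. ennreal ((1/2)^(k+1)) * b k x)"
      by (intro incseq_SucI le_funI) simp
  qed
  then show ?thesis by (simp only: suminf_eq_SUP)
qed

text \<open>
  The Rubio de Francia algorithm: the series of normalized iterates of the maximal operator
  is an \<open>A\<^sub>1\<close> majorant in the same ball, up to constants.
\<close>

lemma Rubio_de_Francia:
  assumes B: "normal_ball B" and conv: "convex_ball B" and C: "0 < C"
    and M: "\<And>F. F \<in> B \<Longrightarrow> (\<lambda>x. hl_max F x / ennreal C) \<in> B" and F: "F \<in> B"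
  shows "\<exists>w\<in>B. (\<forall>x. F x \<le> 2 * w x) \<and> (\<forall>x. hl_max w x \<le> ennreal (2 * C) * w x)"
proof -
  define T where "T G x = hl_max G x / ennreal C" for G :: "'a \<Rightarrow> ennreal" and x
  define b where "b k = (T ^^ k) F" for k
  have b: "b k \<in> B" for k
  proof (induction k)
    case (Suc k)
    have "b (Suc k) = (\<lambda>x. hl_max (b k) x / ennreal C)" by (simp add: b_def T_def fun_eq_iff)
    then show ?case using M[OF Suc] by simp
  qed (simp add: b_def F)
  have [measurable]: "b k \<in> borel_measurable lebesgue" for k using b normal_ballD(1)[OF B] by blast
  have step: "hl_max (b k) x = ennreal C * b (Suc k) x" for k x
    using C by (simp add: b_def T_def ennreal_times_divide mult_divide_eq_ennreal mult.commute[of "ennreal C"])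
  define w where "w x = (\<Sum>k. ennreal ((1/2)^(k+1)) * b k x)" for x
  have "w \<in> B" unfolding w_def by (rule convex_ball_series[OF B conv b])
  moreover have "F x \<le> 2 * w x" for x
  proof -
    have "ennreal ((1/2)^(0+1)) * b 0 x \<le> w x"
      unfolding w_def using sum_le_suminf[of "\<lambda>k. ennreal ((1/2)^(k+1)) * b k x" "{0}"] by simp
    then have "2 * (ennreal (1/2) * F x) \<le> 2 * w x" by (intro mult_left_mono) (simp_all add: b_def)
    moreover have "2 * (ennreal (1/2) * F x) = ennreal (2 * (1/2)) * F x"
      by (subst ennreal_mult) (auto simp: mult.assoc)
    ultimately show ?thesis by simp
  qed
  moreover have "hl_max w x \<le> ennreal (2 * C) * w x" for x
  proof -
    have "hl_max w x \<le> (\<Sum>k. hl_max (\<lambda>x. ennreal ((1/2)^(k+1)) * b k x) x)"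
      unfolding w_def by (rule hl_max_suminf_le) measurable
    also have "\<dots> = (\<Sum>k. ennreal (2 * C) * (ennreal ((1/2)^(Suc k+1)) * b (Suc k) x))"
    proof (rule suminf_cong)
      fix k
      have "ennreal ((1/2)^(k+1)) * ennreal C = ennreal (2 * C) * ennreal ((1/2)^(Suc k+1))"
        using C by (simp add: ennreal_mult[symmetric])
      then show "hl_max (\<lambda>x. ennreal ((1/2)^(k+1)) * b k x) x = ennreal (2 * C) * (ennreal ((1/2)^(Suc k+1)) * b (Suc k) x)"
        by (simp only: hl_max_cmult[OF \<open>b k \<in> borel_measurable lebesgue\<close>] step mult.assoc[symmetric])
    qed
    also have "\<dots> = ennreal (2 * C) * (\<Sum>k. ennreal ((1/2)^(Suc k+1)) * b (Suc k) x)"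
      by (rule ennreal_suminf_cmult)
    also have "\<dots> \<le> ennreal (2 * C) * w x"
      unfolding w_def
    proof (rule mult_left_mono)
      show "(\<Sum>k. ennreal ((1/2)^(Suc k+1)) * b (Suc k) x) \<le> (\<Sum>k. ennreal ((1/2)^(k+1)) * b k x)"
        using suminf_offset[of "\<lambda>k. ennreal ((1/2)^(k+1)) * b k x" 1] by simp
    qed simp
    finally show ?thesis .
  qed
  ultimately show ?thesis by blast
qed

text \<open>
  Since \<open>A\<^sub>1\<close> majorants satisfy a reverse Hoelder inequality, boundedness of the maximal
  operator improves itself to a slightly larger power.
\<close>

lemma ball_maximal_A1_majorant:
  fixes B :: "('a::euclidean_space \<Rightarrow> ennreal) set"
  assumes B: "normal_ball B" and conv: "convex_ball B" and M: "ball_maximal B" and b: "1 < b"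
  obtains p A where "1 < p" "p \<le> b" "1 \<le> A"
    and "\<And>F. F \<in> B \<Longrightarrow> \<exists>w\<in>B. (\<forall>x. F x \<le> 2 * w x) \<and> (\<forall>x. hl_max w x \<le> ennreal A * w x) \<and>
           (\<forall>x. hl_max (\<lambda>y. w y epowr p) x \<le> ennreal A * w x epowr p)"
proof -
  obtain C where C: "0 < C" "\<And>F. F \<in> B \<Longrightarrow> (\<lambda>x. hl_max F x / ennreal C) \<in> B"
    using M unfolding ball_maximal_def by blast
  define A0 where "A0 = max 1 (2 * C)"
  have A0: "1 \<le> A0" "2 * C \<le> A0" by (simp_all add: A0_def)
  obtain e0 where e0: "0 < e0" and RH: "\<And>e (w :: 'a \<Rightarrow> ennreal) x. e \<in> {0<..e0} \<Longrightarrow> w \<in> borel_measurable lebesgue \<Longrightarrow>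
      AE x in lebesgue. hl_max w x \<le> ennreal A0 * w x \<Longrightarrow>
      hl_max (\<lambda>y. w y epowr (1 + e)) x \<le> 2 * hl_max w x epowr (1 + e)"
    using reverse_Hoelder_A1[OF A0(1), where ?'a = 'a] by blast
  define e where "e = min e0 (b - 1)"
  have e: "0 < e" "e \<le> e0" "1 + e \<le> b" using e0 b by (auto simp: e_def)
  define A where "A = 2 * A0 powr (1 + e)"
  have "A0 powr 1 \<le> A0 powr (1 + e)" using A0(1) e(1) by (intro powr_mono) auto
  then have A: "A0 \<le> A" "1 \<le> A" using A0(1) by (simp_all add: A_def)
  show ?thesis
  proof (rule that[of "1 + e" A])
    fix F assume F: "F \<in> B"
    obtain w where w: "w \<in> B" "\<And>x. F x \<le> 2 * w x" "\<And>x. hl_max w x \<le> ennreal (2 * C) * w x"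
      using Rubio_de_Francia[OF B conv C F] by blast
    have w_meas: "w \<in> borel_measurable lebesgue" using w(1) normal_ballD(1)[OF B] by blast
    have wA0: "hl_max w x \<le> ennreal A0 * w x" for x
      using w(3)[of x] mult_right_mono[OF ennreal_leI[OF A0(2)], of "w x"] by (rule order_trans) simp
    have "hl_max w x \<le> ennreal A * w x" for x
      using wA0[of x] mult_right_mono[OF ennreal_leI[OF A(1)], of "w x"] by (rule order_trans) simp
    moreover have "hl_max (\<lambda>y. w y epowr (1 + e)) x \<le> ennreal A * w x epowr (1 + e)" for x
    proof -
      have "hl_max (\<lambda>y. w y epowr (1 + e)) x \<le> 2 * hl_max w x epowr (1 + e)"
        using e by (intro RH w_meas AE_I2 wA0) auto
      also have "\<dots> \<le> 2 * (ennreal A0 * w x) epowr (1 + e)"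
        using e wA0 by (intro mult_left_mono epowr_mono) auto
      also have "\<dots> = ennreal A * w x epowr (1 + e)"
        using A0(1) by (simp add: A_def epowr_mult epowr_ennreal ennreal_mult mult.assoc)
      finally show ?thesis .
    qed
    ultimately show "\<exists>w\<in>B. (\<forall>x. F x \<le> 2 * w x) \<and> (\<forall>x. hl_max w x \<le> ennreal A * w x) \<and>
           (\<forall>x. hl_max (\<lambda>y. w y epowr (1 + e)) x \<le> ennreal A * w x epowr (1 + e))"
      using w(1,2) by blast
  qed (use e A in auto)
qed

lemma divide_in_polar_iff:
  assumes B: "B \<subseteq> borel_measurable lebesgue" and [measurable]: "G \<in> borel_measurable lebesgue" and k: "0 < k"
  shows "(\<lambda>x. G x / ennreal k) \<in> polar B \<longleftrightarrow> (\<forall>F\<in>B. (\<integral>\<^sup>+x. F x * G x \<partial>lebesgue) \<le> ennreal k)"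
proof -
  have "(\<integral>\<^sup>+x. F x * (G x / ennreal k) \<partial>lebesgue) \<le> 1 \<longleftrightarrow> (\<integral>\<^sup>+x. F x * G x \<partial>lebesgue) \<le> ennreal k"
    if F: "F \<in> B" for F
  proof -
    have [measurable]: "F \<in> borel_measurable lebesgue" using F B by blast
    have "(\<integral>\<^sup>+x. F x * (G x / ennreal k) \<partial>lebesgue) = (\<integral>\<^sup>+x. F x * G x \<partial>lebesgue) / ennreal k"
      by (simp add: ennreal_times_divide nn_integral_divide)
    moreover have "y / ennreal k \<le> 1 \<longleftrightarrow> y \<le> ennreal k" for y
    proof -
      have "y = ennreal k * (y / ennreal k)"
        using k by (simp add: ennreal_times_divide mult_divide_eq_ennreal mult.commute[of "ennreal k"])
      then have "y \<le> ennreal k \<longleftrightarrow> ennreal k * (y / ennreal k) \<le> ennreal k * 1" by simp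
      also have "\<dots> \<longleftrightarrow> y / ennreal k \<le> 1" using k by (intro ennreal_mult_le_mult_iff) auto
      finally show ?thesis by simp
    qed
    ultimately show ?thesis by simp
  qed
  then show ?thesis by (simp add: polar_def)
qed

lemma SUP_mult_incseq:
  fixes a b :: "nat \<Rightarrow> ennreal"
  assumes "incseq a" "incseq b"
  shows "(SUP n. a n) * (SUP n. b n) = (SUP n. a n * b n)"
proof (rule antisym)
  show "(SUP n. a n) * (SUP n. b n) \<le> (SUP n. a n * b n)"
    unfolding SUP_mult_right_ennreal SUP_mult_left_ennreal
  proof (intro SUP_least)
    fix i j
    have "a i * b j \<le> a (max i j) * b (max i j)"
      using assms by (intro mult_mono) (auto simp: incseq_def)
    then show "a i * b j \<le> (SUP n. a n * b n)" by (rule SUP_upper2[OF UNIV_I])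
  qed
  show "(SUP n. a n * b n) \<le> (SUP n. a n) * (SUP n. b n)"
    by (intro SUP_least mult_mono SUP_upper) auto
qed

text \<open>
  Both sides of the pairing can be replaced by bounded functions with bounded support, since the maximal
  operator commutes with increasing limits.
\<close>

lemma hl_max_pairing_trunc_le:
  assumes [measurable]: "h \<in> borel_measurable lebesgue" "f \<in> borel_measurable lebesgue"
    and le: "\<And>n. (\<integral>\<^sup>+x. hl_max (trunc n h) x * trunc n f x \<partial>lebesgue) \<le> K"
  shows "(\<integral>\<^sup>+x. hl_max h x * f x \<partial>lebesgue) \<le> K"
proof -
  have inc1: "incseq (\<lambda>n. hl_max (trunc n h) x)" for x
    using incseq_hl_max[OF incseq_trunc[of h]] by (simp add: incseq_def le_fun_def)
  have inc2: "incseq (\<lambda>n. trunc n f x)" for x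
    using incseq_trunc[of f] by (simp add: incseq_def le_fun_def)
  have "hl_max h x = (SUP n. hl_max (trunc n h) x)" for x
    using hl_max_SUP[of "\<lambda>n. trunc n h" x] incseq_trunc[of h] by (simp add: SUP_trunc)
  then have "hl_max h x * f x = (SUP n. hl_max (trunc n h) x * trunc n f x)" for x
    using SUP_mult_incseq[OF inc1 inc2, of x x] by (simp add: SUP_trunc)
  then have "(\<integral>\<^sup>+x. hl_max h x * f x \<partial>lebesgue) = (\<integral>\<^sup>+x. (SUP n. hl_max (trunc n h) x * trunc n f x) \<partial>lebesgue)"
    by simp
  also have "\<dots> = (SUP n. \<integral>\<^sup>+x. hl_max (trunc n h) x * trunc n f x \<partial>lebesgue)"
    using inc1 inc2 by (intro nn_integral_monotone_convergence_SUP) (auto simp: incseq_def le_fun_def intro!: mult_mono)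
  also have "\<dots> \<le> K" by (intro SUP_least le)
  finally show ?thesis .
qed

lemma cube_sum_le:
  assumes "\<And>i. i \<in> I \<Longrightarrow> \<alpha> i \<le> N"
  shows "cube_sum I Q \<alpha> x \<le> of_nat (card I) * N"
proof -
  have "cube_sum I Q \<alpha> x \<le> (\<Sum>i\<in>I. N)"
    unfolding cube_sum_def using assms by (intro sum_mono) (auto simp: indicator_def)
  then show ?thesis by simp
qed

lemma avg_Hoelder:
  assumes [measurable]: "f \<in> borel_measurable lebesgue" "g \<in> borel_measurable lebesgue"
    and pq: "1 < p" "1 < q" "1/p + 1/q = 1" and Q: "0 < snd Q"
  shows "avg (\<lambda>x. f x * g x) Q \<le> avg (\<lambda>x. f x epowr p) Q epowr (1/p) * avg (\<lambda>x. g x epowr q) Q epowr (1/q)"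
proof -
  define m where "m = emeasure lebesgue (cube Q)"
  obtain v where v: "0 < v" "m = ennreal v"
    using emeasure_cube_pos[OF Q] unfolding m_def[symmetric] by (cases m) (auto simp: less_le)
  have "(\<integral>\<^sup>+x\<in>cube Q. f x * g x \<partial>lebesgue) = (\<integral>\<^sup>+x. indicator (cube Q) x * (f x * g x) \<partial>lebesgue)"
    by (simp add: mult.commute)
  also have "\<dots> \<le> (\<integral>\<^sup>+x. indicator (cube Q) x * f x epowr p \<partial>lebesgue) epowr (1/p) *
      (\<integral>\<^sup>+x. indicator (cube Q) x * g x epowr q \<partial>lebesgue) epowr (1/q)"
    by (intro Hoelder_weighted pq) measurable
  also have "\<dots> = (avg (\<lambda>x. f x epowr p) Q * m) epowr (1/p) * (avg (\<lambda>x. g x epowr q) Q * m) epowr (1/q)"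
    unfolding m_def by (simp only: mult.commute[of "indicator _ _"] set_nn_integral_cube[OF Q])
  also have "\<dots> = (avg (\<lambda>x. f x epowr p) Q epowr (1/p) * avg (\<lambda>x. g x epowr q) Q epowr (1/q)) * (m epowr (1/p) * m epowr (1/q))"
    by (simp only: epowr_mult mult_ac)
  also have "m epowr (1/p) * m epowr (1/q) = m"
    unfolding epowr_add[symmetric] pq(3) by simp
  finally have *: "(\<integral>\<^sup>+x\<in>cube Q. f x * g x \<partial>lebesgue) \<le>
      (avg (\<lambda>x. f x epowr p) Q epowr (1/p) * avg (\<lambda>x. g x epowr q) Q epowr (1/q)) * m" .
  show ?thesis
    unfolding avg_def[of "\<lambda>x. f x * g x"] m_def[symmetric]
    using * v by (intro divide_le_posI_ennreal) (auto simp: mult.commute)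
qed

section \<open>From the space and its associate to a power\<close>

lemma cube_sum_epowr_le:
  assumes "finite I" "1 < r"
  shows "cube_sum I Q \<alpha> x \<le> cube_sum I Q (\<lambda>i. \<alpha> i epowr (1/r)) x epowr r"
proof -
  have "cube_sum I Q \<alpha> x = (\<Sum>i\<in>I. (\<alpha> i epowr (1/r) * indicator (cube (Q i)) x) epowr r)"
    using assms(2) unfolding cube_sum_def by (intro sum.cong) (auto simp: epowr_mult indicator_epowr)
  also have "\<dots> \<le> cube_sum I Q (\<lambda>i. \<alpha> i epowr (1/r)) x epowr r"
    unfolding cube_sum_def using assms by (intro epowr_sum_ge) auto
  finally show ?thesis .
qed

lemma ball_powerI: "(\<lambda>x. F x epowr (1/p)) \<in> B \<Longrightarrow> F \<in> borel_measurable lebesgue \<Longrightarrow> F \<in> ball_power B p"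
  by (simp add: ball_power_def)

lemma epowr_in_ball_power:
  assumes "normal_ball B" "F \<in> B" "0 < p"
  shows "(\<lambda>x. F x epowr p) \<in> ball_power B p"
proof (rule ball_powerI)
  have [measurable]: "F \<in> borel_measurable lebesgue" using assms normal_ballD(1) by blast
  show "(\<lambda>x. F x epowr p) \<in> borel_measurable lebesgue" by measurable
  show "(\<lambda>x. (F x epowr p) epowr (1/p)) \<in> B" using assms by simp
qed

text \<open>
  Boundedness on \<open>X\<close> and \<open>X'\<close> implies boundedness on \<open>(X\<^sup>r)'\<close>. After sparse domination it
  remains to bound \<open>J = \<integral>h g\<^sup>r\<close>, where \<open>g\<close> is a sparse sum of the \<open>r\<close>-averages of an element
  \<open>f\<^bsup>1/r\<^esup>\<close> of the ball of \<open>X\<close>. By Hoelder's inequality \<open>h g\<^bsup>r-1\<^esup>\<close> has norm at most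
  \<open>J\<^bsup>1/r'\<^esup>\<close> in \<open>X'\<close>, so sparseness bounds \<open>J\<close> by \<open>\<integral>M(f)\<^bsup>1/r\<^esup> M(h g\<^bsup>r-1\<^esup>) \<lesssim> J\<^bsup>1/r'\<^esup>\<close>; the
  first factor is controlled because the maximal operator on \<open>X\<close> improves itself.
\<close>

lemma ball_maximal_polar_power:
  fixes B :: "('a::euclidean_space \<Rightarrow> ennreal) set"
  assumes B: "normal_ball B" and conv: "convex_ball B" and M: "ball_maximal B" and M': "ball_maximal (polar B)"
    and b: "1 < b"
  shows "\<exists>r\<in>{1<..b}. ball_maximal (polar (ball_power B r))"
proof -
  have B_meas: "B \<subseteq> borel_measurable lebesgue" using normal_ballD(1)[OF B] by blast
  obtain r A where r: "1 < r" "r \<le> b" and A: "1 \<le> A"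
    and maj: "\<And>F. F \<in> B \<Longrightarrow> \<exists>w\<in>B. (\<forall>x. F x \<le> 2 * w x) \<and> (\<forall>x. hl_max w x \<le> ennreal A * w x) \<and>
           (\<forall>x. hl_max (\<lambda>y. w y epowr r) x \<le> ennreal A * w x epowr r)"
    using ball_maximal_A1_majorant[OF B conv M b] by blast
  obtain C where C: "0 < C" and CM: "\<And>G. G \<in> polar B \<Longrightarrow> (\<lambda>x. hl_max G x / ennreal C) \<in> polar B"
    using M' unfolding ball_maximal_def by blast
  define K where "K = 8 * A powr (1/r) * C"
  have K: "0 < K" using A C by (simp add: K_def)
  define C1 :: real where "C1 = 2 * 27 ^ DIM('a)"
  have C1: "0 < C1" by (simp add: C1_def)
  define P where "P = ball_power B r"
  have P_meas: "P \<subseteq> borel_measurable lebesgue" by (auto simp: P_def ball_power_def)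
  have P_normal: "normal_ball P" unfolding P_def using r by (intro normal_ball_power B) simp
  have polP: "normal_ball (polar P)" by (rule normal_ball_polar[OF P_meas])
  have conj: "1 < r / (r-1)" "1 / (r/(r-1)) + 1/r = 1" "1/r + 1/(r/(r-1)) = 1" "(r-1) * (r/(r-1)) = r"
    using r by (simp_all add: field_simps)
  have key: "(\<integral>\<^sup>+x. hl_max (trunc n h) x * trunc n f x \<partial>lebesgue) \<le> ennreal (C1 * K powr r)"
    if h0: "h \<in> polar P" and f0: "f \<in> P" for h f n
  proof (rule dense_le)
    fix c assume c: "c < (\<integral>\<^sup>+x. hl_max (trunc n h) x * trunc n f x \<partial>lebesgue)"
    define h' where "h' = trunc n h"
    define f' where "f' = trunc n f"
    have [measurable]: "h \<in> borel_measurable lebesgue" "f \<in> borel_measurable lebesgue"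
      using h0 f0 P_meas by (auto intro: polar_measurable)
    have [measurable]: "h' \<in> borel_measurable lebesgue" "f' \<in> borel_measurable lebesgue"
      unfolding h'_def f'_def by measurable
    have h': "h' \<in> polar P"
      unfolding h'_def by (rule normal_ball_mono[OF polP h0]) (simp_all add: trunc_le)
    have f': "f' \<in> P"
      unfolding f'_def by (rule normal_ball_mono[OF P_normal f0]) (simp_all add: trunc_le)
    have h'_le: "h' x \<le> ennreal (real n)" for x unfolding h'_def by (rule trunc_le)
    have c': "c < (\<integral>\<^sup>+x. hl_max h' x * f' x \<partial>lebesgue)" using c by (simp add: h'_def f'_def)
    obtain I :: "(int \<times> 'a \<times> real) set" and E where sp: "sparse_family I snd E"
      and c_le0: "c \<le> ennreal (2 * 27 ^ DIM('a)) * (\<integral>\<^sup>+x. h' x * cube_sum I snd (\<lambda>i. avg f' (tripled (snd i))) x \<partial>lebesgue)"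
      by (rule sparse_domination[OF \<open>h' \<in> borel_measurable lebesgue\<close> \<open>f' \<in> borel_measurable lebesgue\<close> h'_le c'])
        (rule that)
    note c_le = c_le0[folded C1_def]
    have finI: "finite I" and posI: "\<And>i. i \<in> I \<Longrightarrow> 0 < snd (snd i)"
      using sp by (auto simp: sparse_family_def)
    define \<alpha> where "\<alpha> i = avg f' (tripled (snd i))" for i :: "int \<times> 'a \<times> real"
    define g where "g = cube_sum I snd (\<lambda>i. \<alpha> i epowr (1/r))"
    have [measurable]: "g \<in> borel_measurable lebesgue" unfolding g_def by measurable
    define J where "J = (\<integral>\<^sup>+x. h' x * g x epowr r \<partial>lebesgue)"
    \<comment> \<open>The truncations make \<open>J\<close> finite, which the absorption at the end of the estimate requires.\<close>
    have J_fin: "J < top"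
    proof -
      define N where "N = of_nat (card I) * ennreal (real n) epowr (1/r)"
      have g_le: "g x \<le> N" for x
        unfolding g_def N_def
      proof (rule cube_sum_le)
        fix i assume i: "i \<in> I"
        have "\<alpha> i \<le> avg (\<lambda>_. ennreal (real n)) (tripled (snd i))"
          unfolding \<alpha>_def f'_def by (intro avg_mono trunc_le)
        also have "\<dots> = ennreal (real n)" using posI[OF i] by (intro avg_const) simp
        finally show "\<alpha> i epowr (1/r) \<le> ennreal (real n) epowr (1/r)" using r by (intro epowr_mono) auto
      qed
      have "J \<le> (\<integral>\<^sup>+x. (ennreal (real n) * N epowr r) * indicator (cbox (- (real n *\<^sub>R One)) (real n *\<^sub>R One)) x \<partial>(lebesgue :: 'a measure))"
        unfolding J_def
      proof (rule nn_integral_mono)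
        fix x :: 'a
        have "g x epowr r \<le> N epowr r" using g_le r by (intro epowr_mono) auto
        then show "h' x * g x epowr r \<le> (ennreal (real n) * N epowr r) * indicator (cbox (- (real n *\<^sub>R One)) (real n *\<^sub>R One)) x"
          by (auto simp: h'_def trunc_def indicator_def intro: mult_mono)
      qed
      also have "\<dots> = (ennreal (real n) * N epowr r) * emeasure lebesgue (cbox (- (real n *\<^sub>R One)) (real n *\<^sub>R One :: 'a))"
        by (rule nn_integral_cmult_indicator) simp
      also have "\<dots> < top"
        using emeasure_lborel_cbox_finite[of "- (real n *\<^sub>R One)" "real n *\<^sub>R One :: 'a"]
        by (simp add: N_def emeasure_completion ennreal_mult_less_top of_nat_less_top)
      finally show ?thesis .
    qed
    have J_le: "J \<le> ennreal K * J epowr (1 / (r/(r-1)))"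
    proof (cases "J = 0")
      case False
      define k where "k = enn2real (J epowr (1 / (r/(r-1))))"
      have k: "0 < k" "J epowr (1 / (r/(r-1))) = ennreal k"
        using False J_fin by (simp_all add: k_def enn2real_positive_iff zero_less_iff_neq_zero)
      define v where "v x = h' x * g x epowr (r-1)" for x
      have [measurable]: "v \<in> borel_measurable lebesgue" unfolding v_def by measurable
      have "(\<integral>\<^sup>+x. F x * v x \<partial>lebesgue) \<le> ennreal k" if F: "F \<in> B" for F
      proof -
        have [measurable]: "F \<in> borel_measurable lebesgue" using F B_meas by blast
        have "(\<integral>\<^sup>+x. F x epowr r * h' x \<partial>lebesgue) \<le> 1"
          using epowr_in_ball_power[OF B F, of r] r by (intro polarD[OF h']) (simp add: P_def)
        then have 1: "(\<integral>\<^sup>+x. h' x * F x epowr r \<partial>lebesgue) epowr (1/r) \<le> 1 epowr (1/r)"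
          using r by (intro epowr_mono) (auto simp: mult.commute)
        have "(\<integral>\<^sup>+x. F x * v x \<partial>lebesgue) = (\<integral>\<^sup>+x. h' x * (g x epowr (r-1) * F x) \<partial>lebesgue)"
          by (simp add: v_def mult_ac)
        also have "\<dots> \<le> (\<integral>\<^sup>+x. h' x * (g x epowr (r-1)) epowr (r/(r-1)) \<partial>lebesgue) epowr (1 / (r/(r-1))) *
            (\<integral>\<^sup>+x. h' x * F x epowr r \<partial>lebesgue) epowr (1/r)"
          by (intro Hoelder_weighted conj r) measurable
        also have "(\<integral>\<^sup>+x. h' x * (g x epowr (r-1)) epowr (r/(r-1)) \<partial>lebesgue) = J"
          unfolding epowr_epowr conj(4) J_def ..
        also have "J epowr (1 / (r/(r-1))) * (\<integral>\<^sup>+x. h' x * F x epowr r \<partial>lebesgue) epowr (1/r) \<le> ennreal k * 1"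
          using 1 unfolding k(2) by (intro mult_left_mono) simp_all
        finally show ?thesis by simp
      qed
      then have "(\<lambda>x. v x / ennreal k) \<in> polar B"
        using divide_in_polar_iff[OF B_meas _ k(1), of v] by simp
      then have "(\<lambda>x. hl_max (\<lambda>y. v y / ennreal k) x / ennreal C) \<in> polar B" by (rule CM)
      then have Mv: "(\<integral>\<^sup>+x. F x * hl_max (\<lambda>y. v y / ennreal k) x \<partial>lebesgue) \<le> ennreal C" if "F \<in> B" for F
        using divide_in_polar_iff[OF B_meas measurable_hl_max C, THEN iffD1] that by simp
      have v_eq: "v x = ennreal k * (v x / ennreal k)" for x
        using k(1) by (simp add: ennreal_times_divide mult_divide_eq_ennreal mult.commute[of "ennreal k"])
      have Mv_eq: "hl_max v x = ennreal k * hl_max (\<lambda>y. v y / ennreal k) x" for x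
      proof -
        have "hl_max v x = hl_max (\<lambda>y. ennreal k * (v y / ennreal k)) x"
          by (rule arg_cong[where f = "\<lambda>V. hl_max V x"]) (rule ext, rule v_eq)
        also have "\<dots> = ennreal k * hl_max (\<lambda>y. v y / ennreal k) x"
          by (rule hl_max_cmult) measurable
        finally show ?thesis .
      qed
      have "(\<lambda>x. f' x epowr (1/r)) \<in> B" using f' by (simp add: P_def ball_power_def)
      then obtain w where w: "w \<in> B" "\<And>x. f' x epowr (1/r) \<le> 2 * w x"
          "\<And>x. hl_max (\<lambda>y. w y epowr r) x \<le> ennreal A * w x epowr r"
        using maj by blast
      have [measurable]: "w \<in> borel_measurable lebesgue" using w(1) B_meas by blast
      have Mf: "hl_max f' x epowr (1/r) \<le> ennreal (2 * A powr (1/r)) * w x" for x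
      proof -
        have "f' y \<le> ennreal (2 powr r) * w y epowr r" for y
        proof -
          have "(f' y epowr (1/r)) epowr r \<le> (ennreal 2 * w y) epowr r"
            using w(2)[of y] r by (intro epowr_mono) auto
          then show ?thesis using r by (simp add: epowr_mult epowr_ennreal del: ennreal_numeral)
        qed
        then have "hl_max f' x \<le> hl_max (\<lambda>y. ennreal (2 powr r) * w y epowr r) x" by (rule hl_max_mono)
        also have "\<dots> = ennreal (2 powr r) * hl_max (\<lambda>y. w y epowr r) x"
          by (rule hl_max_cmult) measurable
        also have "\<dots> \<le> ennreal (2 powr r) * (ennreal A * w x epowr r)"
          by (intro mult_left_mono w(3)) simp
        finally have "hl_max f' x epowr (1/r) \<le> (ennreal (2 powr r) * (ennreal A * w x epowr r)) epowr (1/r)"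
          using r by (intro epowr_mono) auto
        also have "\<dots> = ennreal (2 * A powr (1/r)) * w x"
          using r A by (simp add: epowr_mult epowr_ennreal powr_powr ennreal_mult mult.assoc)
        finally show ?thesis .
      qed
      have "J = (\<integral>\<^sup>+x. cube_sum I snd (\<lambda>i. \<alpha> i epowr (1/r)) x * v x \<partial>lebesgue)"
        using epowr_add[of "g _" 1 "r-1"] by (simp add: J_def v_def g_def[symmetric] mult_ac)
      also have "\<dots> \<le> 4 * (\<integral>\<^sup>+x. ennreal (2 * A powr (1/r)) * w x * hl_max v x \<partial>lebesgue)"
      proof (rule sparse_family_nn_integral_le[OF sp])
        fix i x assume i: "i \<in> I" and x: "x \<in> cube (snd i)"
        have "x \<in> cube (tripled (snd i))" using x cube_subset_own_tripled[OF posI[OF i]] by blast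
        then have "\<alpha> i \<le> hl_max f' x" using posI[OF i] unfolding \<alpha>_def by (intro avg_le_hl_max) auto
        then have "\<alpha> i epowr (1/r) \<le> hl_max f' x epowr (1/r)" using r by (intro epowr_mono) auto
        also note Mf
        finally show "\<alpha> i epowr (1/r) * avg v (snd i) \<le> ennreal (2 * A powr (1/r)) * w x * hl_max v x"
          using posI[OF i] x by (intro mult_mono avg_le_hl_max) auto
      qed measurable
      also have "(\<integral>\<^sup>+x. ennreal (2 * A powr (1/r)) * w x * hl_max v x \<partial>lebesgue) =
          (\<integral>\<^sup>+x. ennreal (2 * A powr (1/r)) * ennreal k * (w x * hl_max (\<lambda>y. v y / ennreal k) x) \<partial>lebesgue)"
        unfolding Mv_eq by (simp only: mult_ac)
      also have "\<dots> = ennreal (2 * A powr (1/r)) * ennreal k * (\<integral>\<^sup>+x. w x * hl_max (\<lambda>y. v y / ennreal k) x \<partial>lebesgue)"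
        by (rule nn_integral_cmult) measurable
      also have "4 * (ennreal (2 * A powr (1/r)) * ennreal k * (\<integral>\<^sup>+x. w x * hl_max (\<lambda>y. v y / ennreal k) x \<partial>lebesgue)) \<le>
          ennreal 4 * (ennreal (2 * A powr (1/r)) * ennreal k * ennreal C)"
        by (simp only: ennreal_numeral) (intro mult_left_mono Mv w(1) zero_le)
      also have "\<dots> = ennreal K * ennreal k"
        using k(1) C by (simp add: ennreal_mult[symmetric] K_def del: ennreal_numeral)
      finally show ?thesis unfolding k(2) .
    qed simp
    have "J \<le> ennreal K epowr r"
      by (rule absorb_epowr[OF J_le J_fin r(1) conj(3)])
    then have J_bound: "J \<le> ennreal (K powr r)" using K by (simp add: epowr_ennreal)
    have "(\<integral>\<^sup>+x. h' x * cube_sum I snd \<alpha> x \<partial>lebesgue) \<le> J"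
      unfolding J_def g_def by (intro nn_integral_mono mult_left_mono cube_sum_epowr_le finI r) auto
    then have "c \<le> ennreal C1 * ennreal (K powr r)"
      using J_bound unfolding \<alpha>_def by (intro order_trans[OF c_le] mult_left_mono) auto
    then show "c \<le> ennreal (C1 * K powr r)" using C1 by (simp add: ennreal_mult)
  qed
  have "ball_maximal (polar P)"
    unfolding ball_maximal_def
  proof (intro exI conjI ballI)
    show "0 < C1 * K powr r" using C1 K by simp
    then have pos: "0 < C1 * K powr r" .
    fix h assume h: "h \<in> polar P"
    have "(\<integral>\<^sup>+x. f x * hl_max h x \<partial>lebesgue) \<le> ennreal (C1 * K powr r)" if f: "f \<in> P" for f
      using hl_max_pairing_trunc_le[OF polar_measurable[OF h] _ key[OF h f]] f P_meas by (auto simp: mult.commute)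
    then show "(\<lambda>x. hl_max h x / ennreal (C1 * K powr r)) \<in> polar P"
      using divide_in_polar_iff[OF P_meas measurable_hl_max pos] by blast
  qed
  then show ?thesis using r by (auto simp: P_def)
qed

text \<open>
  Conversely, the Fefferman--Stein inequality tested against the elements of \<open>(X\<^sup>r)'\<close>
  bounds \<open>M(f)\<^sup>r\<close> in \<open>(X\<^sup>r)''\<close>, which is \<open>X\<^sup>r\<close>.
\<close>

lemma ball_maximal_if_polar_power:
  fixes B :: "('a::euclidean_space \<Rightarrow> ennreal) set"
  assumes B: "normal_ball B" and r: "1 < r" and conv: "convex_ball (ball_power B r)"
    and M: "ball_maximal (polar (ball_power B r))"
  shows "ball_maximal B"
proof -
  define P where "P = ball_power B r"
  have P_meas: "P \<subseteq> borel_measurable lebesgue" by (auto simp: P_def ball_power_def)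
  have P_normal: "normal_ball P" unfolding P_def using r by (intro normal_ball_power B) simp
  obtain C where C: "0 < C" and CM: "\<And>G. G \<in> polar P \<Longrightarrow> (\<lambda>x. hl_max G x / ennreal C) \<in> polar P"
    using M unfolding ball_maximal_def P_def by blast
  obtain C2 where C2: "0 < C2" and FS: "\<And>(f::'a \<Rightarrow> ennreal) h. f \<in> borel_measurable lebesgue \<Longrightarrow> h \<in> borel_measurable lebesgue \<Longrightarrow>
    (\<integral>\<^sup>+x. hl_max f x epowr r * h x \<partial>lebesgue) \<le> ennreal C2 * (\<integral>\<^sup>+x. f x epowr r * hl_max h x \<partial>lebesgue)"
    using Fefferman_Stein[OF r, where ?'a = 'a] by blast
  show ?thesis
    unfolding ball_maximal_def
  proof (intro exI conjI ballI)
    show "0 < (C2 * C) powr (1/r)" using C C2 by simp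
    fix f assume f: "f \<in> B"
    have f_meas: "f \<in> borel_measurable lebesgue" using f normal_ballD(1)[OF B] by blast
    have fr: "(\<lambda>x. f x epowr r) \<in> P" unfolding P_def using r by (intro epowr_in_ball_power B f) simp
    have "(\<integral>\<^sup>+x. h x * hl_max f x epowr r \<partial>lebesgue) \<le> ennreal (C2 * C)" if h: "h \<in> polar P" for h
    proof -
      have "(\<integral>\<^sup>+x. f x epowr r * hl_max h x \<partial>lebesgue) \<le> ennreal C"
        by (rule divide_in_polar_iff[OF P_meas measurable_hl_max C, THEN iffD1, OF CM[OF h], rule_format, OF fr])
      then have "ennreal C2 * (\<integral>\<^sup>+x. f x epowr r * hl_max h x \<partial>lebesgue) \<le> ennreal C2 * ennreal C"
        by (rule mult_left_mono) simp
      then show ?thesis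
        using FS[OF f_meas polar_measurable[OF h]] C C2 by (simp add: mult.commute ennreal_mult order_trans)
    qed
    then have "(\<lambda>x. hl_max f x epowr r / ennreal (C2 * C)) \<in> polar (polar P)"
      using C C2 by (subst divide_in_polar_iff) (auto simp: polar_def)
    then have "(\<lambda>x. hl_max f x epowr r / ennreal (C2 * C)) \<in> P"
      unfolding bipolar_eq[OF P_normal conv[folded P_def]] .
    then have "(\<lambda>x. (hl_max f x epowr r / ennreal (C2 * C)) epowr (1/r)) \<in> B"
      by (simp add: P_def ball_power_def)
    then show "(\<lambda>x. hl_max f x / ennreal ((C2 * C) powr (1/r))) \<in> B"
      using C C2 r by (simp add: epowr_divide)
  qed
qed

section \<open>From a power to the space and its associate\<close>

text \<open>
  A sparse operator is bounded on \<open>L\<^sup>r(w)\<close> for an \<open>A\<^sub>1\<close> weight \<open>w\<close> that satisfies a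
  reverse Hoelder inequality. With \<open>g\<close> the sparse sum, write \<open>J = \<integral>g\<^sup>r w = \<integral>g v\<close>, where
  \<open>v = (g\<^bsup>r-1\<^esup>w\<^bsup>1/r'\<^esup>) w\<^bsup>1/r\<^esup>\<close>. Hoelder's inequality on each cube, with exponent \<open>pr\<close> on
  \<open>w\<^bsup>1/r\<^esup>\<close>, leaves on the first factor an exponent smaller than \<open>r'\<close>, for which the
  maximal theorem is available. The bounds on \<open>u\<close> and \<open>w\<close> make \<open>J\<close> finite and do not enter
  the constant.
\<close>

lemma sparse_operator_A1_bound:
  fixes u w :: "'a::euclidean_space \<Rightarrow> ennreal"
  assumes r: "1 < r" and p: "1 < p" and A: "1 \<le> A"
    and FS: "\<And>(f::'a \<Rightarrow> ennreal) h. f \<in> borel_measurable lebesgue \<Longrightarrow> h \<in> borel_measurable lebesgue \<Longrightarrow>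
      (\<integral>\<^sup>+x. hl_max f x epowr r * h x \<partial>lebesgue) \<le> ennreal C2 * (\<integral>\<^sup>+x. f x epowr r * hl_max h x \<partial>lebesgue)"
    and HL: "\<And>f::'a \<Rightarrow> ennreal. f \<in> borel_measurable lebesgue \<Longrightarrow>
      (\<integral>\<^sup>+x. hl_max f x epowr ((p * r - 1) / (p * (r - 1))) \<partial>lebesgue) \<le>
        ennreal C3 * (\<integral>\<^sup>+x. f x epowr ((p * r - 1) / (p * (r - 1))) \<partial>lebesgue)"
    and C: "0 < C2" "0 < C3"
    and sp: "sparse_family I snd E"
    and u_meas[measurable]: "u \<in> borel_measurable lebesgue" and u_le: "\<And>x. u x \<le> ennreal m"
    and w_meas[measurable]: "w \<in> borel_measurable lebesgue" and w_le: "\<And>x. w x \<le> ennreal n"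
    and w_A1: "\<And>x. hl_max w x \<le> ennreal A * w x"
    and w_RH: "\<And>x. hl_max (\<lambda>y. w y epowr p) x \<le> ennreal A * w x epowr p"
    and uw: "(\<integral>\<^sup>+x. u x epowr r * w x \<partial>lebesgue) \<le> 1"
  shows "(\<integral>\<^sup>+x. w x * cube_sum I snd (\<lambda>i. avg u (tripled (snd i))) x epowr r \<partial>lebesgue) \<le>
    ennreal ((4 * A powr (1/(p*r)) * (C2 * A) powr (1/r) * C3 powr ((r-1)/r)) powr r)"
proof -
  have finI: "finite I" and posI: "\<And>i. i \<in> I \<Longrightarrow> 0 < snd (snd i)"
    using sp by (auto simp: sparse_family_def)
  define \<alpha> where "\<alpha> i = avg u (tripled (snd i))" for i :: "'b \<times> 'a \<times> real"
  define g where "g = cube_sum I snd \<alpha>"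
  have [measurable]: "g \<in> borel_measurable lebesgue" unfolding g_def by measurable
  define J where "J = (\<integral>\<^sup>+x. w x * g x epowr r \<partial>lebesgue)"
  have J_fin: "J < top"
  proof -
    define N where "N = of_nat (card I) * ennreal m"
    have g_le: "g x \<le> N" for x
      unfolding g_def N_def
    proof (rule cube_sum_le)
      fix i assume i: "i \<in> I"
      have "\<alpha> i \<le> avg (\<lambda>_. ennreal m) (tripled (snd i))"
        unfolding \<alpha>_def by (intro avg_mono u_le)
      also have "\<dots> = ennreal m" using posI[OF i] by (intro avg_const) simp
      finally show "\<alpha> i \<le> ennreal m" .
    qed
    have "J \<le> (\<integral>\<^sup>+x. (\<Sum>i\<in>I. (ennreal n * N epowr r) * indicator (cube (snd i)) x) \<partial>lebesgue)"
      unfolding J_def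
    proof (rule nn_integral_mono)
      fix x :: 'a
      show "w x * g x epowr r \<le> (\<Sum>i\<in>I. (ennreal n * N epowr r) * indicator (cube (snd i)) x)"
      proof (cases "\<exists>i\<in>I. x \<in> cube (snd i)")
        case True
        then obtain i where i: "i \<in> I" "x \<in> cube (snd i)" by blast
        have "w x * g x epowr r \<le> ennreal n * N epowr r"
          using g_le r by (intro mult_mono w_le epowr_mono) auto
        also have "\<dots> = (ennreal n * N epowr r) * indicator (cube (snd i)) x" using i(2) by simp
        also have "\<dots> \<le> (\<Sum>i\<in>I. (ennreal n * N epowr r) * indicator (cube (snd i)) x)"
          using i(1) finI by (intro member_le_sum) auto
        finally show ?thesis .
      next
        case False
        then have "g x = 0" unfolding g_def cube_sum_def by (intro sum.neutral) auto
        then show ?thesis by simp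
      qed
    qed
    also have "\<dots> = (\<Sum>i\<in>I. (ennreal n * N epowr r) * emeasure lebesgue (cube (snd i)))"
      by (subst nn_integral_sum) (simp_all add: nn_integral_cmult)
    also have "\<dots> < top"
      using emeasure_cube_pos(2)[OF posI] finI
      by (simp add: N_def ennreal_mult_less_top of_nat_less_top)
    finally show ?thesis .
  qed
  define a where "a = p * r"
  define a' where "a' = a / (a - 1)"
  define r' where "r' = r / (r - 1)"
  define s where "s = (p * r - 1) / (p * (r - 1))"
  have pr: "1 < p * r" using less_1_mult[OF p r] .
  have a1: "1 < a" using pr by (simp add: a_def)
  have a: "1 < a" "1 < a'" "1/a' + 1/a = 1" using a1 by (simp_all add: a'_def field_simps)
  have r': "1 < r'" "1/r + 1/r' = 1" "(r-1) * r' = r" "1/r' = (r-1)/r" using r by (simp_all add: r'_def field_simps)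
  have s: "1/a' * r' = s" "a' * s = r'" "0 < s"
  proof -
    have "s = (a - 1) / a * (r / (r - 1))" using p r by (simp add: s_def a_def)
    then show "1/a' * r' = s" by (simp add: a'_def r'_def)
    then have "a' * s = a' * (1/a' * r')" by simp
    then show "a' * s = r'" using a(2) by simp
    show "0 < s" using pr p r by (simp add: s_def)
  qed
  define Z where "Z x = (g x epowr (r-1) * w x epowr (1/r')) epowr a'" for x
  have [measurable]: "Z \<in> borel_measurable lebesgue" unfolding Z_def by measurable
  define v where "v x = w x * g x epowr (r-1)" for x
  have [measurable]: "v \<in> borel_measurable lebesgue" unfolding v_def by measurable
  have v_eq: "v x = (g x epowr (r-1) * w x epowr (1/r')) * w x epowr (1/r)" for x
    using epowr_add[of "w x" "1/r" "1/r'"] r'(2) by (simp add: v_def mult_ac)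
  define G where "G x = ennreal (A powr (1/a)) * ((hl_max u x * w x epowr (1/r)) * hl_max Z x epowr (1/a'))" for x
  have [measurable]: "G \<in> borel_measurable lebesgue" unfolding G_def by measurable
  have "J = (\<integral>\<^sup>+x. cube_sum I snd \<alpha> x * v x \<partial>lebesgue)"
    using epowr_add[of "g _" 1 "r-1"] by (simp add: J_def v_def g_def[symmetric] mult_ac)
  also have "\<dots> \<le> 4 * (\<integral>\<^sup>+x. G x \<partial>lebesgue)"
  proof (rule sparse_family_nn_integral_le[OF sp])
    fix i x assume i: "i \<in> I" and x: "x \<in> cube (snd i)"
    note q = posI[OF i]
    have "x \<in> cube (tripled (snd i))" using x cube_subset_own_tripled[OF q] by blast
    then have \<alpha>_le: "\<alpha> i \<le> hl_max u x" using q unfolding \<alpha>_def by (intro avg_le_hl_max) auto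
    have "avg v (snd i) \<le> avg Z (snd i) epowr (1/a') * avg (\<lambda>x. (w x epowr (1/r)) epowr a) (snd i) epowr (1/a)"
      unfolding v_eq Z_def by (intro avg_Hoelder a q) measurable
    also have "(\<lambda>x. (w x epowr (1/r)) epowr a) = (\<lambda>x. w x epowr p)" using r by (simp add: a_def)
    also have "avg Z (snd i) epowr (1/a') * avg (\<lambda>x. w x epowr p) (snd i) epowr (1/a) \<le>
        hl_max Z x epowr (1/a') * (ennreal A * w x epowr p) epowr (1/a)"
      using a q x by (intro mult_mono epowr_mono avg_le_hl_max order_trans[OF avg_le_hl_max w_RH]) auto
    also have "(ennreal A * w x epowr p) epowr (1/a) = ennreal (A powr (1/a)) * w x epowr (1/r)"
      using A p r by (simp add: epowr_mult epowr_ennreal a_def)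
    finally have "\<alpha> i * avg v (snd i) \<le> hl_max u x * (hl_max Z x epowr (1/a') * (ennreal (A powr (1/a)) * w x epowr (1/r)))"
      using \<alpha>_le by (intro mult_mono) auto
    then show "\<alpha> i * avg v (snd i) \<le> G x" by (simp only: G_def mult_ac)
  qed measurable
  also have "(\<integral>\<^sup>+x. G x \<partial>lebesgue) = ennreal (A powr (1/a)) *
      (\<integral>\<^sup>+x. (hl_max u x * w x epowr (1/r)) * hl_max Z x epowr (1/a') \<partial>lebesgue)"
    unfolding G_def by (rule nn_integral_cmult) measurable
  also have "4 * (ennreal (A powr (1/a)) * (\<integral>\<^sup>+x. (hl_max u x * w x epowr (1/r)) * hl_max Z x epowr (1/a') \<partial>lebesgue)) \<le>
    4 * (ennreal (A powr (1/a)) * (ennreal ((C2 * A) powr (1/r)) * (ennreal (C3 powr (1/r')) * J epowr (1/r'))))"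
  proof (intro mult_left_mono zero_le)
    have "(\<integral>\<^sup>+x. (hl_max u x * w x epowr (1/r)) * hl_max Z x epowr (1/a') \<partial>lebesgue) \<le>
      (\<integral>\<^sup>+x. (hl_max u x * w x epowr (1/r)) epowr r \<partial>lebesgue) epowr (1/r) *
      (\<integral>\<^sup>+x. (hl_max Z x epowr (1/a')) epowr r' \<partial>lebesgue) epowr (1/r')"
      by (intro Hoelder_nn_integral r r') measurable
    also have "(\<integral>\<^sup>+x. (hl_max u x * w x epowr (1/r)) epowr r \<partial>lebesgue) = (\<integral>\<^sup>+x. hl_max u x epowr r * w x \<partial>lebesgue)"
      using r by (simp add: epowr_mult)
    also have "(\<integral>\<^sup>+x. (hl_max Z x epowr (1/a')) epowr r' \<partial>lebesgue) = (\<integral>\<^sup>+x. hl_max Z x epowr s \<partial>lebesgue)"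
      unfolding epowr_epowr s(1) ..
    also have "(\<integral>\<^sup>+x. hl_max u x epowr r * w x \<partial>lebesgue) epowr (1/r) * (\<integral>\<^sup>+x. hl_max Z x epowr s \<partial>lebesgue) epowr (1/r') \<le>
      ennreal (C2 * A) epowr (1/r) * (ennreal C3 * J) epowr (1/r')"
    proof (intro mult_mono epowr_mono)
      have "(\<integral>\<^sup>+x. hl_max u x epowr r * w x \<partial>lebesgue) \<le> ennreal C2 * (\<integral>\<^sup>+x. u x epowr r * hl_max w x \<partial>lebesgue)"
        by (rule FS[OF u_meas w_meas])
      also have "\<dots> \<le> ennreal C2 * (\<integral>\<^sup>+x. ennreal A * (u x epowr r * w x) \<partial>lebesgue)"
        unfolding mult.left_commute[of "ennreal A"] by (intro mult_left_mono nn_integral_mono w_A1) auto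
      also have "(\<integral>\<^sup>+x. ennreal A * (u x epowr r * w x) \<partial>lebesgue) = ennreal A * (\<integral>\<^sup>+x. u x epowr r * w x \<partial>lebesgue)"
        by (rule nn_integral_cmult) measurable
      also have "ennreal C2 * (ennreal A * (\<integral>\<^sup>+x. u x epowr r * w x \<partial>lebesgue)) \<le> ennreal C2 * (ennreal A * 1)"
        by (intro mult_left_mono uw) auto
      finally show "(\<integral>\<^sup>+x. hl_max u x epowr r * w x \<partial>lebesgue) \<le> ennreal (C2 * A)"
        using A C by (simp add: ennreal_mult)
      have "(\<integral>\<^sup>+x. hl_max Z x epowr s \<partial>lebesgue) \<le> ennreal C3 * (\<integral>\<^sup>+x. Z x epowr s \<partial>lebesgue)"
        unfolding s_def by (rule HL) measurable
      also have "(\<integral>\<^sup>+x. Z x epowr s \<partial>lebesgue) = J"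
        unfolding J_def Z_def epowr_epowr s(2) using r'(1)
        by (simp add: epowr_mult r'(3) mult.commute[of "g _ epowr r"])
      finally show "(\<integral>\<^sup>+x. hl_max Z x epowr s \<partial>lebesgue) \<le> ennreal C3 * J" .
    qed (use r r' in auto)
    also have "\<dots> = ennreal ((C2 * A) powr (1/r)) * (ennreal (C3 powr (1/r')) * J epowr (1/r'))"
      using A C by (simp add: epowr_mult epowr_ennreal)
    finally show "(\<integral>\<^sup>+x. (hl_max u x * w x epowr (1/r)) * hl_max Z x epowr (1/a') \<partial>lebesgue) \<le> \<dots>" .
  qed
  also have "4 * (ennreal (A powr (1/a)) * (ennreal ((C2 * A) powr (1/r)) * (ennreal (C3 powr (1/r')) * J epowr (1/r')))) =
     ennreal 4 * ennreal (A powr (1/a)) * ennreal ((C2 * A) powr (1/r)) * ennreal (C3 powr (1/r')) * J epowr (1/r')"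
    by (simp only: mult.assoc ennreal_numeral)
  also have "ennreal 4 * ennreal (A powr (1/a)) * ennreal ((C2 * A) powr (1/r)) * ennreal (C3 powr (1/r')) =
      ennreal (4 * A powr (1/a) * (C2 * A) powr (1/r) * C3 powr (1/r'))"
    by (simp add: ennreal_mult del: ennreal_numeral)
  finally have "J \<le> ennreal (4 * A powr (1/a) * (C2 * A) powr (1/r) * C3 powr (1/r')) epowr r"
    by (rule absorb_epowr[OF _ J_fin r r'(2)])
  then show ?thesis
    unfolding J_def g_def \<alpha>_def a_def r'(4) by (simp add: epowr_ennreal)
qed

text \<open>
  Boundedness on \<open>(X\<^sup>r)'\<close> implies boundedness on \<open>X'\<close>. By sparse domination and duality it
  suffices that sparse operators are bounded on \<open>X\<close>; as \<open>X\<^sup>r = (X\<^sup>r)''\<close>, this follows from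
  their boundedness on \<open>L\<^sup>r(w)\<close> for \<open>A\<^sub>1\<close> majorants \<open>w\<close> of the elements of \<open>(X\<^sup>r)'\<close>.
\<close>

lemma ball_maximal_polar_if_polar_power:
  fixes B :: "('a::euclidean_space \<Rightarrow> ennreal) set"
  assumes B: "normal_ball B" and r: "1 < r" and conv: "convex_ball (ball_power B r)"
    and M: "ball_maximal (polar (ball_power B r))"
  shows "ball_maximal (polar B)"
proof -
  have B_meas: "B \<subseteq> borel_measurable lebesgue" using normal_ballD(1)[OF B] by blast
  define P where "P = ball_power B r"
  have P_meas: "P \<subseteq> borel_measurable lebesgue" by (auto simp: P_def ball_power_def)
  have P_normal: "normal_ball P" unfolding P_def using r by (intro normal_ball_power B) simp
  have polP: "normal_ball (polar P)" "convex_ball (polar P)"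
    using normal_ball_polar[OF P_meas] convex_ball_polar[OF P_meas] .
  have polP_meas: "polar P \<subseteq> borel_measurable lebesgue" by (auto simp: polar_def)
  have polB: "normal_ball (polar B)" by (rule normal_ball_polar[OF B_meas])
  have two: "1 < (2::real)" by simp
  obtain p A where p: "1 < p" and "p \<le> 2" and A: "1 \<le> A"
    and maj: "\<And>F. F \<in> polar P \<Longrightarrow> \<exists>w\<in>polar P. (\<forall>x. F x \<le> 2 * w x) \<and> (\<forall>x. hl_max w x \<le> ennreal A * w x) \<and>
           (\<forall>x. hl_max (\<lambda>y. w y epowr p) x \<le> ennreal A * w x epowr p)"
    by (rule ball_maximal_A1_majorant[OF polP M[folded P_def] two]) (rule that)
  obtain C2 where C2: "0 < C2" and FS: "\<And>(f::'a \<Rightarrow> ennreal) h. f \<in> borel_measurable lebesgue \<Longrightarrow> h \<in> borel_measurable lebesgue \<Longrightarrow>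
    (\<integral>\<^sup>+x. hl_max f x epowr r * h x \<partial>lebesgue) \<le> ennreal C2 * (\<integral>\<^sup>+x. f x epowr r * hl_max h x \<partial>lebesgue)"
    using Fefferman_Stein[OF r, where ?'a = 'a] by blast
  define s where "s = (p * r - 1) / (p * (r - 1))"
  have s: "1 < s"
  proof -
    have "p * (r - 1) < p * r - 1" using p by (simp add: right_diff_distrib)
    moreover have "0 < p * (r - 1)" using p r by simp
    ultimately show ?thesis unfolding s_def by (simp only: less_divide_eq_1_pos)
  qed
  obtain C3 where C3: "0 < C3" and FS3: "\<And>(f::'a \<Rightarrow> ennreal) h. f \<in> borel_measurable lebesgue \<Longrightarrow> h \<in> borel_measurable lebesgue \<Longrightarrow>
    (\<integral>\<^sup>+x. hl_max f x epowr s * h x \<partial>lebesgue) \<le> ennreal C3 * (\<integral>\<^sup>+x. f x epowr s * hl_max h x \<partial>lebesgue)"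
    using Fefferman_Stein[OF s, where ?'a = 'a] by blast
  have HL: "(\<integral>\<^sup>+x. hl_max f x epowr s \<partial>lebesgue) \<le> ennreal C3 * (\<integral>\<^sup>+x. f x epowr s \<partial>lebesgue)"
    if [measurable]: "f \<in> borel_measurable lebesgue" for f :: "'a \<Rightarrow> ennreal"
  proof -
    have "(\<integral>\<^sup>+x. hl_max f x epowr s * 1 \<partial>lebesgue) \<le> ennreal C3 * (\<integral>\<^sup>+x. f x epowr s * hl_max (\<lambda>_. 1) x \<partial>lebesgue)"
      by (rule FS3) auto
    also have "\<dots> \<le> ennreal C3 * (\<integral>\<^sup>+x. f x epowr s * 1 \<partial>lebesgue)"
      by (intro mult_left_mono nn_integral_mono hl_max_const_le) auto
    finally show ?thesis by simp
  qed
  define L where "L = 2 * (4 * A powr (1/(p*r)) * (C2 * A) powr (1/r) * C3 powr ((r-1)/r)) powr r"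
  have L: "0 < L" using A C2 C3 by (simp add: L_def)
  define C1 where "C1 = 2 * 27 ^ DIM('a) * L powr (1/r)"
  have C1: "0 < C1" using L by (simp add: C1_def)
  have key: "(\<integral>\<^sup>+x. hl_max (trunc n h) x * trunc n u x \<partial>lebesgue) \<le> ennreal C1"
    if h0: "h \<in> polar B" and u0: "u \<in> B" for h u n
  proof (rule dense_le)
    fix c assume c: "c < (\<integral>\<^sup>+x. hl_max (trunc n h) x * trunc n u x \<partial>lebesgue)"
    define h' where "h' = trunc n h"
    define u' where "u' = trunc n u"
    have [measurable]: "h \<in> borel_measurable lebesgue" "u \<in> borel_measurable lebesgue"
      using h0 u0 B_meas by (auto intro: polar_measurable)
    have meas[measurable]: "h' \<in> borel_measurable lebesgue" "u' \<in> borel_measurable lebesgue"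
      unfolding h'_def u'_def by measurable
    have h': "h' \<in> polar B"
      unfolding h'_def by (rule normal_ball_mono[OF polB h0]) (simp_all add: trunc_le)
    have u': "u' \<in> B"
      unfolding u'_def by (rule normal_ball_mono[OF B u0]) (simp_all add: trunc_le)
    have h'_le: "h' x \<le> ennreal (real n)" and u'_le: "u' x \<le> ennreal (real n)" for x
      unfolding h'_def u'_def by (rule trunc_le)+
    have c': "c < (\<integral>\<^sup>+x. hl_max h' x * u' x \<partial>lebesgue)" using c by (simp add: h'_def u'_def)
    obtain I :: "(int \<times> 'a \<times> real) set" and E where sp: "sparse_family I snd E"
      and c_le: "c \<le> ennreal (2 * 27 ^ DIM('a)) * (\<integral>\<^sup>+x. h' x * cube_sum I snd (\<lambda>i. avg u' (tripled (snd i))) x \<partial>lebesgue)"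
      by (rule sparse_domination[OF meas h'_le c']) (rule that)
    define g where "g = cube_sum I snd (\<lambda>i. avg u' (tripled (snd i)))"
    have [measurable]: "g \<in> borel_measurable lebesgue" unfolding g_def by measurable
    have u'_P: "(\<lambda>x. u' x epowr r) \<in> P" unfolding P_def using r by (intro epowr_in_ball_power B u') simp
    have "(\<integral>\<^sup>+x. H x * g x epowr r \<partial>lebesgue) \<le> ennreal L" if H: "H \<in> polar P" for H
    proof -
      obtain w where w: "w \<in> polar P" "\<And>x. H x \<le> 2 * w x" "\<And>x. hl_max w x \<le> ennreal A * w x"
          "\<And>x. hl_max (\<lambda>y. w y epowr p) x \<le> ennreal A * w x epowr p"
        using maj[OF H] by blast
      have [measurable]: "w \<in> borel_measurable lebesgue" using w(1) by (rule polar_measurable)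
      \<comment> \<open>Truncation in height preserves the \<open>A\<^sub>1\<close> condition and the reverse Hoelder bound, because \<open>A \<ge> 1\<close>.\<close>
      define W where "W k x = min (w x) (ennreal (real k))" for k :: nat and x
      have W_meas[measurable]: "W k \<in> borel_measurable lebesgue" for k unfolding W_def by measurable
      have W_le: "W k x \<le> w x" "W k x \<le> ennreal (real k)" for k x by (simp_all add: W_def)
      have min_le: "y \<le> ennreal A * min a b" if "y \<le> ennreal A * a" "y \<le> b" for y a b
      proof -
        have "b \<le> ennreal A * b" using A mult_right_mono[of 1 "ennreal A" b] by simp
        then show ?thesis using that by (auto simp: min_def)
      qed
      have W_A1: "hl_max (W k) x \<le> ennreal A * W k x" for k x
        unfolding W_def[of k x]
      proof (rule min_le)
        show "hl_max (W k) x \<le> ennreal A * w x"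
          using hl_max_mono[of "W k" w x] W_le(1) w(3)[of x] by (meson order_trans)
        show "hl_max (W k) x \<le> ennreal (real k)" by (intro hl_max_bounded W_le)
      qed
      have W_RH: "hl_max (\<lambda>y. W k y epowr p) x \<le> ennreal A * W k x epowr p" for k x
      proof -
        have "W k x epowr p = min (w x epowr p) (ennreal (real k) epowr p)"
          using p epowr_le_iff[of p "w x" "ennreal (real k)"] by (auto simp: W_def min_def)
        moreover have "hl_max (\<lambda>y. W k y epowr p) x \<le> ennreal A * min (w x epowr p) (ennreal (real k) epowr p)"
        proof (rule min_le)
          have "hl_max (\<lambda>y. W k y epowr p) x \<le> hl_max (\<lambda>y. w y epowr p) x"
            using p by (intro hl_max_mono epowr_mono W_le) auto
          then show "hl_max (\<lambda>y. W k y epowr p) x \<le> ennreal A * w x epowr p"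
            using w(4)[of x] by (rule order_trans)
          show "hl_max (\<lambda>y. W k y epowr p) x \<le> ennreal (real k) epowr p"
            using p by (intro hl_max_bounded epowr_mono W_le) auto
        qed
        ultimately show ?thesis by simp
      qed
      have W_u: "(\<integral>\<^sup>+x. u' x epowr r * W k x \<partial>lebesgue) \<le> 1" for k
      proof -
        have "(\<integral>\<^sup>+x. u' x epowr r * W k x \<partial>lebesgue) \<le> (\<integral>\<^sup>+x. u' x epowr r * w x \<partial>lebesgue)"
          by (intro nn_integral_mono mult_left_mono W_le) auto
        also have "\<dots> \<le> 1" by (rule polarD[OF w(1) u'_P])
        finally show ?thesis .
      qed
      have Wg: "(\<integral>\<^sup>+x. W k x * g x epowr r \<partial>lebesgue) \<le> ennreal (L / 2)" for k
      proof -
        have half: "L / 2 = (4 * A powr (1/(p*r)) * (C2 * A) powr (1/r) * C3 powr ((r-1)/r)) powr r"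
          by (simp add: L_def)
        show ?thesis
          unfolding half g_def
        proof (rule sparse_operator_A1_bound)
          show "(\<integral>\<^sup>+x. hl_max f x epowr r * h x \<partial>lebesgue) \<le> ennreal C2 * (\<integral>\<^sup>+x. f x epowr r * hl_max h x \<partial>lebesgue)"
            if "f \<in> borel_measurable lebesgue" "h \<in> borel_measurable lebesgue" for f h :: "'a \<Rightarrow> ennreal"
            using that by (rule FS)
          show "(\<integral>\<^sup>+x. hl_max f x epowr ((p * r - 1) / (p * (r - 1))) \<partial>lebesgue) \<le>
              ennreal C3 * (\<integral>\<^sup>+x. f x epowr ((p * r - 1) / (p * (r - 1))) \<partial>lebesgue)"
            if "f \<in> borel_measurable lebesgue" for f :: "'a \<Rightarrow> ennreal"
            using HL[OF that] unfolding s_def .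
          show "sparse_family I snd E" by (rule sp)
          show "hl_max (W k) x \<le> ennreal A * W k x" for x by (rule W_A1)
          show "hl_max (\<lambda>y. W k y epowr p) x \<le> ennreal A * W k x epowr p" for x by (rule W_RH)
          show "(\<integral>\<^sup>+x. u' x epowr r * W k x \<partial>lebesgue) \<le> 1" by (rule W_u)
          show "u' x \<le> ennreal (real n)" for x by (rule u'_le)
          show "W k x \<le> ennreal (real k)" for x by (rule W_le)
        qed (use r p A C2 C3 meas W_meas in auto)
      qed
      have supW: "(SUP k. W k x) = w x" for x
      proof (rule antisym)
        show "(SUP k. W k x) \<le> w x" by (intro SUP_least W_le)
        have "w x = (SUP k. trunc k w x)" by (simp add: SUP_trunc)
        also have "\<dots> \<le> (SUP k. W k x)"
          by (intro SUP_mono') (auto simp: trunc_def W_def indicator_def)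
        finally show "w x \<le> (SUP k. W k x)" .
      qed
      have "(\<integral>\<^sup>+x. w x * g x epowr r \<partial>lebesgue) = (\<integral>\<^sup>+x. (SUP k. W k x * g x epowr r) \<partial>lebesgue)"
        by (simp add: supW[symmetric] SUP_mult_right_ennreal)
      also have "\<dots> = (SUP k. \<integral>\<^sup>+x. W k x * g x epowr r \<partial>lebesgue)"
      proof (rule nn_integral_monotone_convergence_SUP)
        show "incseq (\<lambda>k x. W k x * g x epowr r)"
          unfolding incseq_def le_fun_def W_def
          by (auto intro!: mult_right_mono min.mono ennreal_leI)
      qed measurable
      also have "\<dots> \<le> ennreal (L / 2)" by (intro SUP_least Wg)
      finally have wg: "(\<integral>\<^sup>+x. w x * g x epowr r \<partial>lebesgue) \<le> ennreal (L / 2)" .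
      have "(\<integral>\<^sup>+x. H x * g x epowr r \<partial>lebesgue) \<le> (\<integral>\<^sup>+x. 2 * (w x * g x epowr r) \<partial>lebesgue)"
        unfolding mult.assoc[symmetric] by (intro nn_integral_mono mult_right_mono w(2)) auto
      also have "\<dots> = 2 * (\<integral>\<^sup>+x. w x * g x epowr r \<partial>lebesgue)" by (rule nn_integral_cmult) measurable
      also have "\<dots> \<le> 2 * ennreal (L / 2)" by (intro mult_left_mono wg) auto
      also have "\<dots> = ennreal L" using L by (simp add: ennreal_numeral[symmetric] ennreal_mult[symmetric] del: ennreal_numeral)
      finally show ?thesis .
    qed
    then have "(\<lambda>x. g x epowr r / ennreal L) \<in> polar (polar P)"
      using divide_in_polar_iff[OF polP_meas _ L, of "\<lambda>x. g x epowr r"] by simp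
    then have "(\<lambda>x. g x epowr r / ennreal L) \<in> P"
      unfolding bipolar_eq[OF P_normal conv[folded P_def]] .
    then have "(\<lambda>x. (g x epowr r / ennreal L) epowr (1/r)) \<in> B"
      by (simp add: P_def ball_power_def)
    then have gB: "(\<lambda>x. g x / ennreal (L powr (1/r))) \<in> B"
      using L r by (simp add: epowr_divide)
    have "(\<integral>\<^sup>+x. h' x * g x \<partial>lebesgue) = (\<integral>\<^sup>+x. ennreal (L powr (1/r)) * (g x / ennreal (L powr (1/r)) * h' x) \<partial>lebesgue)"
    proof (rule nn_integral_cong)
      fix x
      have "g x = ennreal (L powr (1/r)) * (g x / ennreal (L powr (1/r)))"
        using L by (simp add: ennreal_times_divide mult_divide_eq_ennreal mult.commute[of "ennreal _"])
      then show "h' x * g x = ennreal (L powr (1/r)) * (g x / ennreal (L powr (1/r)) * h' x)"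
        by (metis mult.assoc mult.commute)
    qed
    also have "\<dots> = ennreal (L powr (1/r)) * (\<integral>\<^sup>+x. g x / ennreal (L powr (1/r)) * h' x \<partial>lebesgue)"
      by (rule nn_integral_cmult) measurable
    also have "\<dots> \<le> ennreal (L powr (1/r)) * 1"
      by (intro mult_left_mono polarD[OF h' gB]) simp
    finally have "(\<integral>\<^sup>+x. h' x * g x \<partial>lebesgue) \<le> ennreal (L powr (1/r))" by simp
    then have "c \<le> ennreal (2 * 27 ^ DIM('a)) * ennreal (L powr (1/r))"
      unfolding g_def by (intro order_trans[OF c_le] mult_left_mono) auto
    then show "c \<le> ennreal C1" by (simp add: C1_def ennreal_mult)
  qed
  show ?thesis
    unfolding ball_maximal_def
  proof (intro exI conjI ballI)
    show "0 < C1" by (rule C1)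
    fix h assume h: "h \<in> polar B"
    have "(\<integral>\<^sup>+x. u x * hl_max h x \<partial>lebesgue) \<le> ennreal C1" if u: "u \<in> B" for u
      using hl_max_pairing_trunc_le[OF polar_measurable[OF h] _ key[OF h u]] u B_meas by (auto simp: mult.commute)
    then show "(\<lambda>x. hl_max h x / ennreal C1) \<in> polar B"
      using divide_in_polar_iff[OF B_meas measurable_hl_max C1] by blast
  qed
qed

text \<open>
  The equivalence of (i) and (ii) in terms of unit balls. For the polar ball it is the
  equivalence of (i) and (iii).
\<close>

lemma ball_maximal_iff_polar_power:
  assumes B: "normal_ball B" and b: "1 < b" and conv: "convex_ball (ball_power B b)"
  shows "ball_maximal B \<and> ball_maximal (polar B) \<longleftrightarrow> (\<exists>r\<in>{1<..b}. ball_maximal (polar (ball_power B r)))"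
proof
  have "convex_ball B"
    using convex_ball_power_mono[OF B conv, of 1] b ball_power_one[OF B] by simp
  then show "ball_maximal B \<and> ball_maximal (polar B) \<Longrightarrow> \<exists>r\<in>{1<..b}. ball_maximal (polar (ball_power B r))"
    using ball_maximal_polar_power[OF B _ _ _ b] by blast
next
  assume "\<exists>r\<in>{1<..b}. ball_maximal (polar (ball_power B r))"
  then obtain r where r: "1 < r" "r \<le> b" "ball_maximal (polar (ball_power B r))" by auto
  have "convex_ball (ball_power B r)" using convex_ball_power_mono[OF B conv, of r] r by simp
  then show "ball_maximal B \<and> ball_maximal (polar B)"
    using ball_maximal_if_polar_power[OF B r(1)] ball_maximal_polar_if_polar_power[OF B r(1)] r(3) by blast
qed

section \<open>Banach function spaces and their unit balls\<close>

text \<open>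
  The axioms that associate spaces and powers inherit from any space satisfying them, and that
  suffice to express boundedness of the maximal operator by the unit ball.
\<close>

locale lattice_seminorm =
  fixes Z :: "'a::euclidean_space fspace"
  assumes meas: "f \<in> fcarrier Z \<Longrightarrow> f \<in> borel_measurable lebesgue"
    and scale: "f \<in> fcarrier Z \<Longrightarrow> (\<lambda>x. c * f x) \<in> fcarrier Z \<and> fnorm Z (\<lambda>x. c * f x) = \<bar>c\<bar> * fnorm Z f"
    and nonneg: "f \<in> fcarrier Z \<Longrightarrow> 0 \<le> fnorm Z f"
    and solid: "f \<in> fcarrier Z \<Longrightarrow> g \<in> borel_measurable lebesgue \<Longrightarrow>
      (AE x in lebesgue. \<bar>g x\<bar> \<le> \<bar>f x\<bar>) \<Longrightarrow> g \<in> fcarrier Z \<and> fnorm Z g \<le> fnorm Z f"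

text \<open>
  Membership is tested on the real-valued representative \<open>enn2real \<circ> F\<close>, which forgets infinite values;
  hence the requirement that these occur on a null set only.
\<close>

definition unit_ball :: "'a::euclidean_space fspace \<Rightarrow> ('a \<Rightarrow> ennreal) set" where
  "unit_ball Z = {F \<in> borel_measurable lebesgue. (AE x in lebesgue. F x < top) \<and>
     (\<lambda>x. enn2real (F x)) \<in> fcarrier Z \<and> fnorm Z (\<lambda>x. enn2real (F x)) \<le> 1}"

lemma unit_ballD:
  assumes "F \<in> unit_ball Z"
  shows "F \<in> borel_measurable lebesgue" "AE x in lebesgue. F x < top"
    "(\<lambda>x. enn2real (F x)) \<in> fcarrier Z" "fnorm Z (\<lambda>x. enn2real (F x)) \<le> 1"
  using assms by (auto simp: unit_ball_def)

lemma enn2real_divide_ennreal: "0 < c \<Longrightarrow> enn2real (y / ennreal c) = 1 / c * enn2real y"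
  by (simp add: divide_ennreal_def enn2real_mult inverse_ennreal inverse_eq_divide)

context lattice_seminorm
begin

lemma abs_mem:
  assumes f: "f \<in> fcarrier Z"
  shows "(\<lambda>x. \<bar>f x\<bar>) \<in> fcarrier Z" "fnorm Z (\<lambda>x. \<bar>f x\<bar>) = fnorm Z f"
proof -
  have [measurable]: "f \<in> borel_measurable lebesgue" by (rule meas[OF f])
  have *: "(\<lambda>x. \<bar>f x\<bar>) \<in> fcarrier Z \<and> fnorm Z (\<lambda>x. \<bar>f x\<bar>) \<le> fnorm Z f"
    by (rule solid[OF f]) auto
  then have "fnorm Z f \<le> fnorm Z (\<lambda>x. \<bar>f x\<bar>)"
    using solid[of "\<lambda>x. \<bar>f x\<bar>" f] by simp
  with * show "(\<lambda>x. \<bar>f x\<bar>) \<in> fcarrier Z" "fnorm Z (\<lambda>x. \<bar>f x\<bar>) = fnorm Z f" by auto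
qed

lemma ennreal_in_unit_ball:
  assumes f: "f \<in> fcarrier Z" "fnorm Z f \<le> 1"
  shows "(\<lambda>x. ennreal \<bar>f x\<bar>) \<in> unit_ball Z"
proof -
  have [measurable]: "f \<in> borel_measurable lebesgue" by (rule meas[OF f(1)])
  show ?thesis using abs_mem[OF f(1)] f(2) by (simp add: unit_ball_def)
qed

lemma scaled_in_unit_ball:
  assumes f: "f \<in> fcarrier Z" and t: "fnorm Z f \<le> t" "0 < t"
  shows "(\<lambda>x. ennreal \<bar>1 / t * f x\<bar>) \<in> unit_ball Z"
  using scale[OF f, of "1/t"] t by (intro ennreal_in_unit_ball) simp_all

lemma unit_ball_solid:
  assumes F: "F \<in> unit_ball Z" and [measurable]: "G \<in> borel_measurable lebesgue"
    and le: "AE x in lebesgue. G x \<le> F x"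
  shows "G \<in> unit_ball Z"
proof -
  note F' = unit_ballD[OF F]
  have fin: "AE x in lebesgue. G x < top" using le F'(2) by eventually_elim (rule le_less_trans)
  have "AE x in lebesgue. \<bar>enn2real (G x)\<bar> \<le> \<bar>enn2real (F x)\<bar>"
    using le F'(2) by eventually_elim (simp add: enn2real_mono)
  then have "(\<lambda>x. enn2real (G x)) \<in> fcarrier Z \<and> fnorm Z (\<lambda>x. enn2real (G x)) \<le> fnorm Z (\<lambda>x. enn2real (F x))"
    by (intro solid[OF F'(3)]) measurable
  then show ?thesis using fin F'(4) by (auto simp: unit_ball_def)
qed

lemma maximal_bounded_iff: "maximal_bounded Z \<longleftrightarrow> ball_maximal (unit_ball Z)"
proof
  assume "maximal_bounded Z"
  then obtain C where C: "\<And>f. f \<in> fcarrier Z \<Longrightarrow> AE x in lebesgue. maximal_fun f x < \<infinity>"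
    "\<And>f. f \<in> fcarrier Z \<Longrightarrow> (\<lambda>x. enn2real (maximal_fun f x)) \<in> fcarrier Z"
    "\<And>f. f \<in> fcarrier Z \<Longrightarrow> fnorm Z (\<lambda>x. enn2real (maximal_fun f x)) \<le> C * fnorm Z f"
    unfolding maximal_bounded_def by blast
  define D where "D = max C 1"
  have D: "0 < D" "C \<le> D" by (auto simp: D_def)
  have "(\<lambda>x. hl_max F x / ennreal D) \<in> unit_ball Z" if F: "F \<in> unit_ball Z" for F
  proof -
    define f where "f x = enn2real (F x)" for x
    note F' = unit_ballD[OF F, folded f_def]
    have "AE x in lebesgue. F x = ennreal \<bar>f x\<bar>"
      using F'(2) by eventually_elim (simp add: f_def)
    then have M_eq: "hl_max F = maximal_fun f"
      unfolding maximal_fun_eq_hl_max by (rule hl_max_cong_AE)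
    have M_meas: "maximal_fun f \<in> borel_measurable lebesgue"
      unfolding maximal_fun_eq_hl_max by (rule measurable_hl_max)
    have real_eq: "enn2real (maximal_fun f x / ennreal D) = 1 / D * enn2real (maximal_fun f x)" for x
      by (rule enn2real_divide_ennreal[OF D(1)])
    have "fnorm Z (\<lambda>x. enn2real (maximal_fun f x)) \<le> C * fnorm Z f" by (rule C(3)[OF F'(3)])
    also have "\<dots> \<le> D * fnorm Z f" using D nonneg[OF F'(3)] by (intro mult_right_mono) auto
    also have "\<dots> \<le> D" using D F'(4) by (simp add: mult_left_le)
    finally have "1 / D * fnorm Z (\<lambda>x. enn2real (maximal_fun f x)) \<le> 1" using D by (simp add: field_simps)
    then have "(\<lambda>x. 1 / D * enn2real (maximal_fun f x)) \<in> fcarrier Z"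
        "fnorm Z (\<lambda>x. 1 / D * enn2real (maximal_fun f x)) \<le> 1"
      using scale[OF C(2)[OF F'(3)], of "1/D"] D by simp_all
    moreover have "AE x in lebesgue. maximal_fun f x / ennreal D < top"
      using C(1)[OF F'(3)] by eventually_elim (use D in \<open>simp add: ennreal_divide_eq_top_iff less_top[symmetric]\<close>)
    moreover have "(\<lambda>x. maximal_fun f x / ennreal D) \<in> borel_measurable lebesgue"
      using M_meas by measurable
    ultimately show ?thesis
      unfolding unit_ball_def M_eq mem_Collect_eq real_eq by blast
  qed
  then show "ball_maximal (unit_ball Z)" using D(1) unfolding ball_maximal_def by blast
next
  assume "ball_maximal (unit_ball Z)"
  then obtain C where C: "0 < C" and M: "\<And>F. F \<in> unit_ball Z \<Longrightarrow> (\<lambda>x. hl_max F x / ennreal C) \<in> unit_ball Z"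
    unfolding ball_maximal_def by blast
  have main: "(AE x in lebesgue. maximal_fun f x < top) \<and> (\<lambda>x. enn2real (maximal_fun f x)) \<in> fcarrier Z \<and>
      fnorm Z (\<lambda>x. enn2real (maximal_fun f x)) \<le> t * C"
    if f: "f \<in> fcarrier Z" and t: "fnorm Z f \<le> t" "0 < t" for f t
  proof -
    have [measurable]: "f \<in> borel_measurable lebesgue" by (rule meas[OF f])
    have tC: "0 < t * C" using t C by simp
    have "hl_max (\<lambda>x. ennreal \<bar>1 / t * f x\<bar>) x / ennreal C = maximal_fun f x / ennreal (t * C)" for x
    proof -
      have "(\<lambda>x. ennreal \<bar>1 / t * f x\<bar>) = (\<lambda>x. ennreal (1 / t) * ennreal \<bar>f x\<bar>)"
        using t by (simp add: ennreal_mult[symmetric] abs_mult)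
      then have "hl_max (\<lambda>x. ennreal \<bar>1 / t * f x\<bar>) x = ennreal (1 / t) * maximal_fun f x"
        by (simp add: maximal_fun_eq_hl_max hl_max_cmult)
      moreover have "ennreal (1 / t) * y / ennreal C = y / ennreal (t * C)" for y
      proof -
        have "ennreal (1 / t) * y / ennreal C = y * (ennreal (1 / t) * ennreal (1 / C))"
          using C by (simp add: divide_ennreal_def inverse_ennreal inverse_eq_divide mult_ac)
        also have "ennreal (1 / t) * ennreal (1 / C) = ennreal (1 / (t * C))"
          using t C by (simp add: ennreal_mult[symmetric])
        also have "y * ennreal (1 / (t * C)) = y / ennreal (t * C)"
          using tC by (simp add: divide_ennreal_def inverse_ennreal inverse_eq_divide)
        finally show ?thesis .
      qed
      ultimately show ?thesis by simp
    qed
    then have N: "(\<lambda>x. maximal_fun f x / ennreal (t * C)) \<in> unit_ball Z"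
      using M[OF scaled_in_unit_ball[OF f t]] by simp
    have real_eq: "enn2real (maximal_fun f x / ennreal (t * C)) = 1 / (t * C) * enn2real (maximal_fun f x)" for x
      by (rule enn2real_divide_ennreal[OF tC])
    note N' = unit_ballD(2-4)[OF N, unfolded real_eq]
    have "AE x in lebesgue. maximal_fun f x < top"
      using N'(1) by eventually_elim (simp add: ennreal_divide_eq_top_iff less_top[symmetric])
    moreover have eq: "(\<lambda>x. t * C * (1 / (t * C) * enn2real (maximal_fun f x))) = (\<lambda>x. enn2real (maximal_fun f x))"
      using t C by (simp add: fun_eq_iff)
    moreover note scale[OF N'(2), of "t * C", unfolded eq]
    moreover have "\<bar>t * C\<bar> * fnorm Z (\<lambda>x. 1 / (t * C) * enn2real (maximal_fun f x)) \<le> t * C"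
      using tC N'(3) by (simp add: mult_left_le)
    ultimately show ?thesis by simp
  qed
  show "maximal_bounded Z"
    unfolding maximal_bounded_def
  proof (intro exI ballI conjI)
    fix f assume f: "f \<in> fcarrier Z"
    have n1: "fnorm Z f \<le> fnorm Z f + 1" "0 < fnorm Z f + 1" using nonneg[OF f] by auto
    show "AE x in lebesgue. maximal_fun f x < \<infinity>" using main[OF f n1] by simp
    show "(\<lambda>x. enn2real (maximal_fun f x)) \<in> fcarrier Z" using main[OF f n1] by simp
    show "fnorm Z (\<lambda>x. enn2real (maximal_fun f x)) \<le> C * fnorm Z f"
    \<comment> \<open>The scaling factor exceeds the norm of \<open>f\<close>, which may be zero.\<close>
    proof (rule field_le_epsilon)
      fix e :: real assume e: "0 < e"
      have "fnorm Z f \<le> fnorm Z f + e / C" "0 < fnorm Z f + e / C"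
        using e C nonneg[OF f] by (auto intro: add_nonneg_pos)
      moreover have "(fnorm Z f + e / C) * C = C * fnorm Z f + e" using C by (simp add: field_simps)
      ultimately show "fnorm Z (\<lambda>x. enn2real (maximal_fun f x)) \<le> C * fnorm Z f + e"
        using main[OF f, of "fnorm Z f + e / C"] by simp
    qed
  qed
qed

lemma unit_ball_pairing_le:
  assumes G: "G \<in> polar (unit_ball Z)" and u: "u \<in> fcarrier Z"
  shows "(\<integral>\<^sup>+x. ennreal \<bar>u x\<bar> * G x \<partial>lebesgue) \<le> ennreal (fnorm Z u)"
proof (rule ennreal_le_epsilon)
  fix e :: real assume e: "0 < e"
  have [measurable]: "u \<in> borel_measurable lebesgue" "G \<in> borel_measurable lebesgue"
    using meas[OF u] polar_measurable[OF G] .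
  define t where "t = fnorm Z u + e"
  have t: "fnorm Z u \<le> t" "0 < t" using e nonneg[OF u] by (auto simp: t_def)
  have "(\<integral>\<^sup>+x. ennreal \<bar>u x\<bar> * G x \<partial>lebesgue) = (\<integral>\<^sup>+x. ennreal t * (ennreal \<bar>1 / t * u x\<bar> * G x) \<partial>lebesgue)"
  proof (rule nn_integral_cong)
    fix x
    have "ennreal \<bar>u x\<bar> = ennreal t * ennreal \<bar>1 / t * u x\<bar>"
      using t by (simp add: ennreal_mult[symmetric] abs_mult)
    then show "ennreal \<bar>u x\<bar> * G x = ennreal t * (ennreal \<bar>1 / t * u x\<bar> * G x)" by (simp only: mult.assoc)
  qed
  also have "\<dots> = ennreal t * (\<integral>\<^sup>+x. ennreal \<bar>1 / t * u x\<bar> * G x \<partial>lebesgue)"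
    by (rule nn_integral_cmult) measurable
  also have "\<dots> \<le> ennreal t * 1"
    by (intro mult_left_mono polarD[OF G scaled_in_unit_ball[OF u t]]) simp
  finally show "(\<integral>\<^sup>+x. ennreal \<bar>u x\<bar> * G x \<partial>lebesgue) \<le> ennreal (fnorm Z u) + ennreal e"
    using e nonneg[OF u] by (simp add: t_def)
qed

lemma associate_enorm_le_1_iff:
  assumes [measurable]: "G \<in> borel_measurable lebesgue" and fin: "AE x in lebesgue. G x < top"
  shows "associate_enorm Z (\<lambda>x. enn2real (G x)) \<le> 1 \<longleftrightarrow> G \<in> polar (unit_ball Z)"
proof
  assume le: "associate_enorm Z (\<lambda>x. enn2real (G x)) \<le> 1"
  show "G \<in> polar (unit_ball Z)"
  proof (rule polarI)
    fix F assume F: "F \<in> unit_ball Z"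
    note F' = unit_ballD[OF F]
    have "AE x in lebesgue. F x * G x = ennreal \<bar>enn2real (F x) * enn2real (G x)\<bar>"
      using F'(2) fin by eventually_elim (simp add: ennreal_mult)
    then have "(\<integral>\<^sup>+x. F x * G x \<partial>lebesgue) = (\<integral>\<^sup>+x. ennreal \<bar>enn2real (F x) * enn2real (G x)\<bar> \<partial>lebesgue)"
      by (rule nn_integral_cong_AE)
    also have "\<dots> \<le> associate_enorm Z (\<lambda>x. enn2real (G x))"
      unfolding associate_enorm_def using F'(3,4) by (intro SUP_upper2[of "\<lambda>x. enn2real (F x)"]) auto
    also note le
    finally show "(\<integral>\<^sup>+x. F x * G x \<partial>lebesgue) \<le> 1" .
  qed measurable
next
  assume G: "G \<in> polar (unit_ball Z)"
  show "associate_enorm Z (\<lambda>x. enn2real (G x)) \<le> 1"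
    unfolding associate_enorm_def
  proof (rule SUP_least)
    fix f assume f: "f \<in> {f \<in> fcarrier Z. fnorm Z f \<le> 1}"
    have "AE x in lebesgue. ennreal \<bar>f x * enn2real (G x)\<bar> = ennreal \<bar>f x\<bar> * G x"
      using fin by eventually_elim (simp add: abs_mult ennreal_mult)
    then have "(\<integral>\<^sup>+x. ennreal \<bar>f x * enn2real (G x)\<bar> \<partial>lebesgue) = (\<integral>\<^sup>+x. ennreal \<bar>f x\<bar> * G x \<partial>lebesgue)"
      by (rule nn_integral_cong_AE)
    also have "\<dots> \<le> 1" using f by (intro polarD[OF G] ennreal_in_unit_ball) auto
    finally show "(\<integral>\<^sup>+x. ennreal \<bar>f x * enn2real (G x)\<bar> \<partial>lebesgue) \<le> 1" .
  qed
qed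

end

definition saturated_ball :: "('a::euclidean_space \<Rightarrow> ennreal) set \<Rightarrow> bool" where
  "saturated_ball B \<longleftrightarrow> (\<forall>E\<in>sets lebesgue. emeasure lebesgue E > 0 \<longrightarrow> (\<exists>F\<in>B. \<not> (AE x in lebesgue. x \<in> E \<longrightarrow> F x = 0)))"

text \<open>
  An element of the polar that is infinite on a set of positive measure has an infinite
  pairing with every element of the ball that does not vanish on this set. So the unit ball of
  the associate space is the whole polar.
\<close>

lemma polar_finite_if_saturated:
  assumes B: "saturated_ball B" and G: "G \<in> polar B"
    and meas: "B \<subseteq> borel_measurable lebesgue"
  shows "AE x in lebesgue. G x < top"
proof (rule ccontr)
  assume nfin: "\<not> (AE x in lebesgue. G x < top)"
  have [measurable]: "G \<in> borel_measurable lebesgue" by (rule polar_measurable[OF G])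
  define E where "E = {x \<in> space lebesgue. \<not> G x < top}"
  have E: "E \<in> sets lebesgue" unfolding E_def by measurable
  have "emeasure lebesgue E \<noteq> 0"
    using nfin E unfolding E_def by (subst (asm) AE_iff_measurable[OF _ refl]) auto
  then obtain F where F: "F \<in> B" "\<not> (AE x in lebesgue. x \<in> E \<longrightarrow> F x = 0)"
    using B E unfolding saturated_ball_def by (auto simp: zero_less_iff_neq_zero)
  have [measurable]: "F \<in> borel_measurable lebesgue" using F(1) meas by blast
  have "(\<integral>\<^sup>+x. F x * G x \<partial>lebesgue) \<noteq> \<infinity>"
    using neq_top_trans[OF ennreal_one_neq_top polarD[OF G F(1)]] by simp
  then have "AE x in lebesgue. F x * G x \<noteq> \<infinity>"
    by (intro nn_integral_noteq_infinite) auto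
  then have "AE x in lebesgue. x \<in> E \<longrightarrow> F x = 0"
    by eventually_elim (auto simp: E_def less_top[symmetric] ennreal_mult_top split: if_splits)
  with F(2) show False by blast
qed

text \<open>
  If all elements of the polar vanished on a set, the function that is infinite on this set would
  belong to the bipolar.
\<close>

lemma saturated_polar:
  assumes bip: "polar (polar B) = B" and fin: "\<And>F. F \<in> B \<Longrightarrow> AE x in lebesgue. F x < top"
  shows "saturated_ball (polar B)"
  unfolding saturated_ball_def
proof (intro ballI impI, rule ccontr)
  fix E :: "'a set" assume E[measurable]: "E \<in> sets lebesgue" and pos: "0 < emeasure lebesgue E"
    and none: "\<not> (\<exists>F\<in>polar B. \<not> (AE x in lebesgue. x \<in> E \<longrightarrow> F x = 0))"
  have "(\<lambda>x. top * indicator E x) \<in> polar (polar B)"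
  proof (rule polarI)
    fix G assume "G \<in> polar B"
    then have "AE x in lebesgue. x \<in> E \<longrightarrow> G x = 0" using none by blast
    then have "AE x in lebesgue. G x * (top * indicator E x) = 0"
      by eventually_elim (auto simp: indicator_def)
    then have "(\<integral>\<^sup>+x. G x * (top * indicator E x) \<partial>lebesgue) = (\<integral>\<^sup>+x. 0 \<partial>(lebesgue :: 'a measure))"
      by (rule nn_integral_cong_AE)
    then show "(\<integral>\<^sup>+x. G x * (top * indicator E x) \<partial>lebesgue) \<le> 1" by simp
  qed measurable
  then have "AE x in lebesgue. top * indicator E x < (top::ennreal)" unfolding bip by (rule fin)
  then have "AE x in lebesgue. x \<notin> E" by eventually_elim (auto simp: indicator_def)
  then have "emeasure lebesgue E = 0" using E by (subst (asm) AE_iff_measurable[OF _ refl]) auto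
  with pos show False by simp
qed

lemma saturated_ball_power:
  assumes B: "normal_ball B" "saturated_ball B" and p: "0 < p"
  shows "saturated_ball (ball_power B p)"
  unfolding saturated_ball_def
proof (intro ballI impI)
  fix E :: "'a set" assume "E \<in> sets lebesgue" "0 < emeasure lebesgue E"
  then obtain F where F: "F \<in> B" "\<not> (AE x in lebesgue. x \<in> E \<longrightarrow> F x = 0)"
    using B(2) unfolding saturated_ball_def by blast
  have "(\<lambda>x. F x epowr p) \<in> ball_power B p" by (rule epowr_in_ball_power[OF B(1) F(1) p])
  moreover have "\<not> (AE x in lebesgue. x \<in> E \<longrightarrow> F x epowr p = 0)" using F(2) by simp
  ultimately show "\<exists>F\<in>ball_power B p. \<not> (AE x in lebesgue. x \<in> E \<longrightarrow> F x = 0)"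
    by (intro bexI[of _ "\<lambda>x. F x epowr p"])
qed


lemma (in lattice_seminorm) lattice_seminorm_associate: "lattice_seminorm (associate Z)"
proof
  have carrier: "f \<in> fcarrier (associate Z) \<longleftrightarrow> f \<in> borel_measurable lebesgue \<and> associate_enorm Z f < top" for f
    by (simp add: associate_def)
  have norm: "fnorm (associate Z) f = enn2real (associate_enorm Z f)" for f
    by (simp add: associate_def)
  fix f assume f: "f \<in> fcarrier (associate Z)"
  then have f': "f \<in> borel_measurable lebesgue" "associate_enorm Z f < top" by (simp_all add: carrier)
  note [measurable] = f'(1)
  show "f \<in> borel_measurable lebesgue" by (rule f'(1))
  show "0 \<le> fnorm (associate Z) f" by (simp add: norm)
  show "(\<lambda>x. c * f x) \<in> fcarrier (associate Z) \<and> fnorm (associate Z) (\<lambda>x. c * f x) = \<bar>c\<bar> * fnorm (associate Z) f" for c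
  proof -
    have "associate_enorm Z (\<lambda>x. c * f x) = ennreal \<bar>c\<bar> * associate_enorm Z f"
      unfolding associate_enorm_def SUP_mult_left_ennreal
    proof (rule SUP_cong[OF refl])
      fix g assume "g \<in> {f \<in> fcarrier Z. fnorm Z f \<le> 1}"
      then have [measurable]: "g \<in> borel_measurable lebesgue" using meas by blast
      have "(\<integral>\<^sup>+x. ennreal \<bar>g x * (c * f x)\<bar> \<partial>lebesgue) = (\<integral>\<^sup>+x. ennreal \<bar>c\<bar> * ennreal \<bar>g x * f x\<bar> \<partial>lebesgue)"
        by (intro nn_integral_cong) (simp add: ennreal_mult[symmetric] abs_mult mult.left_commute)
      also have "\<dots> = ennreal \<bar>c\<bar> * (\<integral>\<^sup>+x. ennreal \<bar>g x * f x\<bar> \<partial>lebesgue)"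
        by (rule nn_integral_cmult) measurable
      finally show "(\<integral>\<^sup>+x. ennreal \<bar>g x * (c * f x)\<bar> \<partial>lebesgue) = ennreal \<bar>c\<bar> * (\<integral>\<^sup>+x. ennreal \<bar>g x * f x\<bar> \<partial>lebesgue)" .
    qed
    moreover have "(\<lambda>x. c * f x) \<in> borel_measurable lebesgue" by measurable
    ultimately show ?thesis using f'(2) by (simp add: carrier norm ennreal_mult_less_top enn2real_mult)
  qed
  fix g assume g: "g \<in> borel_measurable lebesgue" and le: "AE x in lebesgue. \<bar>g x\<bar> \<le> \<bar>f x\<bar>"
  have "associate_enorm Z g \<le> associate_enorm Z f"
    unfolding associate_enorm_def
  proof (rule SUP_mono')
    fix h
    show "(\<integral>\<^sup>+x. ennreal \<bar>h x * g x\<bar> \<partial>lebesgue) \<le> (\<integral>\<^sup>+x. ennreal \<bar>h x * f x\<bar> \<partial>lebesgue)"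
      using le by (intro nn_integral_mono_AE, eventually_elim) (simp add: abs_mult ennreal_leI mult_left_mono)
  qed
  then show "g \<in> fcarrier (associate Z) \<and> fnorm (associate Z) g \<le> fnorm (associate Z) f"
    using g f'(2) by (simp add: carrier norm enn2real_mono le_less_trans)
qed

lemma (in lattice_seminorm) lattice_seminorm_fpower:
  assumes p: "0 < p"
  shows "lattice_seminorm (fpower Z p)"
proof
  have carrier: "f \<in> fcarrier (fpower Z p) \<longleftrightarrow> f \<in> borel_measurable lebesgue \<and> (\<lambda>x. \<bar>f x\<bar> powr (1/p)) \<in> fcarrier Z" for f
    by (simp add: fpower_def)
  have norm: "fnorm (fpower Z p) f = fnorm Z (\<lambda>x. \<bar>f x\<bar> powr (1/p)) powr p" for f
    by (simp add: fpower_def)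
  fix f assume f: "f \<in> fcarrier (fpower Z p)"
  then have f': "f \<in> borel_measurable lebesgue" "(\<lambda>x. \<bar>f x\<bar> powr (1/p)) \<in> fcarrier Z" by (simp_all add: carrier)
  note [measurable] = f'(1)
  show "f \<in> borel_measurable lebesgue" by (rule f'(1))
  show "0 \<le> fnorm (fpower Z p) f" by (simp add: norm)
  show "(\<lambda>x. c * f x) \<in> fcarrier (fpower Z p) \<and> fnorm (fpower Z p) (\<lambda>x. c * f x) = \<bar>c\<bar> * fnorm (fpower Z p) f" for c
  proof -
    have eq: "\<bar>c * f x\<bar> powr (1/p) = \<bar>c\<bar> powr (1/p) * \<bar>f x\<bar> powr (1/p)" for x
      by (simp add: abs_mult powr_mult)
    have "(\<bar>c\<bar> powr (1/p) * fnorm Z (\<lambda>x. \<bar>f x\<bar> powr (1/p))) powr p = \<bar>c\<bar> * fnorm Z (\<lambda>x. \<bar>f x\<bar> powr (1/p)) powr p"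
      using p nonneg[OF f'(2)] by (simp add: powr_mult powr_powr)
    moreover have "(\<lambda>x. c * f x) \<in> borel_measurable lebesgue" by measurable
    ultimately show ?thesis
      unfolding carrier norm eq using scale[OF f'(2), of "\<bar>c\<bar> powr (1/p)"] by simp
  qed
  fix g assume g[measurable]: "g \<in> borel_measurable lebesgue" and le: "AE x in lebesgue. \<bar>g x\<bar> \<le> \<bar>f x\<bar>"
  have "AE x in lebesgue. \<bar>\<bar>g x\<bar> powr (1/p)\<bar> \<le> \<bar>\<bar>f x\<bar> powr (1/p)\<bar>"
    using le by eventually_elim (use p in \<open>simp add: powr_mono2\<close>)
  then have *: "(\<lambda>x. \<bar>g x\<bar> powr (1/p)) \<in> fcarrier Z \<and> fnorm Z (\<lambda>x. \<bar>g x\<bar> powr (1/p)) \<le> fnorm Z (\<lambda>x. \<bar>f x\<bar> powr (1/p))"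
    by (intro solid[OF f'(2)]) measurable
  then show "g \<in> fcarrier (fpower Z p) \<and> fnorm (fpower Z p) g \<le> fnorm (fpower Z p) f"
    unfolding carrier norm using g p nonneg by (auto intro!: powr_mono2)
qed

lemma (in lattice_seminorm) unit_ball_associate:
  assumes "saturated_ball (unit_ball Z)"
  shows "unit_ball (associate Z) = polar (unit_ball Z)"
proof -
  have "G \<in> unit_ball (associate Z) \<longleftrightarrow> G \<in> polar (unit_ball Z)" for G
  proof (cases "G \<in> borel_measurable lebesgue \<and> (AE x in lebesgue. G x < top)")
    case True
    then have [measurable]: "G \<in> borel_measurable lebesgue" by simp
    have "e < top \<and> enn2real e \<le> 1 \<longleftrightarrow> e \<le> 1" for e :: ennreal
      by (cases e) (auto simp: top_unique)
    then have "G \<in> unit_ball (associate Z) \<longleftrightarrow> associate_enorm Z (\<lambda>x. enn2real (G x)) \<le> 1"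
      using True by (simp add: unit_ball_def associate_def)
    then show ?thesis using associate_enorm_le_1_iff[of G] True by simp
  next
    case False
    moreover have "G \<in> borel_measurable lebesgue \<and> (AE x in lebesgue. G x < top)" if "G \<in> polar (unit_ball Z)"
      using polar_finite_if_saturated[OF assms that] polar_measurable[OF that] by (auto simp: unit_ball_def)
    ultimately show ?thesis by (auto simp: unit_ball_def)
  qed
  then show ?thesis by blast
qed

lemma (in lattice_seminorm) unit_ball_fpower:
  assumes p: "0 < p"
  shows "unit_ball (fpower Z p) = ball_power (unit_ball Z) p"
proof -
  have eq: "enn2real y powr (1/p) = enn2real (y epowr (1/p))" for y
    by (cases y) (auto simp: epowr_ennreal)
  have "F \<in> unit_ball (fpower Z p) \<longleftrightarrow> F \<in> ball_power (unit_ball Z) p" for F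
  proof (cases "F \<in> borel_measurable lebesgue")
    case True
    note [measurable] = True
    have "(\<lambda>x. enn2real (F x)) \<in> borel_measurable lebesgue" "(\<lambda>x. F x epowr (1/p)) \<in> borel_measurable lebesgue"
      by measurable
    moreover have "fnorm Z f powr p \<le> 1 \<longleftrightarrow> fnorm Z f \<le> 1" if "f \<in> fcarrier Z" for f
      using nonneg[OF that] p by (cases "fnorm Z f \<le> 1") (auto intro: powr_le1 simp: gr_one_powr not_le)
    ultimately show ?thesis
      using True by (auto simp: unit_ball_def ball_power_def fpower_def eq)
  qed (auto simp: unit_ball_def ball_power_def)
  then show ?thesis by blast
qed


lemma (in banach_function_space) lattice_seminorm: "lattice_seminorm X"
proof
  fix f assume f: "f \<in> fcarrier X"
  show "f \<in> borel_measurable lebesgue" by (rule measurable[OF f])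
  show "(\<lambda>x. c * f x) \<in> fcarrier X \<and> fnorm X (\<lambda>x. c * f x) = \<bar>c\<bar> * fnorm X f" for c
    using scale_mem[OF f] norm_scale[OF f] by simp
  show "0 \<le> fnorm X f" by (rule norm_nonneg[OF f])
  show "g \<in> fcarrier X \<and> fnorm X g \<le> fnorm X f"
    if "g \<in> borel_measurable lebesgue" "AE x in lebesgue. \<bar>g x\<bar> \<le> \<bar>f x\<bar>" for g
    using ideal[OF f that] .
qed

lemma (in banach_function_space) saturated_unit_ball: "saturated_ball (unit_ball X)"
  unfolding saturated_ball_def
proof (intro ballI impI)
  fix E :: "'a set" assume "E \<in> sets lebesgue" "0 < emeasure lebesgue E"
  then obtain A where A: "A \<in> sets lebesgue" "A \<subseteq> E" "emeasure lebesgue A > 0" "indicat_real A \<in> fcarrier X"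
    using saturation by blast
  define t where "t = fnorm X (indicat_real A) + 1"
  have t: "fnorm X (indicat_real A) \<le> t" "0 < t" using norm_nonneg[OF A(4)] by (auto simp: t_def)
  define F where "F = (\<lambda>x. ennreal \<bar>1 / t * indicat_real A x\<bar>)"
  have "F \<in> unit_ball X"
    unfolding F_def by (rule lattice_seminorm.scaled_in_unit_ball[OF lattice_seminorm A(4) t])
  moreover have "\<not> (AE x in lebesgue. x \<in> E \<longrightarrow> F x = 0)"
  proof
    assume "AE x in lebesgue. x \<in> E \<longrightarrow> F x = 0"
    then have "AE x in lebesgue. x \<notin> A"
      by eventually_elim (use A(2) t in \<open>auto simp: F_def\<close>)
    then have "emeasure lebesgue A = 0" using A(1) by (subst (asm) AE_iff_measurable[OF _ refl]) auto
    with A(3) show False by simp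
  qed
  ultimately show "\<exists>F\<in>unit_ball X. \<not> (AE x in lebesgue. x \<in> E \<longrightarrow> F x = 0)" by (intro bexI[of _ F])
qed

text \<open>
  The unit ball of a Banach function space is closed under increasing limits even if the
  limit is not assumed finite: if it were infinite on a set of positive measure, all
  multiples of an indicator function would have norm at most one.
\<close>

lemma (in banach_function_space) normal_unit_ball: "normal_ball (unit_ball X)"
proof -
  interpret L: lattice_seminorm X by (rule lattice_seminorm)
  have fatou_ball: "(\<lambda>x. SUP n. F n x) \<in> unit_ball X"
    if F: "\<And>n::nat. F n \<in> unit_ball X" and inc: "incseq F" and fin: "AE x in lebesgue. (SUP n. F n x) < top" for F
  proof -
    note F' = unit_ballD[OF F]
    note [measurable] = F'(1)
    define f where "f x = enn2real (SUP n. F n x)" for x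
    have f_meas: "f \<in> borel_measurable lebesgue" unfolding f_def by measurable
    have mono: "F m x \<le> F n x" if "m \<le> n" for m n x using inc that by (simp add: incseq_def le_fun_def)
    have lim: "AE x in lebesgue. (\<forall>n. 0 \<le> enn2real (F n x)) \<and> incseq (\<lambda>n. enn2real (F n x)) \<and> (\<lambda>n. enn2real (F n x)) \<longlonglongrightarrow> f x"
      using fin
    proof eventually_elim
      fix x assume top: "(SUP n. F n x) < top"
      have Fn: "F n x < top" for n by (rule le_less_trans[OF SUP_upper[OF UNIV_I] top])
      have "(\<lambda>n. F n x) \<longlonglongrightarrow> (SUP n. F n x)"
        by (rule LIMSEQ_SUP) (simp add: incseq_def mono)
      then have "(\<lambda>n. ennreal (enn2real (F n x))) \<longlonglongrightarrow> ennreal (f x)"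
        using Fn top by (simp add: f_def)
      then have "(\<lambda>n. enn2real (F n x)) \<longlonglongrightarrow> f x"
        by (rule tendsto_ennrealD) (auto simp: f_def)
      then show "(\<forall>n. 0 \<le> enn2real (F n x)) \<and> incseq (\<lambda>n. enn2real (F n x)) \<and> (\<lambda>n. enn2real (F n x)) \<longlonglongrightarrow> f x"
        using Fn mono by (auto simp: incseq_def intro!: enn2real_mono)
    qed
    have bdd: "bdd_above (range (\<lambda>n. fnorm X (\<lambda>x. enn2real (F n x))))"
      using F'(4) by (intro bdd_aboveI[of _ 1]) auto
    have "f \<in> fcarrier X \<and> fnorm X f = (SUP n. fnorm X (\<lambda>x. enn2real (F n x)))"
      by (rule fatou[OF F'(3) f_meas lim bdd])
    moreover have "(SUP n. fnorm X (\<lambda>x. enn2real (F n x))) \<le> 1"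
      using F'(4) by (intro cSUP_least) auto
    moreover have "(\<lambda>x. SUP n. F n x) \<in> borel_measurable lebesgue" by measurable
    ultimately show ?thesis using fin by (simp add: unit_ball_def f_def[symmetric])
  qed
  show ?thesis
    unfolding normal_ball_def
  proof (intro conjI ballI allI impI)
    show "unit_ball X \<subseteq> borel_measurable lebesgue" by (auto simp: unit_ball_def)
    have "fnorm X (\<lambda>x. 0) = 0" using norm_eq_0_iff[OF zero_mem] by simp
    then show "(\<lambda>x. 0) \<in> unit_ball X" using zero_mem by (simp add: unit_ball_def)
    show "G \<in> unit_ball X" if "F \<in> unit_ball X" "G \<in> borel_measurable lebesgue" "AE x in lebesgue. G x \<le> F x" for F G
      by (rule L.unit_ball_solid[OF that])
    fix F :: "nat \<Rightarrow> 'a \<Rightarrow> ennreal" assume "\<forall>n. F n \<in> unit_ball X" and inc: "incseq F"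
    then have F: "F n \<in> unit_ball X" for n by blast
    note [measurable] = unit_ballD(1)[OF F]
    have "AE x in lebesgue. (SUP n. F n x) < top"
    proof (rule ccontr)
      assume nfin: "\<not> (AE x in lebesgue. (SUP n. F n x) < top)"
      define E where "E = {x \<in> space lebesgue. \<not> (SUP n. F n x) < top}"
      have E: "E \<in> sets lebesgue" unfolding E_def by measurable
      have "emeasure lebesgue E \<noteq> 0"
        using nfin E unfolding E_def by (subst (asm) AE_iff_measurable[OF _ refl]) auto
      then obtain A where A: "A \<in> sets lebesgue" "A \<subseteq> E" "emeasure lebesgue A > 0" "indicat_real A \<in> fcarrier X"
        using saturation[OF E] by (auto simp: zero_less_iff_neq_zero)
      note [measurable] = A(1)
      have le1: "real k * fnorm X (indicat_real A) \<le> 1" for k :: nat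
      proof -
        define H where "H n x = min (F n x) (ennreal (real k)) * indicator A x" for n x
        have H_sup: "(SUP n. H n x) = ennreal (real k) * indicator A x" for x
        proof (cases "x \<in> A")
          case True
          then have "(SUP n. F n x) = top" using A(2) by (auto simp: E_def less_top[symmetric])
          have "ennreal (real k) \<le> (SUP n. min (F n x) (ennreal (real k)))"
          proof (rule ccontr)
            assume "\<not> ennreal (real k) \<le> (SUP n. min (F n x) (ennreal (real k)))"
            then have "(SUP n. min (F n x) (ennreal (real k))) < ennreal (real k)" by simp
            then have "min (F n x) (ennreal (real k)) < ennreal (real k)" for n
              by (rule le_less_trans[OF SUP_upper[OF UNIV_I]])
            then have "F n x \<le> ennreal (real k)" for n by (simp add: min_less_iff_disj less_imp_le)
            then have "(SUP n. F n x) \<le> ennreal (real k)" by (intro SUP_least)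
            then show False using \<open>(SUP n. F n x) = top\<close> by (simp add: top_unique)
          qed
          moreover have "(SUP n. min (F n x) (ennreal (real k))) \<le> ennreal (real k)" by (intro SUP_least) simp
          ultimately show ?thesis using True by (simp add: H_def)
        qed (simp add: H_def)
        have "H n \<in> borel_measurable lebesgue" for n unfolding H_def by measurable
        then have H: "H n \<in> unit_ball X" for n
          by (rule L.unit_ball_solid[OF F[of n]]) (auto simp: H_def indicator_def)
        have "incseq H"
          using inc by (auto simp: H_def incseq_def le_fun_def indicator_def intro: min.coboundedI1)
        then have lim_ball: "(\<lambda>x. SUP n. H n x) \<in> unit_ball X"
          by (intro fatou_ball H) (auto simp: H_sup indicator_def)
        have "(\<lambda>x. enn2real (SUP n. H n x)) = (\<lambda>x. real k * indicat_real A x)"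
          by (auto simp: H_sup indicator_def)
        then have "fnorm X (\<lambda>x. real k * indicat_real A x) \<le> 1"
          using unit_ballD(4)[OF lim_ball] by simp
        then show ?thesis using norm_scale[OF A(4), of "real k"] by simp
      qed
      have "fnorm X (indicat_real A) = 0"
      proof (rule ccontr)
        assume "fnorm X (indicat_real A) \<noteq> 0"
        then have "0 < fnorm X (indicat_real A)" using norm_nonneg[OF A(4)] by simp
        then obtain k :: nat where "1 < real k * fnorm X (indicat_real A)"
          using reals_Archimedean3 by blast
        then show False using le1[of k] by simp
      qed
      then have "AE x in lebesgue. indicat_real A x = 0" using norm_eq_0_iff[OF A(4)] by simp
      then have "AE x in lebesgue. x \<notin> A" by eventually_elim (auto simp: indicator_def)
      then have "emeasure lebesgue A = 0" using A(1) by (subst (asm) AE_iff_measurable[OF _ refl]) auto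
      with A(3) show False by simp
    qed
    then show "(\<lambda>x. SUP n. F n x) \<in> unit_ball X" by (rule fatou_ball[OF F inc])
  qed
qed

section \<open>Convexity and concavity in terms of unit balls\<close>

lemma powr_root_add_le:
  fixes x y r :: real
  assumes "1 \<le> r" "0 \<le> x" "0 \<le> y"
  shows "(x powr r + y powr r) powr (1/r) \<le> x + y"
proof -
  have "ennreal x epowr r + ennreal y epowr r \<le> (ennreal x + ennreal y) epowr r"
    by (rule epowr_add_ge[OF assms(1)])
  then have "ennreal (x powr r + y powr r) \<le> ennreal ((x + y) powr r)"
    using assms by (simp add: epowr_ennreal ennreal_plus[symmetric] del: ennreal_plus)
  then have "x powr r + y powr r \<le> (x + y) powr r" by (subst (asm) ennreal_le_iff) auto
  then have "(x powr r + y powr r) powr (1/r) \<le> ((x + y) powr r) powr (1/r)"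
    using assms by (intro powr_mono2) auto
  then show ?thesis using assms by (simp add: powr_powr)
qed

text \<open>
  The function \<open>(|f|\<^sup>r + |g|\<^sup>r)\<^bsup>1/r\<^esup>\<close> of the convexity condition is the one that represents
  convex combinations in the ball of \<open>X\<^sup>r\<close>.
\<close>

lemma (in banach_function_space) convex_ball_power_if_p_convex:
  assumes r: "1 < r" and pc: "p_convex r X"
  shows "convex_ball (ball_power (unit_ball X) r)"
  unfolding convex_ball_def
proof (intro ballI allI impI)
  interpret L: lattice_seminorm X by (rule lattice_seminorm)
  fix F G :: "'a \<Rightarrow> ennreal" and s t :: real
  assume F: "F \<in> ball_power (unit_ball X) r" and G: "G \<in> ball_power (unit_ball X) r"
    and st: "0 \<le> s" "0 \<le> t" "s + t = 1"
  have [measurable]: "F \<in> borel_measurable lebesgue" "G \<in> borel_measurable lebesgue"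
    using F G by (auto simp: ball_power_def)
  define f where "f x = enn2real (F x epowr (1/r))" for x
  define g where "g x = enn2real (G x epowr (1/r))" for x
  have "(\<lambda>x. F x epowr (1/r)) \<in> unit_ball X" "(\<lambda>x. G x epowr (1/r)) \<in> unit_ball X"
    using F G by (simp_all add: ball_power_def)
  note f = unit_ballD(3,4,2)[OF this(1), folded f_def] and g = unit_ballD(3,4,2)[OF this(2), folded g_def]
  have fg_nonneg: "0 \<le> f x" "0 \<le> g x" for x by (simp_all add: f_def g_def)
  have [measurable]: "f \<in> borel_measurable lebesgue" "g \<in> borel_measurable lebesgue"
    by (rule measurable[OF f(1)], rule measurable[OF g(1)])
  define f1 where "f1 x = s powr (1/r) * f x" for x
  define g1 where "g1 x = t powr (1/r) * g x" for x
  have f1: "f1 \<in> fcarrier X" "fnorm X f1 \<le> s powr (1/r)"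
    using L.scale[OF f(1), of "s powr (1/r)"] f(2) mult_left_le[of "fnorm X f" "s powr (1/r)"] unfolding f1_def by simp_all
  have g1: "g1 \<in> fcarrier X" "fnorm X g1 \<le> t powr (1/r)"
    using L.scale[OF g(1), of "t powr (1/r)"] g(2) mult_left_le[of "fnorm X g" "t powr (1/r)"] unfolding g1_def by simp_all
  have nonneg1: "0 \<le> f1 x" "0 \<le> g1 x" for x using fg_nonneg by (simp_all add: f1_def g1_def)
  define k where "k x = (\<bar>f1 x\<bar> powr r + \<bar>g1 x\<bar> powr r) powr (1/r)" for x
  have k_nonneg: "0 \<le> k x" for x by (simp add: k_def)
  have k_meas: "k \<in> borel_measurable lebesgue" unfolding k_def f1_def g1_def by measurable
  have k_le: "\<bar>k x\<bar> \<le> \<bar>f1 x + g1 x\<bar>" for x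
    using powr_root_add_le[of r "f1 x" "g1 x"] r nonneg1[of x] k_nonneg[of x] by (simp add: k_def)
  have k_mem: "k \<in> fcarrier X"
    using ideal[OF add_mem[OF f1(1) g1(1)] k_meas] k_le by simp
  have "fnorm X k \<le> (fnorm X f1 powr r + fnorm X g1 powr r) powr (1/r)"
    using pc f1(1) g1(1) unfolding p_convex_def k_def by blast
  also have "\<dots> \<le> ((s powr (1/r)) powr r + (t powr (1/r)) powr r) powr (1/r)"
    using r f1(2) g1(2) norm_nonneg[OF f1(1)] norm_nonneg[OF g1(1)]
    by (intro powr_mono2 add_mono) auto
  also have "\<dots> = 1" using r st by (simp add: powr_powr)
  finally have k_ball: "(\<lambda>x. ennreal \<bar>k x\<bar>) \<in> unit_ball X" by (intro L.ennreal_in_unit_ball k_mem)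
  have le: "AE x in lebesgue. (ennreal s * F x + ennreal t * G x) epowr (1/r) \<le> ennreal \<bar>k x\<bar>"
    using f(3) g(3)
  proof eventually_elim
    fix x assume "F x epowr (1/r) < top" "G x epowr (1/r) < top"
    then have "F x < top" "G x < top" by simp_all
    then obtain a b where ab: "0 \<le> a" "F x = ennreal a" "0 \<le> b" "G x = ennreal b"
      by (auto simp: less_top_ennreal)
    have "\<bar>f1 x\<bar> powr r = s * a"
      using st ab r by (simp add: f1_def f_def epowr_ennreal abs_mult powr_mult powr_powr)
    moreover have "\<bar>g1 x\<bar> powr r = t * b"
      using st ab r by (simp add: g1_def g_def epowr_ennreal abs_mult powr_mult powr_powr)
    ultimately show "(ennreal s * F x + ennreal t * G x) epowr (1/r) \<le> ennreal \<bar>k x\<bar>"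
      using st ab by (simp add: k_def epowr_ennreal ennreal_mult[symmetric] ennreal_plus[symmetric] del: ennreal_plus)
  qed
  have "(\<lambda>x. (ennreal s * F x + ennreal t * G x) epowr (1/r)) \<in> borel_measurable lebesgue" by measurable
  then have "(\<lambda>x. (ennreal s * F x + ennreal t * G x) epowr (1/r)) \<in> unit_ball X"
    by (rule L.unit_ball_solid[OF k_ball _ le])
  then show "(\<lambda>x. ennreal s * F x + ennreal t * G x) \<in> ball_power (unit_ball X) r"
    by (intro ball_powerI) measurable
qed

text \<open>
  Concavity of \<open>X\<close> is convexity of \<open>X'\<close>. A function is paired with
  \<open>(s F + t G)\<^bsup>1/q'\<^esup>\<close> by splitting it into two pieces whose \<open>q\<close>-th powers add up to its own, in
  the proportion of equality in Hoelder's inequality.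
\<close>

lemma (in banach_function_space) convex_ball_power_polar_if_q_concave:
  assumes q: "1 < q" and qc: "q_concave q X"
  shows "convex_ball (ball_power (polar (unit_ball X)) (conjugate_exponent q))"
  unfolding convex_ball_def
proof (intro ballI allI impI)
  interpret L: lattice_seminorm X by (rule lattice_seminorm)
  define q' where "q' = conjugate_exponent q"
  have q': "1 < q'" "1/q' + 1/q = 1" using q by (simp_all add: q'_def conjugate_exponent_def field_simps)
  fix F G :: "'a \<Rightarrow> ennreal" and s t :: real
  assume "F \<in> ball_power (polar (unit_ball X)) (conjugate_exponent q)" "G \<in> ball_power (polar (unit_ball X)) (conjugate_exponent q)"
    and st: "0 \<le> s" "0 \<le> t" "s + t = 1"
  then have F: "F \<in> borel_measurable lebesgue" "(\<lambda>x. F x epowr (1/q')) \<in> polar (unit_ball X)"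
    and G: "G \<in> borel_measurable lebesgue" "(\<lambda>x. G x epowr (1/q')) \<in> polar (unit_ball X)"
    by (simp_all add: ball_power_def q'_def)
  note [measurable] = F(1) G(1)
  have ball_meas: "unit_ball X \<subseteq> borel_measurable lebesgue" by (auto simp: unit_ball_def)
  have fin: "AE x in lebesgue. F x epowr (1/q') < top" "AE x in lebesgue. G x epowr (1/q') < top"
    by (rule polar_finite_if_saturated[OF saturated_unit_ball F(2) ball_meas],
        rule polar_finite_if_saturated[OF saturated_unit_ball G(2) ball_meas])
  define H where "H x = (ennreal s * F x + ennreal t * G x) epowr (1/q')" for x
  have [measurable]: "H \<in> borel_measurable lebesgue" unfolding H_def by measurable
  have "H \<in> polar (unit_ball X)"
  proof (rule polarI)
    fix V assume V: "V \<in> unit_ball X"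
    define v where "v x = enn2real (V x)" for x
    note V' = unit_ballD[OF V, folded v_def]
    have [measurable]: "v \<in> borel_measurable lebesgue" by (rule measurable[OF V'(3)])
    have v_nonneg: "0 \<le> v x" for x by (simp add: v_def)
    define a where "a x = s * enn2real (F x)" for x
    define b where "b x = t * enn2real (G x)" for x
    have [measurable]: "a \<in> borel_measurable lebesgue" "b \<in> borel_measurable lebesgue" unfolding a_def b_def by measurable
    have ab: "0 \<le> a x" "0 \<le> b x" for x using st by (simp_all add: a_def b_def)
    define \<alpha> where "\<alpha> x = (a x / (a x + b x)) powr (1/q)" for x
    define \<beta> where "\<beta> x = (b x / (a x + b x)) powr (1/q)" for x
    have [measurable]: "\<alpha> \<in> borel_measurable lebesgue" "\<beta> \<in> borel_measurable lebesgue" unfolding \<alpha>_def \<beta>_def by measurable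
    have \<alpha>\<beta>: "0 \<le> \<alpha> x" "0 \<le> \<beta> x" for x by (simp_all add: \<alpha>_def \<beta>_def)
    have frac: "a x / (a x + b x) + b x / (a x + b x) \<le> 1" for x
      using ab[of x] by (simp add: add_divide_distrib[symmetric])
    have \<alpha>\<beta>_sum: "\<alpha> x powr q + \<beta> x powr q \<le> 1" for x
      using frac[of x] ab[of x] q by (simp add: \<alpha>_def \<beta>_def powr_powr)
    have le1: "\<alpha> x \<le> 1" "\<beta> x \<le> 1" for x
    proof -
      have "0 \<le> a x / (a x + b x)" "0 \<le> b x / (a x + b x)" using ab[of x] by simp_all
      then have "\<bar>a x / (a x + b x)\<bar> \<le> 1" "\<bar>b x / (a x + b x)\<bar> \<le> 1" using frac[of x] by linarith+
      then show "\<alpha> x \<le> 1" "\<beta> x \<le> 1"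
        unfolding \<alpha>_def \<beta>_def using q by (auto intro!: powr_le1)
    qed
    define v1 where "v1 x = v x * \<alpha> x" for x
    define v2 where "v2 x = v x * \<beta> x" for x
    have v1: "v1 \<in> fcarrier X" and v2: "v2 \<in> fcarrier X"
    proof -
      have "v1 \<in> borel_measurable lebesgue" "v2 \<in> borel_measurable lebesgue" unfolding v1_def v2_def by measurable
      moreover have "\<bar>v1 x\<bar> \<le> \<bar>v x\<bar>" "\<bar>v2 x\<bar> \<le> \<bar>v x\<bar>" for x
        using v_nonneg[of x] \<alpha>\<beta>[of x] le1[of x] by (simp_all add: v1_def v2_def mult_left_le)
      ultimately show "v1 \<in> fcarrier X" "v2 \<in> fcarrier X" using ideal[OF V'(3)] by simp_all
    qed
    define A where "A = fnorm X v1"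
    define C where "C = fnorm X v2"
    have AC: "0 \<le> A" "0 \<le> C" using norm_nonneg v1 v2 by (simp_all add: A_def C_def)
    have AC_sum: "A powr q + C powr q \<le> 1"
    proof -
      define w where "w x = (\<bar>v1 x\<bar> powr q + \<bar>v2 x\<bar> powr q) powr (1/q)" for x
      have w_meas: "w \<in> borel_measurable lebesgue" unfolding w_def v1_def v2_def by measurable
      have "\<bar>w x\<bar> \<le> \<bar>v x\<bar>" for x
      proof -
        have "\<bar>v1 x\<bar> powr q + \<bar>v2 x\<bar> powr q = v x powr q * (\<alpha> x powr q + \<beta> x powr q)"
          using v_nonneg[of x] \<alpha>\<beta>[of x] by (simp add: v1_def v2_def powr_mult distrib_left)
        also have "\<dots> \<le> v x powr q * 1" using \<alpha>\<beta>_sum by (intro mult_left_mono) auto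
        finally have "w x \<le> (v x powr q) powr (1/q)"
          unfolding w_def using q by (intro powr_mono2) auto
        then show ?thesis using q v_nonneg[of x] by (simp add: powr_powr w_def)
      qed
      then have "fnorm X w \<le> 1" using ideal[OF V'(3) w_meas] V'(4) by (simp add: order_trans)
      moreover have "(A powr q + C powr q) powr (1/q) \<le> fnorm X w"
        using qc v1 v2 unfolding q_concave_def A_def C_def w_def by blast
      ultimately have "(A powr q + C powr q) powr (1/q) \<le> 1" by simp
      then have "((A powr q + C powr q) powr (1/q)) powr q \<le> 1 powr q"
        using q by (intro powr_mono2) auto
      then show ?thesis using q by (simp add: powr_powr)
    qed
    have pointwise: "AE x in lebesgue. V x * H x = ennreal (s powr (1/q')) * (ennreal \<bar>v1 x\<bar> * F x epowr (1/q')) +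
        ennreal (t powr (1/q')) * (ennreal \<bar>v2 x\<bar> * G x epowr (1/q'))"
      using V'(2) fin
    proof eventually_elim
      fix x assume fin: "V x < top" "F x epowr (1/q') < top" "G x epowr (1/q') < top"
      from fin(2,3) have "F x < top" "G x < top" by simp_all
      then obtain c d where cd: "0 \<le> c" "F x = ennreal c" "0 \<le> d" "G x = ennreal d"
        by (auto simp: less_top_ennreal)
      have V_eq: "V x = ennreal (v x)" using fin(1) by (simp add: v_def)
      have a_eq: "a x = s * c" "b x = t * d" using cd by (simp_all add: a_def b_def)
      define D where "D = a x + b x"
      have D: "0 \<le> D" using ab[of x] by (simp add: D_def)
      have H_eq: "H x = ennreal (D powr (1/q'))"
        using cd st by (simp add: H_def D_def a_eq epowr_ennreal ennreal_mult[symmetric] ennreal_plus[symmetric] del: ennreal_plus)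
      have split: "D powr (1/q') = s powr (1/q') * (\<alpha> x * c powr (1/q')) + t powr (1/q') * (\<beta> x * d powr (1/q'))"
      proof (cases "D = 0")
        case False
        have piece: "y powr (1/q') * (y / D) powr (1/q) = y / D powr (1/q)" if "0 \<le> y" for y
        proof -
          have "y powr (1/q') * y powr (1/q) = y"
            using that q'(2) by (cases "y = 0") (simp_all add: powr_add[symmetric])
          then show ?thesis using that D by (simp add: powr_divide)
        qed
        have "s powr (1/q') * (\<alpha> x * c powr (1/q')) = a x / D powr (1/q)"
        proof -
          have "s powr (1/q') * (\<alpha> x * c powr (1/q')) = (s * c) powr (1/q') * (a x / D) powr (1/q)"
            using st cd by (simp add: \<alpha>_def D_def powr_mult mult_ac)
          then show ?thesis using piece[of "a x"] ab[of x] by (simp add: a_eq)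
        qed
        moreover have "t powr (1/q') * (\<beta> x * d powr (1/q')) = b x / D powr (1/q)"
        proof -
          have "t powr (1/q') * (\<beta> x * d powr (1/q')) = (t * d) powr (1/q') * (b x / D) powr (1/q)"
            using st cd by (simp add: \<beta>_def D_def powr_mult mult_ac)
          then show ?thesis using piece[of "b x"] ab[of x] by (simp add: a_eq)
        qed
        moreover have "D powr (1/q') = D / D powr (1/q)"
        proof -
          have "1/q' = 1 - 1/q" using q'(2) by simp
          then have "D powr (1/q') = D powr 1 / D powr (1/q)" by (simp only: powr_diff)
          then show ?thesis using D by simp
        qed
        ultimately show ?thesis by (simp add: D_def add_divide_distrib)
      next
        case True
        then have "a x = 0" "b x = 0" using ab[of x] by (auto simp: D_def)
        then show ?thesis using True by (simp add: \<alpha>_def \<beta>_def)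
      qed
      have "V x * H x = ennreal (v x * D powr (1/q'))"
        using v_nonneg[of x] by (simp add: V_eq H_eq ennreal_mult)
      also have "v x * D powr (1/q') = s powr (1/q') * (\<bar>v1 x\<bar> * c powr (1/q')) + t powr (1/q') * (\<bar>v2 x\<bar> * d powr (1/q'))"
        unfolding split using v_nonneg[of x] \<alpha>\<beta>[of x] by (simp add: v1_def v2_def algebra_simps)
      finally show "V x * H x = ennreal (s powr (1/q')) * (ennreal \<bar>v1 x\<bar> * F x epowr (1/q')) +
        ennreal (t powr (1/q')) * (ennreal \<bar>v2 x\<bar> * G x epowr (1/q'))"
        using cd by (simp add: epowr_ennreal ennreal_mult)
    qed
    have [measurable]: "v1 \<in> borel_measurable lebesgue" "v2 \<in> borel_measurable lebesgue"
      by (rule measurable[OF v1], rule measurable[OF v2])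
    have "(\<integral>\<^sup>+x. V x * H x \<partial>lebesgue) =
      (\<integral>\<^sup>+x. ennreal (s powr (1/q')) * (ennreal \<bar>v1 x\<bar> * F x epowr (1/q')) +
        ennreal (t powr (1/q')) * (ennreal \<bar>v2 x\<bar> * G x epowr (1/q')) \<partial>lebesgue)"
      using pointwise by (rule nn_integral_cong_AE)
    also have "\<dots> = ennreal (s powr (1/q')) * (\<integral>\<^sup>+x. ennreal \<bar>v1 x\<bar> * F x epowr (1/q') \<partial>lebesgue) +
        ennreal (t powr (1/q')) * (\<integral>\<^sup>+x. ennreal \<bar>v2 x\<bar> * G x epowr (1/q') \<partial>lebesgue)"
      by (simp add: nn_integral_add nn_integral_cmult)
    also have "\<dots> \<le> ennreal (s powr (1/q')) * ennreal A + ennreal (t powr (1/q')) * ennreal C"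
      unfolding A_def C_def
      by (intro add_mono mult_left_mono L.unit_ball_pairing_le F(2) G(2) v1 v2) auto
    also have "\<dots> = ennreal (s powr (1/q') * A + t powr (1/q') * C)"
      using AC by (simp add: ennreal_mult)
    also have "\<dots> \<le> 1"
    proof -
      have "s powr (1/q') * A \<le> s / q' + A powr q / q"
        using Youngs_inequality[OF q'(1) q q'(2), of "s powr (1/q')" A] AC st q' by (simp add: powr_powr)
      moreover have "t powr (1/q') * C \<le> t / q' + C powr q / q"
        using Youngs_inequality[OF q'(1) q q'(2), of "t powr (1/q')" C] AC st q' by (simp add: powr_powr)
      moreover have "s / q' + t / q' = 1 / q'" using st by (simp add: add_divide_distrib[symmetric])
      moreover have "A powr q / q + C powr q / q \<le> 1 / q"
        unfolding add_divide_distrib[symmetric] using AC_sum q by (intro divide_right_mono) auto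
      ultimately show ?thesis using q'(2) by simp
    qed
    finally show "(\<integral>\<^sup>+x. V x * H x \<partial>lebesgue) \<le> 1" .
  qed measurable
  then show "(\<lambda>x. ennreal s * F x + ennreal t * G x) \<in> ball_power (polar (unit_ball X)) (conjugate_exponent q)"
    unfolding H_def q'_def by (intro ball_powerI) measurable
qed

section \<open>The equivalences\<close>

lemma conjugate_exponent_involution: "1 < q \<Longrightarrow> conjugate_exponent (conjugate_exponent q) = q"
  by (simp add: conjugate_exponent_def field_simps)

lemma conjugate_exponent_range:
  assumes "1 < s0"
  shows "conjugate_exponent ` {s0..} = {1<..conjugate_exponent s0}"
proof (intro equalityI subsetI)
  have anti: "1 < conjugate_exponent q \<and> (p \<le> q \<longrightarrow> conjugate_exponent q \<le> conjugate_exponent p)"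
    if "1 < p" "1 < q" for p q :: real
    using that by (simp add: conjugate_exponent_def field_simps)
  fix r assume "r \<in> conjugate_exponent ` {s0..}"
  then show "r \<in> {1<..conjugate_exponent s0}" using anti[of s0] assms by auto
next
  have anti: "1 < conjugate_exponent q \<and> (p \<le> q \<longrightarrow> conjugate_exponent q \<le> conjugate_exponent p)"
    if "1 < p" "1 < q" for p q :: real
    using that by (simp add: conjugate_exponent_def field_simps)
  fix r assume r: "r \<in> {1<..conjugate_exponent s0}"
  then have "conjugate_exponent (conjugate_exponent s0) \<le> conjugate_exponent r"
    using anti[of r "conjugate_exponent s0"] anti[of s0 s0] assms by auto
  then have "conjugate_exponent r \<in> {s0..}" using assms by (simp add: conjugate_exponent_involution)
  moreover have "r = conjugate_exponent (conjugate_exponent r)"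
    using r by (simp add: conjugate_exponent_involution)
  ultimately show "r \<in> conjugate_exponent ` {s0..}" by (rule rev_image_eqI)
qed

theorem corollary3p2:
  fixes X :: "'a::euclidean_space fspace" and r_star s_star :: real
  assumes "banach_function_space X"
    and "1 < r_star" and "r_star < s_star"
    and "p_convex r_star X" and "q_concave s_star X"
  shows "(maximal_bounded X \<and> maximal_bounded (associate X)
            \<longleftrightarrow> (\<exists>r\<in>{1<..r_star}. maximal_bounded (associate (fpower X r))))
       \<and> ((\<exists>r\<in>{1<..r_star}. maximal_bounded (associate (fpower X r)))
            \<longleftrightarrow> (\<exists>s\<in>{s_star..}. maximal_bounded (rescaled X 1 s)))"
proof -
  interpret banach_function_space X by fact
  interpret L: lattice_seminorm X by (rule lattice_seminorm)
  define B where "B = unit_ball X"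
  have s_star: "1 < s_star" using assms by simp
  have B: "normal_ball B" "saturated_ball B"
    unfolding B_def by (rule normal_unit_ball, rule saturated_unit_ball)
  have B_meas: "B \<subseteq> borel_measurable lebesgue" by (auto simp: B_def unit_ball_def)
  have conv: "convex_ball (ball_power B r_star)"
    unfolding B_def using assms by (intro convex_ball_power_if_p_convex)
  have "convex_ball B"
    using convex_ball_power_mono[OF B(1) conv, of 1] assms(2) ball_power_one[OF B(1)] by simp
  then have bip: "polar (polar B) = B" by (rule bipolar_eq[OF B(1)])
  have polB: "normal_ball (polar B)" by (rule normal_ball_polar[OF B_meas])
  have sat_pol: "saturated_ball (polar B)"
    by (rule saturated_polar[OF bip]) (simp add: B_def unit_ballD(2))
  have conv': "convex_ball (ball_power (polar B) (conjugate_exponent s_star))"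
    unfolding B_def using s_star assms by (intro convex_ball_power_polar_if_q_concave)
  have s_star': "1 < conjugate_exponent s_star" using s_star by (simp add: conjugate_exponent_def)
  have assoc_power: "lattice_seminorm (associate (fpower X r)) \<and> unit_ball (associate (fpower X r)) = polar (ball_power B r)"
    if r: "0 < r" for r
  proof -
    interpret P: lattice_seminorm "fpower X r" by (rule L.lattice_seminorm_fpower[OF r])
    have "unit_ball (fpower X r) = ball_power B r" unfolding B_def by (rule L.unit_ball_fpower[OF r])
    then show ?thesis
      using P.lattice_seminorm_associate P.unit_ball_associate saturated_ball_power[OF B r] by simp
  qed
  have i_X: "maximal_bounded X \<longleftrightarrow> ball_maximal B" unfolding B_def by (rule L.maximal_bounded_iff)
  have i_assoc: "maximal_bounded (associate X) \<longleftrightarrow> ball_maximal (polar B)"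
    using lattice_seminorm.maximal_bounded_iff[OF L.lattice_seminorm_associate]
      L.unit_ball_associate[OF saturated_unit_ball] by (simp add: B_def)
  have ii: "maximal_bounded (associate (fpower X r)) \<longleftrightarrow> ball_maximal (polar (ball_power B r))" if "0 < r" for r
    using assoc_power[OF that] lattice_seminorm.maximal_bounded_iff by metis
  have iii: "maximal_bounded (rescaled X 1 s) \<longleftrightarrow> ball_maximal (polar (ball_power (polar B) (conjugate_exponent s)))"
    if s: "1 < s" for s
  proof -
    have c: "0 < conjugate_exponent s" using s by (simp add: conjugate_exponent_def)
    interpret A: lattice_seminorm "associate (fpower X 1)" using assoc_power[of 1] by simp
    have A_ball: "unit_ball (associate (fpower X 1)) = polar B"
      using assoc_power[of 1] ball_power_one[OF B(1)] by simp
    interpret P: lattice_seminorm "fpower (associate (fpower X 1)) (conjugate_exponent s)"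
      by (rule A.lattice_seminorm_fpower[OF c])
    have P_ball: "unit_ball (fpower (associate (fpower X 1)) (conjugate_exponent s)) = ball_power (polar B) (conjugate_exponent s)"
      using A.unit_ball_fpower[OF c] A_ball by simp
    have "unit_ball (rescaled X 1 s) = polar (ball_power (polar B) (conjugate_exponent s))"
      using P.unit_ball_associate saturated_ball_power[OF polB sat_pol c] P_ball by (simp add: rescaled_def)
    then show ?thesis
      using lattice_seminorm.maximal_bounded_iff[OF P.lattice_seminorm_associate] by (simp add: rescaled_def)
  qed
  have "ball_maximal B \<and> ball_maximal (polar B) \<longleftrightarrow> (\<exists>r\<in>{1<..r_star}. ball_maximal (polar (ball_power B r)))"
    by (rule ball_maximal_iff_polar_power[OF B(1) assms(2) conv])
  moreover have "ball_maximal B \<and> ball_maximal (polar B) \<longleftrightarrow>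
      (\<exists>r\<in>{1<..conjugate_exponent s_star}. ball_maximal (polar (ball_power (polar B) r)))"
    using ball_maximal_iff_polar_power[OF polB s_star' conv'] unfolding bip by blast
  moreover have "(\<exists>r\<in>{1<..conjugate_exponent s_star}. ball_maximal (polar (ball_power (polar B) r))) \<longleftrightarrow>
      (\<exists>s\<in>{s_star..}. maximal_bounded (rescaled X 1 s))"
    unfolding conjugate_exponent_range[OF s_star, symmetric] using iii s_star by auto
  moreover have "(\<exists>r\<in>{1<..r_star}. maximal_bounded (associate (fpower X r))) \<longleftrightarrow>
      (\<exists>r\<in>{1<..r_star}. ball_maximal (polar (ball_power B r)))"
    using ii by auto
  ultimately show ?thesis using i_X i_assoc by simp
qed

end
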